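(* Let $d>1$ be odd, $0\le r_0<r_1\le\infty$, and let $f:A(r_0,r_1)\to\mathbb{C}$ be polyharmonic of infinite order and type $\tau<1/(2r_1)$. Then there exist analytic functions $$f_1:\{z\in\mathbb{C}^d:L_+(z)<r_1\}\to\mathbb{C},\qquad f_2:\{z\in\mathbb{C}^d:r_0<L_-(z)\le L_+(z)<1/(2\tau)\}\to\mathbb{C}$$ such that $$F(z)=f_1(z)+(z_1^2+\dots+z_d^2)^{(2-d)/2}f_2(z),$$ defined for all $z\in\widetilde A(r_0,r_1)\setminus q^{-1}((-\infty,0])$ (using the principal branch of the power), is analytic there and satisfies $F(x)=f(x)$ for all $x\in A(r_0,r_1)$.
   Context: Conventions: $1/(2\tau)=\infty$ if $\tau=0$. $A(r_0,r_1)=\{x\in\mathbb{R}^d: r_0<|x|<r_1\}$. A function $f:G\to\mathbb{C}$ on a domain $G\subset\mathbb{R}^d$ is polyharmonic of infinite order and type $\tau\ge0$ if $f\in C^\infty(G)$ and for every compact $K\subset G$ and every $\varepsilon>0$ there is $C_{K,\varepsilon}>0$ with $\max_{x\in K}|\Delta^p f(x)|\le C_{K,\varepsilon}(2p)!(\tau+\varepsilon)^{2p}$ for all $p\in\mathbb{N}_0$. For $z\in\mathbb{C}^d$: $|z|_{\mathbb{C}^d}^2=|z_1|^2+\dots+|z_d|^2$, $q(z)=z_1^2+\dots+z_d^2$, and the Lie norms are $L_\pm(z)=\sqrt{|z|_{\mathbb{C}^d}^2\pm\sqrt{|z|_{\mathbb{C}^d}^4-|q(z)|^2}}$. The Lie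 annulus is $\widetilde A(r_0,r_1)=\{z\in\mathbb{C}^d: r_0<L_-(z)\text{ and }L_+(z)<r_1\}$. *)

theory Defs
  imports "HOL-Analysis.Analysis"
begin

definition annulus :: "real \<Rightarrow> ereal \<Rightarrow> (real^'n) set" where
  "annulus r0 r1 = {x. r0 < norm x \<and> ereal (norm x) < r1}"

definition partial :: "'n::finite \<Rightarrow> (real^'n \<Rightarrow> complex) \<Rightarrow> real^'n \<Rightarrow> complex" where
  "partial i g x = frechet_derivative g (at x) (axis i 1)"

definition smooth_on :: "(real^'n::finite) set \<Rightarrow> (real^'n \<Rightarrow> complex) \<Rightarrow> bool" where
  "smooth_on G g \<longleftrightarrow> (\<forall>is. \<forall>x\<in>G. (foldr partial is g) differentiable (at x))"

definition laplacian :: "(real^'n::finite \<Rightarrow> complex) \<Rightarrow> real^'n \<Rightarrow> complex" where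
  "laplacian g x = (\<Sum>i\<in>UNIV. partial i (partial i g) x)"

definition polyharmonic_inf_type ::
    "(real^'n::finite) set \<Rightarrow> real \<Rightarrow> (real^'n \<Rightarrow> complex) \<Rightarrow> bool" where
  "polyharmonic_inf_type G \<tau> f \<longleftrightarrow>
     smooth_on G f \<and>
     (\<forall>K. compact K \<and> K \<subseteq> G \<longrightarrow>
        (\<forall>\<epsilon>>0. \<exists>C>0. \<forall>p::nat. \<forall>x\<in>K.
            norm ((laplacian ^^ p) f x) \<le> C * fact (2*p) * (\<tau> + \<epsilon>) ^ (2*p)))"

definition qform :: "complex^'n::finite \<Rightarrow> complex" where
  "qform z = (\<Sum>k\<in>UNIV. (z$k)^2)"

definition sqnormC :: "complex^'n::finite \<Rightarrow> real" where
  "sqnormC z = (\<Sum>k\<in>UNIV. (cmod (z$k))^2)"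

definition Lie_plus :: "complex^'n::finite \<Rightarrow> real" where
  "Lie_plus z = sqrt (sqnormC z + sqrt ((sqnormC z)^2 - (cmod (qform z))^2))"

definition Lie_minus :: "complex^'n::finite \<Rightarrow> real" where
  "Lie_minus z = sqrt (sqnormC z - sqrt ((sqnormC z)^2 - (cmod (qform z))^2))"

definition Lie_annulus :: "real \<Rightarrow> ereal \<Rightarrow> (complex^'n::finite) set" where
  "Lie_annulus r0 r1 = {z. r0 < Lie_minus z \<and> ereal (Lie_plus z) < r1}"

definition inv_two :: "real \<Rightarrow> ereal" where
  "inv_two \<tau> = (if \<tau> = 0 then \<infinity> else ereal (1 / (2 * \<tau>)))"

text \<open>Complex analyticity in several variables: near every point of S the function is
  the sum of an (absolutely, i.e. unconditionally) convergent power series.\<close>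
definition analytic_on_Cn :: "(complex^'n::finite) set \<Rightarrow> (complex^'n \<Rightarrow> complex) \<Rightarrow> bool" where
  "analytic_on_Cn S g \<longleftrightarrow> open S \<and>
     (\<forall>a\<in>S. \<exists>r>0. \<exists>c :: ('n \<Rightarrow> nat) \<Rightarrow> complex. \<forall>z\<in>ball a r.
        ((\<lambda>\<alpha>. c \<alpha> * (\<Prod>k\<in>UNIV. (z$k - a$k) ^ (\<alpha> k))) has_sum g z) UNIV)"

definition complexify :: "real^'n::finite \<Rightarrow> complex^'n" where
  "complexify x = (\<chi> k. complex_of_real (x$k))"

end

theory Submission
  imports Defs "HOL-Complex_Analysis.Complex_Analysis" "HOL-Real_Asymp.Real_Asymp"
begin

text \<open>
  Let \<open>k\<^sub>0, k\<^sub>1, \<dots>\<close> be radial kernels with \<open>\<Delta> k\<^bsub>p+1\<^esub> = k\<^sub>p\<close>, where \<open>k\<^sub>0\<close> is the fundamental solution; since \<open>d\<close>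
  is odd, \<open>k\<^sub>p(x - y)\<close> is a multiple of \<open>\<bar>x - y\<bar>\<close> to the power \<open>2p + 2 - d\<close>, of size about \<open>1/(2p)!\<close>. Multiply by a radial cutoff \<open>\<chi>\<close> that is
  \<open>1\<close> near \<open>x\<close> and integrate by parts repeatedly: up to a constant, \<open>f(x)\<close> is the sum over \<open>p\<close> of the integrals
  of \<open>(2 \<nabla>\<chi> \<bullet> \<nabla>k\<^sub>p + k\<^sub>p \<Delta>\<chi>) \<Delta>\<^sup>p f\<close>, which converges because of the type bound. The integrand lives on two thin shells,
  one near each boundary sphere. In the outer shell part, \<open>x\<close> may be replaced by any complex \<open>z\<close> with \<open>L\<^sub>+(z) < \<bar>y\<bar>\<close>; this is \<open>f\<^sub>1\<close>.
  In the inner one, after dividing by \<open>q(z)\<close> to the power \<open>(2 - d)/2\<close>, \<open>x\<close> may be replaced by any \<open>z\<close> with \<open>\<bar>y\<bar> < L\<^sub>-(z)\<close>; this is \<open>f\<^sub>2\<close>.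
  The same integration by parts shows that neither sum depends on the position of its shell, so the shells can be pushed to the boundary.
\<close>

text \<open>The kernel is singular at y = x, so the integration by parts is not applied to it
  directly. Its argument q(z - y) is shifted by e = delta^2: for real z the kernel becomes smooth,
  at the price of an extra term in its Laplacian. For p = 0 this term is a multiple of delta^2 / (|x
  - y|^2 + delta^2)^((d+2)/2), an approximate identity that reproduces f(x); for p > 0 it carries a
  further factor that tends to 0. Odd d keeps p + 1 - d/2 away from 0, so no logarithmic kernels
  arise. Since |q(z - y)| is at most (L_+(z) + |y|)^2, the series converge when (L_+(z) + |y|) tau <
  1. As |y| < r1 < 1/(2 tau), the condition L_+(z) < 1/(2 tau) suffices, whence the domain of f2.
  The half-integer power is taken of a quotient by l, where l = 1 in the outer series and l = q(z)
  in the inner one: q(z) may wind around 0, but the quotient stays off the branch cut. The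
  admissible shells depend on z, so they are frozen near each point. Analyticity then follows from
  separate holomorphy and local boundedness.\<close>

section \<open>Partial derivatives and integration by parts\<close>

text \<open>A one-dimensional derivative along a coordinate line, given as a relation. Kernels and
  cutoffs then get their partial derivatives from the product and chain rules, without a proof of
  Frechet differentiability, on which \<open>partial\<close> depends.\<close>

definition has_partial :: "'n::finite \<Rightarrow> (real^'n \<Rightarrow> complex) \<Rightarrow> complex \<Rightarrow> real^'n \<Rightarrow> bool" where
  "has_partial i g g' y \<longleftrightarrow> ((\<lambda>t. g (y + t *\<^sub>R axis i 1)) has_vector_derivative g') (at 0)"

lemma has_partial_const: "has_partial i (\<lambda>_. c) 0 y"
  by (simp add: has_partial_def)

lemma has_partial_add:
  "has_partial i f f' y \<Longrightarrow> has_partial i g g' y \<Longrightarrow> has_partial i (\<lambda>y. f y + g y) (f' + g') y"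
  unfolding has_partial_def by (rule has_vector_derivative_add)

lemma has_partial_diff:
  "has_partial i f f' y \<Longrightarrow> has_partial i g g' y \<Longrightarrow> has_partial i (\<lambda>y. f y - g y) (f' - g') y"
  unfolding has_partial_def by (rule has_vector_derivative_diff)

lemma has_partial_mult:
  assumes "has_partial i f f' y" "has_partial i g g' y"
  shows "has_partial i (\<lambda>y. f y * g y) (f y * g' + f' * g y) y"
  using has_vector_derivative_mult[OF assms[unfolded has_partial_def]]
  by (simp add: has_partial_def)

lemma has_partial_compose:
  assumes "has_partial i f f' y" "(F has_field_derivative F') (at (f y))"
  shows "has_partial i (\<lambda>y. F (f y)) (F' * f') y"
  using field_vector_diff_chain_at[of "\<lambda>t. f (y + t *\<^sub>R axis i 1)" f' 0 F F'] assms
  by (simp add: has_partial_def o_def mult.commute)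

lemma has_partial_unique: "has_partial i f a y \<Longrightarrow> has_partial i f b y \<Longrightarrow> a = b"
  unfolding has_partial_def by (rule vector_derivative_unique_at)

lemma has_partial_cong_open:
  assumes "has_partial i f f' y" "open S" "y \<in> S" "\<And>x. x \<in> S \<Longrightarrow> f x = g x"
  shows "has_partial i g f' y"
proof -
  define h where "h = (\<lambda>t::real. y + t *\<^sub>R axis i 1)"
  have "open (h -` S)"
    unfolding h_def by (intro open_vimage assms continuous_intros)
  from has_vector_derivative_transform_within_open[OF _ this, of "\<lambda>t. f (h t)" f' 0 "\<lambda>t. g (h t)"]
  show ?thesis
    using assms unfolding has_partial_def h_def by simp
qed

lemma differentiable_imp_has_partial:
  assumes "g differentiable (at y)"
  shows "has_partial i g (partial i g y) y"
proof -
  define D where "D = frechet_derivative g (at y)"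
  have D: "(g has_derivative D) (at y)"
    using assms D_def frechet_derivative_works by blast
  have "((\<lambda>t::real. y + t *\<^sub>R axis i 1) has_derivative (\<lambda>t. t *\<^sub>R axis i 1)) (at 0)"
    by (auto intro!: derivative_eq_intros)
  from has_derivative_compose[OF this, of g D] D
  have "((\<lambda>t. g (y + t *\<^sub>R axis i 1)) has_derivative (\<lambda>t. D (t *\<^sub>R axis i 1))) (at 0)"
    by simp
  moreover have "linear D" using D has_derivative_linear by blast
  ultimately show ?thesis
    unfolding has_partial_def has_vector_derivative_def partial_def D_def[symmetric]
    by (simp add: linear_scale)
qed

lemma has_partial_shift:
  assumes "has_partial i g g' (y + s *\<^sub>R axis i 1)"
  shows "((\<lambda>t. g (y + t *\<^sub>R axis i 1)) has_vector_derivative g') (at s)"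
proof -
  have 1: "((\<lambda>t. t - s) has_vector_derivative 1) (at s)"
    by (auto intro!: derivative_eq_intros simp: has_vector_derivative_diff_const)
  have "((\<lambda>t. g (y + s *\<^sub>R axis i 1 + t *\<^sub>R axis i 1)) \<circ> (\<lambda>t. t - s) has_vector_derivative 1 *\<^sub>R g') (at s)"
    by (rule vector_diff_chain_at[OF 1]) (use assms in \<open>simp add: has_partial_def\<close>)
  moreover have "(\<lambda>t. g (y + s *\<^sub>R axis i 1 + t *\<^sub>R axis i 1)) \<circ> (\<lambda>t. t - s) = (\<lambda>t. g (y + t *\<^sub>R axis i 1))"
    by (simp add: fun_eq_iff algebra_simps)
  ultimately show ?thesis by simp
qed

text \<open>Translation invariance of Lebesgue measure makes every difference quotient of
  \<open>g\<close> in direction \<open>i\<close> integrate to 0, and dominated convergence carries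
  this over to the derivative.\<close>

lemma integral_has_partial_eq_0:
  fixes g :: "real^'n::finite \<Rightarrow> complex"
  assumes K: "compact K" and der: "\<And>y. has_partial i g (g' y) y"
    and g0: "\<And>y. y \<notin> K \<Longrightarrow> g y = 0" and g'0: "\<And>y. y \<notin> K \<Longrightarrow> g' y = 0"
    and cg: "continuous_on K g" and cg': "continuous_on K g'"
  shows "(LINT y|lborel. g' y) = 0"
proof -
  define e :: "real^'n" where "e = axis i 1"
  have eq: "(\<lambda>x. indicator K x *\<^sub>R g x) = g" "(\<lambda>x. indicator K x *\<^sub>R g' x) = g'"
    using g0 g'0 by (auto simp: fun_eq_iff indicator_def)
  have intg: "integrable lborel g" "integrable lborel g'"
    using borel_integrable_compact[OF K cg] borel_integrable_compact[OF K cg'] by (simp_all add: eq)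
  have "bounded (g' ` K)"
    using K cg' by (simp add: compact_continuous_image compact_imp_bounded)
  then obtain B where "\<And>y. y \<in> K \<Longrightarrow> norm (g' y) \<le> B"
    by (auto simp: bounded_iff)
  then have B: "norm (g' y) \<le> max B 0" for y
    using g'0[of y] by (cases "y \<in> K") (auto intro: max.cobounded1 order_trans)
  define B' where "B' = max B 0"
  obtain R where R: "\<And>y. y \<in> K \<Longrightarrow> norm y \<le> R"
    using compact_imp_bounded[OF K] unfolding bounded_iff by auto
  define t where "t = (\<lambda>n::nat. 1 / (real n + 1))"
  have tpos: "0 < t n" "t n \<le> 1" for n by (auto simp: t_def)
  have t0: "t \<longlonglongrightarrow> 0" unfolding t_def by real_asymp
  define F where "F = (\<lambda>n y. (g (y + t n *\<^sub>R e) - g y) /\<^sub>R t n)"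
  \<comment> \<open>The mean value inequality along the line bounds the difference quotients
    independently of the step; this is the dominating constant.\<close>
  have lip: "norm (g (y + s *\<^sub>R e) - g y) \<le> B' * s" if "s > 0" for s y
  proof -
    have d: "((\<lambda>t. g (y + t *\<^sub>R e)) has_vector_derivative g' (y + r *\<^sub>R e)) (at r)" for r
      unfolding e_def by (rule has_partial_shift) (rule der)
    have "norm (g (y + s *\<^sub>R e) - g (y + 0 *\<^sub>R e)) \<le> B' * s - B' * 0"
    proof (rule differentiable_bound_general[OF that])
      show "continuous_on {0..s} (\<lambda>t. g (y + t *\<^sub>R e))"
        by (intro continuous_at_imp_continuous_on ballI has_vector_derivative_continuous[OF d])
      show "((\<lambda>s. B' * s) has_vector_derivative B') (at x)" for x
        by (auto intro!: derivative_eq_intros simp flip: has_real_derivative_iff_has_vector_derivative)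
    qed (use d B in \<open>auto intro!: continuous_intros simp: B'_def\<close>)
    then show ?thesis by simp
  qed
  have shift: "(LINT y|lborel. g (a + y)) = (LINT y|lborel. g y)" "integrable lborel (\<lambda>y. g (a + y))" for a
  proof -
    have [measurable]: "g \<in> borel_measurable borel"
      using intg(1) by (simp add: integrable_iff_bounded)
    show "(LINT y|lborel. g (a + y)) = (LINT y|lborel. g y)"
      using integral_distr[of "(+) a" lborel borel g] by (simp add: lborel_distr_plus)
    show "integrable lborel (\<lambda>y. g (a + y))"
      using integrable_distr_eq[of "(+) a" lborel borel g] intg(1) by (simp add: lborel_distr_plus)
  qed
  have F0: "(LINT y|lborel. F n y) = 0" for n
    unfolding F_def using shift[of "t n *\<^sub>R e"] intg(1) by (simp add: add.commute)
  \<comment> \<open>The steps \<open>t n\<close> are at most 1, so all quotients vanish outside the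
    ball of radius \<open>R + 1\<close>.\<close>
  have "(\<lambda>n. LINT y|lborel. F n y) \<longlonglongrightarrow> (LINT y|lborel. g' y)"
  proof (rule integral_dominated_convergence[where w = "\<lambda>y. indicator (cball 0 (R+1)) y *\<^sub>R B'"])
    show "integrable lborel (\<lambda>y::real^'n. indicator (cball 0 (R+1)) y *\<^sub>R B')"
      by (intro borel_integrable_compact) auto
    show "AE y in lborel. (\<lambda>n. F n y) \<longlonglongrightarrow> g' y"
    proof (rule AE_I2)
      fix y
      have lim0: "((\<lambda>t. norm (g (y + t *\<^sub>R e) - g y - t *\<^sub>R g' y) / norm t) \<longlongrightarrow> 0) (at 0)"
        using der[of y] unfolding has_partial_def has_vector_derivative_def has_derivative_at e_def by simp
      have lim_eq: "norm (g (y + t *\<^sub>R e) - g y - t *\<^sub>R g' y) / norm t =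
          norm ((g (y + t *\<^sub>R e) - g y) /\<^sub>R t - g' y)" if "t \<noteq> 0" for t
      proof -
        have "(g (y + t *\<^sub>R e) - g y) /\<^sub>R t - g' y = (g (y + t *\<^sub>R e) - g y - t *\<^sub>R g' y) /\<^sub>R t"
          using that by (simp add: scaleR_diff_right)
        then show ?thesis by (simp add: divide_inverse mult.commute)
      qed
      from lim0 have "((\<lambda>t. norm ((g (y + t *\<^sub>R e) - g y) /\<^sub>R t - g' y)) \<longlongrightarrow> 0) (at 0)"
        by (rule Lim_transform_within[OF _ zero_less_one]) (use lim_eq in auto)
      then have "((\<lambda>t. (g (y + t *\<^sub>R e) - g y) /\<^sub>R t) \<longlongrightarrow> g' y) (at 0)"
        unfolding tendsto_norm_zero_iff by (rule LIM_zero_cancel)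
      moreover have "filterlim t (at 0) sequentially"
        using t0 tpos(1) by (auto simp: filterlim_at intro!: always_eventually) (metis less_irrefl)
      ultimately have "(\<lambda>n. (g (y + t n *\<^sub>R e) - g y) /\<^sub>R t n) \<longlonglongrightarrow> g' y"
        by (rule filterlim_compose)
      then show "(\<lambda>n. F n y) \<longlonglongrightarrow> g' y"
        unfolding F_def .
    qed
    show "AE y in lborel. norm (F n y) \<le> indicator (cball 0 (R+1)) y *\<^sub>R B'" for n
    proof (rule AE_I2)
      fix y
      show "norm (F n y) \<le> indicator (cball 0 (R+1)) y *\<^sub>R B'"
      proof (cases "y \<in> cball 0 (R+1)")
        case True
        then show ?thesis
          using lip[OF tpos(1)[of n], of y] tpos(1)[of n]
          by (simp add: F_def pos_divide_le_eq mult.commute flip: divide_inverse_commute)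
      next
        case False
        have "norm (y + t n *\<^sub>R e) \<ge> norm y - norm (t n *\<^sub>R e)"
          by (metis norm_diff_ineq)
        then have "norm (y + t n *\<^sub>R e) > R" "norm y > R"
          using False tpos[of n] by (auto simp: e_def)
        then show ?thesis
          using R[of y] R[of "y + t n *\<^sub>R e"] g0[of y] g0[of "y + t n *\<^sub>R e"] False
          by (cases "y \<in> K"; cases "y + t n *\<^sub>R e \<in> K") (auto simp: F_def)
      qed
    qed
    show "F n \<in> borel_measurable lborel" for n
      unfolding F_def using shift(2)[of "t n *\<^sub>R e"] intg(1)
      by (intro borel_measurable_scaleR borel_measurable_diff borel_measurable_integrable)
         (auto simp: add.commute)
  qed (use intg in \<open>auto simp: integrable_iff_bounded\<close>)
  then show ?thesis
    using F0 LIMSEQ_unique by (simp add: LIMSEQ_const_iff)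
qed

text \<open>Green's identity for \<open>w k\<close> and \<open>u\<close>: for each \<open>i\<close>
  the difference of the two integrands is the i-th derivative of \<open>g i\<close>, which has
  compact support. The cutoff \<open>w\<close> confines everything to \<open>K\<close>, so
  \<open>k\<close> may be singular elsewhere.\<close>

lemma integral_laplacian_by_parts:
  fixes w k u :: "real^'n::finite \<Rightarrow> complex"
  assumes K: "compact K"
    and w: "\<And>i y. has_partial i w (w1 i y) y" "\<And>i y. has_partial i (w1 i) (w2 i y) y"
    and w0: "\<And>y. y \<notin> K \<Longrightarrow> w y = 0" "\<And>i y. y \<notin> K \<Longrightarrow> w1 i y = 0" "\<And>i y. y \<notin> K \<Longrightarrow> w2 i y = 0"
    and k: "\<And>i y. y \<in> K \<Longrightarrow> has_partial i k (k1 i y) y" "\<And>i y. y \<in> K \<Longrightarrow> has_partial i (k1 i) (k2 i y) y"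
    and u: "\<And>i y. y \<in> K \<Longrightarrow> has_partial i u (u1 i y) y" "\<And>i y. y \<in> K \<Longrightarrow> has_partial i (u1 i) (u2 i y) y"
    and cw: "continuous_on K w" "\<And>i. continuous_on K (w1 i)" "\<And>i. continuous_on K (w2 i)"
    and ck: "continuous_on K k" "\<And>i. continuous_on K (k1 i)" "\<And>i. continuous_on K (k2 i)"
    and cu: "continuous_on K u" "\<And>i. continuous_on K (u1 i)" "\<And>i. continuous_on K (u2 i)"
  shows "(LINT y:K|lborel. w y * k y * (\<Sum>i\<in>UNIV. u2 i y)) =
         (LINT y:K|lborel. (\<Sum>i\<in>UNIV. w2 i y * k y + 2 * w1 i y * k1 i y + w y * k2 i y) * u y)"
proof -
  define D where "D = (\<lambda>i y. (w2 i y * k y + 2 * w1 i y * k1 i y + w y * k2 i y) * u y - w y * k y * u2 i y)"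
  define g where "g = (\<lambda>i y. (w1 i y * k y + w y * k1 i y) * u y - (w y * k y) * u1 i y)"
  have D0: "D i y = 0" if "y \<notin> K" for i y using w0[OF that] by (simp add: D_def)
  have cD: "continuous_on K (D i)" for i
    unfolding D_def by (intro continuous_intros assms)
  have "(LINT y|lborel. D i y) = 0" for i
  proof (rule integral_has_partial_eq_0[OF K, where g = "g i" and i = i])
    show "has_partial i (g i) (D i y) y" for y
    proof (cases "y \<in> K")
      case True
      have "has_partial i (g i)
        (((w1 i y * k y + w y * k1 i y) * u1 i y + ((w1 i y * k1 i y + w2 i y * k y) + (w y * k2 i y + w1 i y * k1 i y)) * u y)
          - ((w y * k y) * u2 i y + (w y * k1 i y + w1 i y * k y) * u1 i y)) y"
        unfolding g_def
        by (intro has_partial_diff has_partial_mult has_partial_add w k[OF True] u[OF True])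
      then show ?thesis by (simp add: D_def algebra_simps)
    next
      case False
      \<comment> \<open>Near a point off \<open>K\<close> the function \<open>g i\<close> vanishes
        identically, whatever \<open>k\<close> and \<open>u\<close> do there.\<close>
      have "open (- K)" using K by (simp add: compact_imp_closed open_Compl)
      from has_partial_cong_open[OF has_partial_const this, of y 0 "g i" i] False
      show ?thesis using w0 by (simp add: g_def D0)
    qed
    show "g i y = 0" if "y \<notin> K" for y using w0[OF that] by (simp add: g_def)
    show "continuous_on K (g i)"
      unfolding g_def by (intro continuous_intros assms)
  qed (use D0 cD in auto)
  moreover have "(\<lambda>y. indicator K y *\<^sub>R D i y) = D i" for i
    using D0 by (auto simp: fun_eq_iff indicator_def)
  then have intD: "integrable lborel (D i)" for i
    using borel_integrable_compact[OF K cD[of i]] by simp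
  ultimately have "(LINT y|lborel. (\<Sum>i\<in>UNIV. D i y)) = 0" by simp
  moreover have "(\<Sum>i\<in>UNIV. D i y) = indicator K y *\<^sub>R
      ((\<Sum>i\<in>UNIV. w2 i y * k y + 2 * w1 i y * k1 i y + w y * k2 i y) * u y) -
      indicator K y *\<^sub>R (w y * k y * (\<Sum>i\<in>UNIV. u2 i y))" for y
    using D0[of y] by (cases "y \<in> K") (simp_all add: D_def sum_subtractf sum_distrib_left sum_distrib_right)
  moreover have "integrable lborel (\<lambda>y. indicator K y *\<^sub>R
      ((\<Sum>i\<in>UNIV. w2 i y * k y + 2 * w1 i y * k1 i y + w y * k2 i y) * u y))"
    by (intro borel_integrable_compact K continuous_intros assms)
  moreover have "integrable lborel (\<lambda>y. indicator K y *\<^sub>R (w y * k y * (\<Sum>i\<in>UNIV. u2 i y)))"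
    by (intro borel_integrable_compact K continuous_intros assms)
  ultimately show ?thesis
    by (simp add: set_lebesgue_integral_def)
qed

section \<open>Holomorphic dependence on a parameter\<close>

text \<open>A bound on \<open>f\<close> alone is enough to differentiate under the integral:
  Cauchy's inequality turns it into a bound on the derivative over the disc of half the radius, and
  this dominates the difference quotients.\<close>

lemma field_differentiable_integral_parameter:
  fixes f :: "complex \<Rightarrow> 'a \<Rightarrow> complex"
  assumes r: "r > 0"
    and hol: "\<And>x. x \<in> space M \<Longrightarrow> (\<lambda>t. f t x) holomorphic_on ball t0 r"
    and meas: "\<And>t. t \<in> ball t0 r \<Longrightarrow> f t \<in> borel_measurable M"
    and bound: "\<And>t x. t \<in> ball t0 r \<Longrightarrow> x \<in> space M \<Longrightarrow> norm (f t x) \<le> B x"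
    and B: "integrable M B"
  shows "(\<lambda>t. \<integral>x. f t x \<partial>M) field_differentiable (at t0)"
proof -
  define D where "D = (\<lambda>x. deriv (\<lambda>t. f t x) t0)"
  have int: "integrable M (f t)" if "t \<in> ball t0 r" for t
    using meas[OF that] bound[OF that] by (intro Bochner_Integration.integrable_bound[OF B]) (auto intro!: AE_I2 order_trans[OF bound[OF that]])
  have lip: "norm (f (t0 + s) x - f t0 x) \<le> 3 * B x / r * norm s"
    if x: "x \<in> space M" and s: "s \<in> ball 0 (r/2)" for s x
  proof -
    have holx: "(\<lambda>t. f t x) holomorphic_on ball t0 r" using hol[OF x] .
    have dd: "((\<lambda>t. f t x) has_field_derivative deriv (\<lambda>t. f t x) z) (at z within ball t0 (r/2))"
      if "z \<in> ball t0 (r/2)" for z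
      using holx that r by (intro has_field_derivative_at_within[OF holomorphic_derivI[of _ "ball t0 r"]]) auto
    have "norm (deriv (\<lambda>t. f t x) z) \<le> 3 * B x / r" if z: "z \<in> ball t0 (r/2)" for z
    proof -
      \<comment> \<open>The radii fit because r/2 + r/3 < r; the Cauchy radius r/3 is the source of
        the factor 3.\<close>
      have sub: "cball z (r/3) \<subseteq> ball t0 r"
      proof
        fix v assume "v \<in> cball z (r/3)"
        then show "v \<in> ball t0 r" using z r dist_triangle[of t0 v z] by (simp add: dist_commute)
      qed
      have "norm ((deriv ^^ 1) (\<lambda>t. f t x) z) \<le> fact 1 * B x / (r/3)^1"
      proof (rule Cauchy_inequality)
        show "(\<lambda>t. f t x) holomorphic_on ball z (r/3)" using holx sub ball_subset_cball by (blast intro: holomorphic_on_subset)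
        show "continuous_on (cball z (r/3)) (\<lambda>t. f t x)"
          using holx sub holomorphic_on_imp_continuous_on holomorphic_on_subset by blast
        show "norm (f y x) \<le> B x" if "norm (z - y) = r/3" for y
          using sub that by (intro bound x) (auto simp: dist_norm)
      qed (use r in auto)
      then show ?thesis by (simp add: field_simps)
    qed
    moreover have "norm (f (t0 + s) x - f t0 x) \<le> 3 * B x / r * norm (t0 + s - t0)" if "\<And>z. z \<in> ball t0 (r/2) \<Longrightarrow> norm (deriv (\<lambda>t. f t x) z) \<le> 3 * B x / r"
      by (rule field_differentiable_bound[where S = "ball t0 (r/2)" and f' = "deriv (\<lambda>t. f t x)"])
         (use s r that in \<open>auto simp: dist_norm intro: has_field_derivative_subset[OF dd]\<close>)
    ultimately show ?thesis by simp
  qed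
  have "((\<lambda>s. ((\<integral>x. f (t0 + s) x \<partial>M) - (\<integral>x. f t0 x \<partial>M)) / s) \<longlongrightarrow> (\<integral>x. D x \<partial>M)) (at 0 within ball 0 (r/2))"
    unfolding tendsto_at_iff_sequentially
  proof (intro allI impI)
    fix X assume X: "\<forall>i. X i \<in> ball 0 (r/2) - {0}" "X \<longlonglongrightarrow> (0::complex)"
    have inb: "t0 + X n \<in> ball t0 r" "X n \<noteq> 0" for n
      using X(1)[rule_format, of n] r by (auto simp: dist_norm)
    have t0b: "t0 \<in> ball t0 r" using r by simp
    have lim: "(\<lambda>n. (f (t0 + X n) x - f t0 x) / X n) \<longlonglongrightarrow> D x" if "x \<in> space M" for x
    proof -
      have "((\<lambda>t. f t x) has_field_derivative D x) (at t0)"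
        unfolding D_def using hol[OF that] r by (intro holomorphic_derivI[of _ "ball t0 r"]) auto
      then have "((\<lambda>h. (f (t0 + h) x - f t0 x) / h) \<longlongrightarrow> D x) (at 0)"
        by (simp add: DERIV_def)
      then show ?thesis
        by (rule filterlim_compose) (use X inb in \<open>auto simp: filterlim_at\<close>)
    qed
    have "(\<lambda>n. \<integral>x. (f (t0 + X n) x - f t0 x) / X n \<partial>M) \<longlonglongrightarrow> (\<integral>x. D x \<partial>M)"
    proof (rule integral_dominated_convergence[where w = "\<lambda>x. 3 * B x / r"])
      show m: "(\<lambda>x. (f (t0 + X n) x - f t0 x) / X n) \<in> borel_measurable M" for n
        using meas[OF inb(1)[of n]] meas[OF t0b] by measurable
      show "D \<in> borel_measurable M"
        by (rule borel_measurable_LIMSEQ_metric[OF m lim])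
      show "integrable M (\<lambda>x. 3 * B x / r)" using B by simp
      show "AE x in M. norm ((f (t0 + X n) x - f t0 x) / X n) \<le> 3 * B x / r" for n
      proof (rule AE_I2)
        fix x assume "x \<in> space M"
        then show "norm ((f (t0 + X n) x - f t0 x) / X n) \<le> 3 * B x / r"
          using lip[of x "X n"] X(1) inb(2)[of n] by (simp add: norm_divide pos_divide_le_eq)
      qed
    qed (use lim in auto)
    then show "((\<lambda>s. ((\<integral>x. f (t0 + s) x \<partial>M) - (\<integral>x. f t0 x \<partial>M)) / s) \<circ> X) \<longlonglongrightarrow> (\<integral>x. D x \<partial>M)"
      using int[OF inb(1)] int[OF t0b] by (simp add: o_def)
  qed
  then have "((\<lambda>s. ((\<integral>x. f (t0 + s) x \<partial>M) - (\<integral>x. f t0 x \<partial>M)) / s) \<longlongrightarrow> (\<integral>x. D x \<partial>M)) (at 0)"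
    using r at_within_open[of "0::complex" "ball 0 (r/2)"] by simp
  then have "((\<lambda>t. \<integral>x. f t x \<partial>M) has_field_derivative (\<integral>x. D x \<partial>M)) (at t0)"
    by (simp add: DERIV_def)
  then show ?thesis by (auto simp: field_differentiable_def)
qed

section \<open>Iterated Laplacians of smooth functions\<close>

lemma partial_eqI: "g differentiable (at y) \<Longrightarrow> has_partial i g g' y \<Longrightarrow> partial i g y = g'"
  using differentiable_imp_has_partial has_partial_unique by blast

lemma smooth_on_differentiable: "smooth_on G g \<Longrightarrow> x \<in> G \<Longrightarrow> g differentiable (at x)"
  unfolding smooth_on_def by (drule spec[of _ "[]"]) simp

lemma smooth_on_partial:
  assumes "smooth_on G g" shows "smooth_on G (partial i g)"
  unfolding smooth_on_def
proof (intro allI ballI)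
  fix "is" x assume "x \<in> G"
  then have "foldr partial (is @ [i]) g differentiable (at x)"
    using assms unfolding smooth_on_def by blast
  then show "foldr partial is (partial i g) differentiable (at x)" by simp
qed

lemma smooth_on_has_partial: "smooth_on G g \<Longrightarrow> x \<in> G \<Longrightarrow> has_partial i g (partial i g x) x"
  by (simp add: differentiable_imp_has_partial smooth_on_differentiable)

lemma smooth_on_continuous: "smooth_on G g \<Longrightarrow> continuous_on G g"
  by (intro continuous_at_imp_continuous_on ballI differentiable_imp_continuous_within
      smooth_on_differentiable)

lemma smooth_on_zero: "smooth_on G (\<lambda>_. 0)"
proof -
  have "partial i (\<lambda>_. 0) = (\<lambda>_. 0)" for i :: 'a
    by (auto simp: fun_eq_iff intro!: partial_eqI has_partial_const)
  then have "foldr partial is (\<lambda>_. 0) = (\<lambda>_. 0)" for "is" :: "'a list"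
    by (induction "is") auto
  then show ?thesis by (simp add: smooth_on_def)
qed

text \<open>Linearity of \<open>partial\<close> holds only where the summands are differentiable, so
  the iterated partials of the sum are known only on \<open>G\<close>. Openness of \<open>G\<close>
  lets each such identity be differentiated once more, which is the induction step.\<close>

lemma smooth_on_add:
  assumes G: "open G" and f: "smooth_on G f" and g: "smooth_on G g"
  shows "smooth_on G (\<lambda>x. f x + g x)"
proof -
  have diff: "foldr partial is f differentiable (at x)" "foldr partial is g differentiable (at x)"
    if "x \<in> G" for "is" x
    using f g that by (auto simp: smooth_on_def)
  have transfer: "h differentiable (at x)"
    if "x \<in> G" "\<forall>y\<in>G. h y = foldr partial is f y + foldr partial is g y" for h "is" x
  proof -
    have "(\<lambda>y. foldr partial is f y + foldr partial is g y) differentiable (at x)"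
      by (intro differentiable_add diff that)
    then obtain D where "((\<lambda>y. foldr partial is f y + foldr partial is g y) has_derivative D) (at x)"
      by (auto simp: differentiable_def)
    then have "(h has_derivative D) (at x)"
      by (rule has_derivative_transform_within_open[OF _ G that(1)]) (use that in auto)
    then show ?thesis by (auto simp: differentiable_def)
  qed
  have eq: "\<forall>x\<in>G. foldr partial is (\<lambda>x. f x + g x) x = foldr partial is f x + foldr partial is g x" for "is"
  proof (induction "is")
    case (Cons i js)
    show ?case
    proof
      fix x assume x: "x \<in> G"
      have "has_partial i (\<lambda>y. foldr partial js f y + foldr partial js g y)
          (partial i (foldr partial js f) x + partial i (foldr partial js g) x) x"
        by (intro has_partial_add differentiable_imp_has_partial diff x)
      then have "has_partial i (foldr partial js (\<lambda>x. f x + g x))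
          (partial i (foldr partial js f) x + partial i (foldr partial js g) x) x"
        by (rule has_partial_cong_open[OF _ G x]) (use Cons in auto)
      then show "foldr partial (i # js) (\<lambda>x. f x + g x) x =
          foldr partial (i # js) f x + foldr partial (i # js) g x"
        using partial_eqI[OF transfer[OF x Cons]] by simp
    qed
  qed auto
  show ?thesis
    unfolding smooth_on_def using transfer eq by blast
qed

lemma smooth_on_sum:
  assumes "open G" "\<And>i. i \<in> I \<Longrightarrow> smooth_on G (f i)"
  shows "smooth_on G (\<lambda>x. \<Sum>i\<in>I. f i x)"
  using assms(2)
proof (induction I rule: infinite_finite_induct)
  case (insert i I)
  then show ?case using smooth_on_add[OF assms(1), of "f i" "\<lambda>x. \<Sum>i\<in>I. f i x"] by simp
qed (simp_all add: smooth_on_zero)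

lemma smooth_on_iterated_laplacian:
  assumes "open G" "smooth_on G f"
  shows "smooth_on G ((laplacian ^^ p) f)"
proof (induction p)
  case (Suc p)
  have "smooth_on G (\<lambda>x. \<Sum>i\<in>UNIV. partial i (partial i ((laplacian ^^ p) f)) x)"
    by (intro smooth_on_sum smooth_on_partial assms(1) Suc)
  then show ?case by (simp add: laplacian_def[abs_def])
qed (use assms in auto)

section \<open>Radial cutoff functions\<close>

lemma DERIV_pos_part_power:
  "((\<lambda>t. (max 0 t) ^ Suc (Suc n)) has_real_derivative real (Suc (Suc n)) * (max 0 t) ^ Suc n) (at t)"
proof -
  consider "t < 0" | "t = 0" | "t > 0" by linarith
  then show ?thesis
  proof cases
    case 1
    have "((\<lambda>t::real. 0) has_real_derivative 0) (at t)" by simp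
    then have "((\<lambda>t. (max 0 t) ^ Suc (Suc n)) has_real_derivative 0) (at t)"
      by (rule has_field_derivative_transform_within_open[of _ _ t "{..<0}"]) (use 1 in auto)
    then show ?thesis using 1 by simp
  next
    case 2
    have "((\<lambda>h::real. (max 0 h) ^ Suc n * (max 0 h / h)) \<longlongrightarrow> 0) (at 0)"
    proof (rule Lim_null_comparison)
      show "\<forall>\<^sub>F h in at (0::real). norm ((max 0 h) ^ Suc n * (max 0 h / h)) \<le> \<bar>h\<bar> ^ Suc n"
      proof (rule always_eventually, rule allI)
        fix h :: real
        show "norm ((max 0 h) ^ Suc n * (max 0 h / h)) \<le> \<bar>h\<bar> ^ Suc n"
        proof (cases "h > 0")
          case True
          then show ?thesis by (simp add: abs_mult power_abs)
        next
          case False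
          then show ?thesis using zero_le_power[OF abs_ge_zero, of h "Suc n"] by (simp add: max_def del: power_Suc)
        qed
      qed
      have "((\<lambda>h::real. \<bar>h\<bar> ^ Suc n) \<longlongrightarrow> \<bar>0\<bar> ^ Suc n) (at 0)" by (intro tendsto_intros)
      then show "((\<lambda>h::real. \<bar>h\<bar> ^ Suc n) \<longlongrightarrow> 0) (at 0)" by simp
    qed
    then show ?thesis using 2 by (simp add: DERIV_def mult_ac)
  next
    case 3
    have "((\<lambda>t. t ^ Suc (Suc n)) has_real_derivative real (Suc (Suc n)) * t ^ Suc n) (at t)"
      using DERIV_pow[of "Suc (Suc n)" t] by simp
    then have "((\<lambda>t. (max 0 t) ^ Suc (Suc n)) has_real_derivative real (Suc (Suc n)) * t ^ Suc n) (at t)"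
      by (rule has_field_derivative_transform_within_open[of _ _ t "{0<..}"]) (use 3 in auto)
    then show ?thesis using 3 by simp
  qed
qed

text \<open>A transition from 0 to 1 of class C^2, enough for the Laplacian of a cutoff. The cube is
  the lowest integer power whose positive part is C^2. \<open>step1\<close> and \<open>step2\<close>
  are the two derivatives, written out.\<close>

definition step0 :: "real \<Rightarrow> real" where
  "step0 t = max 0 t ^ 3 / (max 0 t ^ 3 + max 0 (1 - t) ^ 3)"

definition step1 :: "real \<Rightarrow> real" where
  "step1 t = (3 * max 0 t ^ 2 * (max 0 t ^ 3 + max 0 (1 - t) ^ 3) -
      max 0 t ^ 3 * (3 * max 0 t ^ 2 - 3 * max 0 (1 - t) ^ 2)) / (max 0 t ^ 3 + max 0 (1 - t) ^ 3)\<^sup>2"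

definition step2 :: "real \<Rightarrow> real" where
  "step2 t = ((6 * max 0 t * (max 0 t ^ 3 + max 0 (1 - t) ^ 3) -
      max 0 t ^ 3 * (6 * max 0 t + 6 * max 0 (1 - t))) * (max 0 t ^ 3 + max 0 (1 - t) ^ 3)\<^sup>2 -
    (3 * max 0 t ^ 2 * (max 0 t ^ 3 + max 0 (1 - t) ^ 3) -
      max 0 t ^ 3 * (3 * max 0 t ^ 2 - 3 * max 0 (1 - t) ^ 2)) *
    (2 * (max 0 t ^ 3 + max 0 (1 - t) ^ 3) * (3 * max 0 t ^ 2 - 3 * max 0 (1 - t) ^ 2))) /
    (max 0 t ^ 3 + max 0 (1 - t) ^ 3) ^ 4"

lemma step_denominator_pos: "0 < max 0 t ^ 3 + max 0 (1 - t) ^ 3" for t :: real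
proof (cases "t > 0")
  case False
  then have "0 < max 0 (1 - t) ^ 3" by simp
  then show ?thesis by (simp add: add_nonneg_pos)
qed (simp add: add_pos_nonneg)

lemma DERIV_pos_parts:
  "((\<lambda>t. max 0 t ^ 3) has_real_derivative 3 * max 0 t ^ 2) (at t)"
  "((\<lambda>t. max 0 t ^ 2) has_real_derivative 2 * max 0 t) (at t)"
  "((\<lambda>t. max 0 (1 - t) ^ 3) has_real_derivative - 3 * max 0 (1 - t) ^ 2) (at t)"
  "((\<lambda>t. max 0 (1 - t) ^ 2) has_real_derivative - 2 * max 0 (1 - t)) (at t)" for t :: real
proof -
  show a: "((\<lambda>t. max 0 t ^ 3) has_real_derivative 3 * max 0 t ^ 2) (at t)" for t :: real
    using DERIV_pos_part_power[of 1 t] by (simp add: numeral_3_eq_3 numeral_2_eq_2)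
  show b: "((\<lambda>t. max 0 t ^ 2) has_real_derivative 2 * max 0 t) (at t)" for t :: real
    using DERIV_pos_part_power[of 0 t] by (simp add: numeral_2_eq_2)
  have c: "((\<lambda>t. 1 - t) has_real_derivative - 1) (at t)"
    by (auto intro!: derivative_eq_intros)
  show "((\<lambda>t. max 0 (1 - t) ^ 3) has_real_derivative - 3 * max 0 (1 - t) ^ 2) (at t)"
    using DERIV_chain2[OF a c] by simp
  show "((\<lambda>t. max 0 (1 - t) ^ 2) has_real_derivative - 2 * max 0 (1 - t)) (at t)"
    using DERIV_chain2[OF b c] by simp
qed

lemma DERIV_step_terms:
  "((\<lambda>t. 3 * max 0 t ^ 2) has_real_derivative 6 * max 0 t) (at t)"
  "((\<lambda>t. max 0 t ^ 3 + max 0 (1 - t) ^ 3) has_real_derivative 3 * max 0 t ^ 2 - 3 * max 0 (1 - t) ^ 2) (at t)"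
  "((\<lambda>t. 3 * max 0 t ^ 2 - 3 * max 0 (1 - t) ^ 2) has_real_derivative 6 * max 0 t + 6 * max 0 (1 - t)) (at t)"
  for t :: real
  using DERIV_cmult[OF DERIV_pos_parts(2), of 3 t] DERIV_add[OF DERIV_pos_parts(1,3), of t]
    DERIV_diff[OF DERIV_cmult[OF DERIV_pos_parts(2), of 3] DERIV_cmult[OF DERIV_pos_parts(4), of 3], of t]
  by simp_all

lemma DERIV_step0: "(step0 has_real_derivative step1 t) (at t)"
  using DERIV_quotient[OF DERIV_pos_parts(1) DERIV_step_terms(2) step_denominator_pos[THEN less_imp_neq, THEN not_sym], of t]
  unfolding step0_def[abs_def] step1_def by (simp add: numeral_2_eq_2 mult.commute)

lemma DERIV_step1: "(step1 has_real_derivative step2 t) (at t)"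
proof -
  define c d where "c = (\<lambda>t::real. max 0 t ^ 3)" and "d = (\<lambda>t::real. max 0 t ^ 3 + max 0 (1 - t) ^ 3)"
  define c1 d1 where "c1 = (\<lambda>t::real. 3 * max 0 t ^ 2)" and "d1 = (\<lambda>t::real. 3 * max 0 t ^ 2 - 3 * max 0 (1 - t) ^ 2)"
  define c2 d2 where "c2 = (\<lambda>t::real. 6 * max 0 t)" and "d2 = (\<lambda>t::real. 6 * max 0 t + 6 * max 0 (1 - t))"
  have D: "(c has_real_derivative c1 t) (at t)" "(c1 has_real_derivative c2 t) (at t)"
     "(d has_real_derivative d1 t) (at t)" "(d1 has_real_derivative d2 t) (at t)"
    unfolding c_def d_def c1_def d1_def c2_def d2_def
    by (rule DERIV_pos_parts DERIV_step_terms)+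
  have dp: "d t \<noteq> 0" using step_denominator_pos[of t] by (simp add: d_def)
  have d4: "(d t)\<^sup>2 * (d t)\<^sup>2 = d t ^ 4" by (simp flip: power_add)
  have "((\<lambda>t. (c1 t * d t - c t * d1 t) / (d t)\<^sup>2) has_real_derivative
      ((c2 t * d t - c t * d2 t) * (d t)\<^sup>2 - (c1 t * d t - c t * d1 t) * (2 * d t * d1 t)) / (d t) ^ 4) (at t)"
    using dp by (auto intro!: derivative_eq_intros D simp: power2_eq_square power4_eq_xxxx algebra_simps)
  then show ?thesis
    unfolding step1_def[abs_def] step2_def c_def d_def c1_def d1_def c2_def d2_def .
qed

lemma continuous_on_step:
  "continuous_on A step0" "continuous_on A step1" "continuous_on A step2"
proof -
  show "continuous_on A step0" "continuous_on A step1"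
    by (intro continuous_at_imp_continuous_on ballI DERIV_isCont[OF DERIV_step0] DERIV_isCont[OF DERIV_step1])+
  show "continuous_on A step2"
    unfolding step2_def[abs_def] using step_denominator_pos
    by (intro continuous_intros) (auto simp: less_imp_neq[THEN not_sym])
qed

lemma step_le_0: "t \<le> 0 \<Longrightarrow> step0 t = 0" "t \<le> 0 \<Longrightarrow> step1 t = 0" "t \<le> 0 \<Longrightarrow> step2 t = 0"
  by (simp_all add: step0_def step1_def step2_def)

lemma step_ge_1: "t \<ge> 1 \<Longrightarrow> step0 t = 1" "t \<ge> 1 \<Longrightarrow> step1 t = 0" "t \<ge> 1 \<Longrightarrow> step2 t = 0"
  by (simp_all add: step0_def step1_def step2_def)

text \<open>Squared radii make this a polynomial in \<open>y\<close>, so that the radial cutoff has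
  no trouble at the origin. It runs from 0 on the sphere of radius \<open>a\<close> to 1 on that of
  radius \<open>b\<close>.\<close>

definition cut_arg :: "real \<Rightarrow> real \<Rightarrow> real^'n::finite \<Rightarrow> real" where
  "cut_arg a b y = ((\<Sum>i\<in>UNIV. (y $ i)\<^sup>2) - a\<^sup>2) / (b\<^sup>2 - a\<^sup>2)"

definition cut0 :: "real \<Rightarrow> real \<Rightarrow> real^'n::finite \<Rightarrow> complex" where
  "cut0 a b y = complex_of_real (step0 (cut_arg a b y))"

definition cut1 :: "real \<Rightarrow> real \<Rightarrow> 'n::finite \<Rightarrow> real^'n \<Rightarrow> complex" where
  "cut1 a b i y = complex_of_real (step1 (cut_arg a b y) * (2 * y $ i / (b\<^sup>2 - a\<^sup>2)))"

definition cut2 :: "real \<Rightarrow> real \<Rightarrow> 'n::finite \<Rightarrow> real^'n \<Rightarrow> complex" where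
  "cut2 a b i y = complex_of_real (step2 (cut_arg a b y) * (2 * y $ i / (b\<^sup>2 - a\<^sup>2)) ^ 2 +
     step1 (cut_arg a b y) * (2 / (b\<^sup>2 - a\<^sup>2)))"

lemma norm_sq_vec: "(norm y)\<^sup>2 = (\<Sum>i\<in>UNIV. (y $ i)\<^sup>2)" for y :: "real^'n::finite"
  by (simp add: norm_vec_def L2_set_def sum_nonneg)

lemma sq_diff_pos: "0 \<le> a \<Longrightarrow> a < b \<Longrightarrow> 0 < b\<^sup>2 - a\<^sup>2" for a b :: real
  by (simp add: power_strict_mono)

lemma cut_arg_le_0: "0 \<le> a \<Longrightarrow> a < b \<Longrightarrow> norm y \<le> a \<Longrightarrow> cut_arg a b y \<le> 0"
  using sq_diff_pos[of a b] power_mono[of "norm y" a 2]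
  by (simp add: cut_arg_def norm_sq_vec[symmetric] divide_le_0_iff)

lemma cut_arg_ge_1: "0 \<le> a \<Longrightarrow> a < b \<Longrightarrow> norm y \<ge> b \<Longrightarrow> cut_arg a b y \<ge> 1"
  using sq_diff_pos[of a b] power_mono[of b "norm y" 2]
  by (simp add: cut_arg_def norm_sq_vec[symmetric] pos_le_divide_eq)

lemma cut_inner: "0 \<le> a \<Longrightarrow> a < b \<Longrightarrow> norm y \<le> a \<Longrightarrow> cut0 a b y = 0 \<and> cut1 a b i y = 0 \<and> cut2 a b i y = 0"
  using cut_arg_le_0[of a b y] by (simp add: cut0_def cut1_def cut2_def step_le_0)

lemma cut_outer: "0 \<le> a \<Longrightarrow> a < b \<Longrightarrow> norm y \<ge> b \<Longrightarrow> cut0 a b y = 1 \<and> cut1 a b i y = 0 \<and> cut2 a b i y = 0"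
  using cut_arg_ge_1[of a b y] by (simp add: cut0_def cut1_def cut2_def step_ge_1)

lemma continuous_on_cut:
  "continuous_on A (cut0 a b)" "continuous_on A (cut1 a b i)" "continuous_on A (cut2 a b i)"
proof -
  have c: "continuous_on A (cut_arg a b)" unfolding cut_arg_def[abs_def] divide_inverse by (intro continuous_intros)
  note s = continuous_on_compose2[OF continuous_on_step(1)[of UNIV] c]
      continuous_on_compose2[OF continuous_on_step(2)[of UNIV] c]
      continuous_on_compose2[OF continuous_on_step(3)[of UNIV] c]
  show "continuous_on A (cut0 a b)" "continuous_on A (cut1 a b i)" "continuous_on A (cut2 a b i)"
    unfolding cut0_def[abs_def] cut1_def[abs_def] cut2_def[abs_def] divide_inverse
    by (intro continuous_intros s subset_UNIV)+
qed

lemma has_partial_of_real: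
  assumes "((\<lambda>t. g (y + t *\<^sub>R axis i 1)) has_real_derivative g') (at 0)"
  shows "has_partial i (\<lambda>y. complex_of_real (g y)) (complex_of_real g') y"
  using has_vector_derivative_of_real assms
  unfolding has_partial_def by (simp add: has_real_derivative_iff_has_vector_derivative has_vector_derivative_of_real)

lemma DERIV_component:
  "((\<lambda>t. (y + t *\<^sub>R axis i 1) $ j) has_real_derivative (if j = i then 1 else 0)) (at s)"
  by (auto simp: axis_def intro!: derivative_eq_intros)

lemma DERIV_cut_arg:
  "((\<lambda>t. cut_arg a b (y + t *\<^sub>R axis i 1)) has_real_derivative (2 * y $ i / (b\<^sup>2 - a\<^sup>2))) (at 0)"
proof -
  have "((\<lambda>t. \<Sum>j\<in>UNIV. ((y + t *\<^sub>R axis i 1) $ j)\<^sup>2) has_real_derivative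
     (\<Sum>j\<in>UNIV. 2 * y $ j * (if j = i then 1 else 0))) (at 0)"
    by (rule DERIV_sum) (auto intro!: derivative_eq_intros simp: axis_def)
  moreover have "(\<Sum>j\<in>UNIV. 2 * y $ j * (if j = i then 1 else 0)) = 2 * y $ i"
    by (simp add: if_distrib cong: if_cong)
  ultimately have "((\<lambda>t. (\<Sum>j\<in>UNIV. ((y + t *\<^sub>R axis i 1) $ j)\<^sup>2) - a\<^sup>2) has_real_derivative 2 * y $ i - 0) (at 0)"
    by (intro DERIV_diff) auto
  from DERIV_cdivide[OF this] show ?thesis
    unfolding cut_arg_def by simp
qed

lemma has_partial_cut0: "has_partial i (cut0 a b) (cut1 a b i y) y"
proof -
  have "((\<lambda>t. step0 (cut_arg a b (y + t *\<^sub>R axis i 1))) has_real_derivative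
      step1 (cut_arg a b y) * (2 * y $ i / (b\<^sup>2 - a\<^sup>2))) (at 0)"
    using DERIV_chain2[OF _ DERIV_cut_arg[of a b y i], of step0] DERIV_step0[of "cut_arg a b y"] by simp
  then show ?thesis
    unfolding cut0_def[abs_def] cut1_def by (rule has_partial_of_real)
qed

lemma has_partial_cut1: "has_partial i (cut1 a b i) (cut2 a b i y) y"
proof -
  define m where "m = b\<^sup>2 - a\<^sup>2"
  have 1: "((\<lambda>t. step1 (cut_arg a b (y + t *\<^sub>R axis i 1))) has_real_derivative
      step2 (cut_arg a b y) * (2 * y $ i / m)) (at 0)"
    using DERIV_chain2[OF _ DERIV_cut_arg[of a b y i], of step1] DERIV_step1[of "cut_arg a b y"] by (simp add: m_def)
  have 2: "((\<lambda>t. 2 * (y + t *\<^sub>R axis i 1) $ i / m) has_real_derivative 2 / m) (at 0)"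
    using DERIV_cdivide[OF DERIV_cmult[OF DERIV_component[of y i i 0], of 2], of m] by simp
  have "((\<lambda>t. step1 (cut_arg a b (y + t *\<^sub>R axis i 1)) * (2 * (y + t *\<^sub>R axis i 1) $ i / m)) has_real_derivative
      step2 (cut_arg a b y) * (2 * y $ i / m) ^ 2 + step1 (cut_arg a b y) * (2 / m)) (at 0)"
    using DERIV_mult[OF 1 2] by (simp add: power2_eq_square mult_ac)
  then show ?thesis
    unfolding cut1_def[abs_def] cut2_def m_def by (rule has_partial_of_real)
qed

section \<open>Kernels\<close>

text \<open>With \<open>w = q (z - y) + e\<close> and \<open>s = 1 - d/2\<close>, the functions \<open>radial_power s l p w\<close>
  are, up to constants, iterated fundamental solutions of the Laplacian in \<open>y\<close>, regularised by \<open>e\<close>;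
  the scaling by \<open>l\<close> selects the branch of the power.\<close>

definition radial_power :: "complex \<Rightarrow> complex \<Rightarrow> nat \<Rightarrow> complex \<Rightarrow> complex" where
  "radial_power s l p w = w ^ p * (w / l) powr s"

lemma DERIV_radial_power:
  assumes "w / l \<notin> \<real>\<^sub>\<le>\<^sub>0"
  shows "(radial_power s l p has_field_derivative (of_nat p + s) * radial_power s l p w / w) (at w)"
proof -
  have w: "w \<noteq> 0" "l \<noteq> 0" using assms by auto
  have "((\<lambda>w. (w / l) powr s) has_field_derivative s * (w / l) powr (s - 1) * (1 / l)) (at w)"
    by (rule DERIV_chain2[of "\<lambda>v. v powr s"])
       (use assms in \<open>auto intro!: has_field_derivative_powr derivative_eq_intros\<close>)
  moreover have "s * (w / l) powr (s - 1) * (1 / l) = s * (w / l) powr s / w"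
    using w by (simp add: powr_diff field_simps)
  ultimately have 1: "((\<lambda>w. (w / l) powr s) has_field_derivative s * (w / l) powr s / w) (at w)"
    by simp
  have 2: "((\<lambda>w. w ^ p) has_field_derivative of_nat p * w ^ p / w) (at w)"
  proof (cases p)
    case (Suc n)
    have "((\<lambda>w. w ^ p) has_field_derivative of_nat p * (1 * w ^ (p - Suc 0))) (at w)"
      by (rule DERIV_power[OF DERIV_ident])
    then show ?thesis using w by (simp add: Suc)
  qed auto
  show ?thesis
    using DERIV_mult[OF 2 1] unfolding radial_power_def[abs_def]
    by (simp add: algebra_simps add_divide_distrib)
qed

lemma DERIV_radial_power_div:
  assumes "w / l \<notin> \<real>\<^sub>\<le>\<^sub>0"
  shows "((\<lambda>w. radial_power s l p w / w) has_field_derivative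
    (of_nat p + s - 1) * radial_power s l p w / w\<^sup>2) (at w)"
proof -
  have w: "w \<noteq> 0" using assms by auto
  have eq: "((of_nat p + s) * radial_power s l p w / w * w - radial_power s l p w * 1) / (w * w) =
     (of_nat p + s - 1) * radial_power s l p w / w\<^sup>2"
    using w by (simp add: power2_eq_square field_simps)
  show ?thesis
    using DERIV_divide[OF DERIV_radial_power[OF assms, of s p] DERIV_ident w] unfolding eq .
qed

lemma continuous_on_radial_power:
  fixes P L :: "'a::topological_space \<Rightarrow> complex"
  assumes "continuous_on S P" "continuous_on S L" "\<And>x. x \<in> S \<Longrightarrow> P x / L x \<notin> \<real>\<^sub>\<le>\<^sub>0"
  shows "continuous_on S (\<lambda>x. radial_power s (L x) p (P x))"
proof -
  have "continuous_on (- \<real>\<^sub>\<le>\<^sub>0) (\<lambda>v::complex. v powr s)"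
    by (intro continuous_at_imp_continuous_on ballI DERIV_isCont[OF has_field_derivative_powr]) auto
  moreover have "continuous_on S (\<lambda>x. P x / L x)"
  proof (intro continuous_on_divide assms ballI notI)
    fix x assume "x \<in> S" "L x = 0"
    then show False using assms(3)[of x] by simp
  qed
  ultimately have "continuous_on S (\<lambda>x. (P x / L x) powr s)"
    by (rule continuous_on_compose2) (use assms(3) in auto)
  then show ?thesis
    unfolding radial_power_def by (intro continuous_on_mult continuous_on_power assms(1))
qed

definition shifted_qform :: "complex \<Rightarrow> complex^'n::finite \<Rightarrow> real^'n \<Rightarrow> complex" where
  "shifted_qform e z y = qform (z - complexify y) + e"

lemma shifted_qform_alt: "shifted_qform e z y = (\<Sum>i\<in>UNIV. (z $ i - of_real (y $ i))\<^sup>2) + e"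
  by (simp add: shifted_qform_def qform_def complexify_def)

lemma has_partial_affine: "has_partial i (\<lambda>y. c * (z $ i - of_real (y $ i))) (- c) y"
proof -
  have "has_partial i (\<lambda>y. complex_of_real (y $ i)) (complex_of_real 1) y"
    by (rule has_partial_of_real) (use DERIV_component[of y i i 0] in simp)
  from has_partial_mult[OF has_partial_const has_partial_diff[OF has_partial_const this], of c "z $ i"]
  show ?thesis by simp
qed

lemma has_partial_shifted_qform:
  "has_partial i (shifted_qform e z) (- 2 * (z $ i - of_real (y $ i))) y"
proof -
  have t: "((\<lambda>t. complex_of_real ((y + t *\<^sub>R axis i 1) $ j)) has_vector_derivative of_real (if j = i then 1 else 0)) (at 0)" for j
    by (rule has_vector_derivative_of_real[OF DERIV_component])
  have "((\<lambda>t. (z $ j - complex_of_real ((y + t *\<^sub>R axis i 1) $ j))\<^sup>2) has_vector_derivative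
     (if j = i then - 2 * (z $ i - of_real (y $ i)) else 0)) (at 0)" for j
  proof -
    have d: "((\<lambda>t. z $ j - complex_of_real ((y + t *\<^sub>R axis i 1) $ j)) has_vector_derivative 0 - of_real (if j = i then 1 else 0)) (at 0)"
      by (intro has_vector_derivative_diff has_vector_derivative_const t)
    show ?thesis
      using has_vector_derivative_mult[OF d d] by (simp add: power2_eq_square split: if_splits)
  qed
  then have "((\<lambda>t. \<Sum>j\<in>UNIV. (z $ j - complex_of_real ((y + t *\<^sub>R axis i 1) $ j))\<^sup>2) has_vector_derivative
     (\<Sum>j\<in>UNIV. if j = i then - 2 * (z $ i - of_real (y $ i)) else 0)) (at 0)"
    by (intro has_vector_derivative_sum)
  then have "((\<lambda>t. (\<Sum>j\<in>UNIV. (z $ j - complex_of_real ((y + t *\<^sub>R axis i 1) $ j))\<^sup>2) + e) has_vector_derivative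
     - 2 * (z $ i - of_real (y $ i)) + 0) (at 0)"
    by (intro has_vector_derivative_add has_vector_derivative_const) simp
  then show ?thesis
    unfolding has_partial_def shifted_qform_alt by simp
qed

lemma continuous_on_shifted_qform:
  assumes "continuous_on S e" "continuous_on S z" "continuous_on S y"
  shows "continuous_on S (\<lambda>x. shifted_qform (e x) (z x) (y x))"
  unfolding shifted_qform_alt by (intro continuous_intros assms)

text \<open>The exponent (2 - d)/2 of the fundamental solution as a power of the squared distance;
  the argument only carries the dimension.\<close>

definition kexp :: "'n::finite itself \<Rightarrow> complex" where
  "kexp _ = 1 - of_nat CARD('n) / 2"

definition kernel0 :: "complex \<Rightarrow> complex \<Rightarrow> complex^'n::finite \<Rightarrow> nat \<Rightarrow> real^'n \<Rightarrow> complex" where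
  "kernel0 e l z p y = radial_power (kexp TYPE('n)) l p (shifted_qform e z y)"

definition kernel1 :: "complex \<Rightarrow> complex \<Rightarrow> complex^'n::finite \<Rightarrow> nat \<Rightarrow> 'n \<Rightarrow> real^'n \<Rightarrow> complex" where
  "kernel1 e l z p i y = (- 2 * (of_nat p + kexp TYPE('n))) * (z $ i - of_real (y $ i)) *
     (kernel0 e l z p y / shifted_qform e z y)"

definition kernel2 :: "complex \<Rightarrow> complex \<Rightarrow> complex^'n::finite \<Rightarrow> nat \<Rightarrow> 'n \<Rightarrow> real^'n \<Rightarrow> complex" where
  "kernel2 e l z p i y = (of_nat p + kexp TYPE('n)) *
     (2 * kernel0 e l z p y / shifted_qform e z y +
      4 * (of_nat p + kexp TYPE('n) - 1) * (z $ i - of_real (y $ i))\<^sup>2 * kernel0 e l z p y / (shifted_qform e z y)\<^sup>2)"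

lemma has_partial_kernel0:
  fixes z :: "complex^'n::finite"
  assumes "shifted_qform e z y / l \<notin> \<real>\<^sub>\<le>\<^sub>0"
  shows "has_partial i (kernel0 e l z p) (kernel1 e l z p i y) y"
proof -
  have "has_partial i (kernel0 e l z p) ((of_nat p + kexp TYPE('n)) * kernel0 e l z p y / shifted_qform e z y *
      (- 2 * (z $ i - of_real (y $ i)))) y"
    unfolding kernel0_def[abs_def]
    by (intro has_partial_compose has_partial_shifted_qform DERIV_radial_power assms)
  then show ?thesis by (simp add: kernel1_def algebra_simps add_divide_distrib diff_divide_distrib)
qed

lemma has_partial_kernel1:
  fixes z :: "complex^'n::finite"
  assumes "shifted_qform e z y / l \<notin> \<real>\<^sub>\<le>\<^sub>0"
  shows "has_partial i (kernel1 e l z p i) (kernel2 e l z p i y) y"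
proof -
  define s where "s = kexp TYPE('n)"
  define c where "c = - 2 * (of_nat p + s)"
  have 1: "has_partial i (\<lambda>y. radial_power s l p (shifted_qform e z y) / shifted_qform e z y)
     ((of_nat p + s - 1) * radial_power s l p (shifted_qform e z y) / (shifted_qform e z y)\<^sup>2 * (- 2 * (z $ i - of_real (y $ i)))) y"
    by (rule has_partial_compose[OF has_partial_shifted_qform DERIV_radial_power_div[OF assms]])
  have "has_partial i (\<lambda>y. (c * (z $ i - of_real (y $ i))) * (radial_power s l p (shifted_qform e z y) / shifted_qform e z y))
    ((c * (z $ i - of_real (y $ i))) * ((of_nat p + s - 1) * radial_power s l p (shifted_qform e z y) / (shifted_qform e z y)\<^sup>2 * (- 2 * (z $ i - of_real (y $ i))))
     + (- c) * (radial_power s l p (shifted_qform e z y) / shifted_qform e z y)) y"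
    by (rule has_partial_mult[OF has_partial_affine 1])
  moreover have "(c * (z $ i - of_real (y $ i))) * ((of_nat p + s - 1) * radial_power s l p (shifted_qform e z y) / (shifted_qform e z y)\<^sup>2 * (- 2 * (z $ i - of_real (y $ i))))
     + (- c) * (radial_power s l p (shifted_qform e z y) / shifted_qform e z y) = kernel2 e l z p i y"
    unfolding kernel2_def kernel0_def c_def s_def[symmetric]
    by (simp add: power2_eq_square algebra_simps)
  ultimately show ?thesis
    unfolding kernel1_def[abs_def] kernel0_def[abs_def] c_def s_def[symmetric] by simp
qed

lemma kernel0_Suc_div:
  "shifted_qform e z y \<noteq> 0 \<Longrightarrow> kernel0 e l z (Suc p) y / shifted_qform e z y = kernel0 e l z p y"
  by (simp add: kernel0_def radial_power_def)

definition kernel_error :: "complex \<Rightarrow> complex \<Rightarrow> complex^'n::finite \<Rightarrow> nat \<Rightarrow> real^'n \<Rightarrow> complex" where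
  "kernel_error e l z p y = 4 * (of_nat p + kexp TYPE('n)) * (of_nat p + kexp TYPE('n) - 1) *
     (e * kernel0 e l z p y / (shifted_qform e z y)\<^sup>2)"

text \<open>The squares sum to \<open>P - e\<close> and d = 2 - 2 s, so the coefficients of the main
  part collapse to 4 p (p + s), while the defect \<open>e\<close> produces
  \<open>kernel_error\<close>. For e = 0 the kernel of index 0 is harmonic, and the Laplacian lowers
  the index by one up to a constant.\<close>

lemma sum_kernel2:
  fixes z :: "complex^'n::finite"
  assumes "shifted_qform e z y \<noteq> 0"
  shows "(\<Sum>i\<in>UNIV. kernel2 e l z p i y) =
    4 * of_nat p * (of_nat p + kexp TYPE('n)) * (kernel0 e l z p y / shifted_qform e z y) - kernel_error e l z p y"
proof -
  define s where "s = kexp TYPE('n)"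
  define P k where "P = shifted_qform e z y" and "k = kernel0 e l z p y"
  have P: "P \<noteq> 0" using assms by (simp add: P_def)
  have d: "of_nat CARD('n) = 2 - 2 * s" by (simp add: s_def kexp_def)
  have q: "(\<Sum>i\<in>UNIV. (z $ i - of_real (y $ i))\<^sup>2) = P - e" by (simp add: P_def shifted_qform_alt)
  have "kernel2 e l z p i y = (of_nat p + s) * (2 * k / P) +
      ((of_nat p + s) * 4 * (of_nat p + s - 1) * k / P\<^sup>2) * (z $ i - of_real (y $ i))\<^sup>2" for i
    unfolding kernel2_def s_def[symmetric] P_def[symmetric] k_def[symmetric]
    by (simp add: ring_distribs mult_ac)
  then have "(\<Sum>i\<in>UNIV. kernel2 e l z p i y) = of_nat CARD('n) * ((of_nat p + s) * (2 * k / P)) +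
      ((of_nat p + s) * 4 * (of_nat p + s - 1) * k / P\<^sup>2) * (\<Sum>i\<in>UNIV. (z $ i - of_real (y $ i))\<^sup>2)"
    by (simp add: sum.distrib sum_distrib_left)
  also have "\<dots> = (2 - 2 * s) * ((of_nat p + s) * (2 * k / P)) +
      ((of_nat p + s) * 4 * (of_nat p + s - 1) * k / P\<^sup>2) * (P - e)"
    by (simp only: d q)
  also have "\<dots> = 4 * of_nat p * (of_nat p + s) * (k / P) - 4 * (of_nat p + s) * (of_nat p + s - 1) * (e * k / P\<^sup>2)"
    using P by (simp add: field_simps power2_eq_square)
  finally show ?thesis by (simp add: kernel_error_def s_def P_def k_def)
qed

lemma continuous_on_kernel:
  fixes z :: "'a::topological_space \<Rightarrow> complex^'n::finite"
  assumes c: "continuous_on S e" "continuous_on S l" "continuous_on S z" "continuous_on S y"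
    and reg: "\<And>x. x \<in> S \<Longrightarrow> shifted_qform (e x) (z x) (y x) / l x \<notin> \<real>\<^sub>\<le>\<^sub>0"
  shows "continuous_on S (\<lambda>x. kernel0 (e x) (l x) (z x) p (y x))"
    "continuous_on S (\<lambda>x. kernel1 (e x) (l x) (z x) p i (y x))"
    "continuous_on S (\<lambda>x. kernel2 (e x) (l x) (z x) p i (y x))"
    "continuous_on S (\<lambda>x. kernel_error (e x) (l x) (z x) p (y x))"
proof -
  have nz: "\<forall>x\<in>S. shifted_qform (e x) (z x) (y x) \<noteq> 0" "\<forall>x\<in>S. (shifted_qform (e x) (z x) (y x))\<^sup>2 \<noteq> 0"
    using reg by force+
  have P: "continuous_on S (\<lambda>x. shifted_qform (e x) (z x) (y x))"
    by (intro continuous_on_shifted_qform c)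
  show 0: "continuous_on S (\<lambda>x. kernel0 (e x) (l x) (z x) p (y x))"
    unfolding kernel0_def by (intro continuous_on_radial_power P c reg)
  show "continuous_on S (\<lambda>x. kernel1 (e x) (l x) (z x) p i (y x))"
    unfolding kernel1_def by (intro continuous_intros 0 P c nz)
  show "continuous_on S (\<lambda>x. kernel2 (e x) (l x) (z x) p i (y x))"
    unfolding kernel2_def by (intro continuous_intros 0 P c nz)
  show "continuous_on S (\<lambda>x. kernel_error (e x) (l x) (z x) p (y x))"
    unfolding kernel_error_def by (intro continuous_intros 0 P c nz)
qed

text \<open>The normalisation makes \<open>kcoeff p * kernel0 e l z p\<close> a primitive of
  \<open>kcoeff (p - 1) * kernel0 e l z (p - 1)\<close> for the Laplacian, up to the error caused by \<open>e\<close>.\<close>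

fun kcoeff :: "'n::finite itself \<Rightarrow> nat \<Rightarrow> complex" where
  "kcoeff d 0 = 1"
| "kcoeff d (Suc p) = kcoeff d p / (4 * of_nat (Suc p) * (of_nat (Suc p) + kexp d))"

text \<open>A zero would force d = 2 p + 2. Through this lemma parity of the dimension keeps the
  recursion for \<open>kcoeff\<close> from dividing by 0.\<close>

lemma kexp_nonint: "odd CARD('n) \<Longrightarrow> of_nat p + kexp TYPE('n::finite) \<noteq> 0"
proof
  assume "odd CARD('n)" and "of_nat p + kexp TYPE('n) = 0"
  then have "of_nat CARD('n) = (of_nat (2 * p + 2) :: complex)"
    by (simp add: kexp_def field_simps)
  then have "CARD('n) = 2 * p + 2" by (simp only: of_nat_eq_iff)
  with \<open>odd CARD('n)\<close> show False by simp
qed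

lemma kcoeff_Suc_mult:
  "odd CARD('n) \<Longrightarrow> kcoeff TYPE('n::finite) (Suc p) * (4 * of_nat (Suc p) * (of_nat (Suc p) + kexp TYPE('n))) = kcoeff TYPE('n) p"
  using kexp_nonint[of "Suc p", where 'n='n] of_nat_neq_0[of p, where 'a=complex] by (simp del: of_nat_Suc)

text \<open>The commutator of the Laplacian with multiplication by \<open>w\<close>, applied to the kernel.\<close>

definition cut_term :: "('n \<Rightarrow> real^'n \<Rightarrow> complex) \<Rightarrow> ('n \<Rightarrow> real^'n \<Rightarrow> complex) \<Rightarrow>
    complex \<Rightarrow> complex \<Rightarrow> complex^'n::finite \<Rightarrow> nat \<Rightarrow> real^'n \<Rightarrow> complex" where
  "cut_term w1 w2 e l z p y =
     (\<Sum>i\<in>UNIV. w2 i y * kernel0 e l z p y + 2 * w1 i y * kernel1 e l z p i y)"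

lemma set_integral_add_continuous:
  fixes f g :: "real^'n::finite \<Rightarrow> complex"
  assumes "compact K" "continuous_on K f" "continuous_on K g"
  shows "(LINT y:K|lborel. f y + g y) = (LINT y:K|lborel. f y) + (LINT y:K|lborel. g y)"
    "(LINT y:K|lborel. f y - g y) = (LINT y:K|lborel. f y) - (LINT y:K|lborel. g y)"
  using borel_integrable_compact[OF assms(1,2)] borel_integrable_compact[OF assms(1,3)]
  by (simp_all add: set_integral_add set_integral_diff set_integrable_def)

text \<open>Green's identity expresses the integral of w k_p against the Laplacian power p + 1 by
  the cutoff term, the error term and 4 p (p + s) times the same integral with p - 1 for p. The
  weights \<open>kcoeff\<close> are exactly those for which the sum over p telescopes to its last
  remainder.\<close>

lemma cut_term_telescope:
  fixes f w :: "real^'n::finite \<Rightarrow> complex"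
  assumes odd: "odd CARD('n)" and K: "compact K" "K \<subseteq> G" "open G" and f: "smooth_on G f"
    and w: "\<And>i y. has_partial i w (w1 i y) y" "\<And>i y. has_partial i (w1 i) (w2 i y) y"
    and w0: "\<And>y. y \<notin> K \<Longrightarrow> w y = 0" "\<And>i y. y \<notin> K \<Longrightarrow> w1 i y = 0" "\<And>i y. y \<notin> K \<Longrightarrow> w2 i y = 0"
    and cw: "continuous_on K w" "\<And>i. continuous_on K (w1 i)" "\<And>i. continuous_on K (w2 i)"
    and reg: "\<And>y. y \<in> K \<Longrightarrow> shifted_qform e z y / l \<notin> \<real>\<^sub>\<le>\<^sub>0"
  shows "(\<Sum>p\<le>N. kcoeff TYPE('n) p * (LINT y:K|lborel. cut_term w1 w2 e l z p y * (laplacian ^^ p) f y)) =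
    kcoeff TYPE('n) N * (LINT y:K|lborel. w y * kernel0 e l z N y * (laplacian ^^ Suc N) f y) +
    (\<Sum>p\<le>N. kcoeff TYPE('n) p * (LINT y:K|lborel. w y * kernel_error e l z p y * (laplacian ^^ p) f y))"
proof -
  define u where "u = (\<lambda>p. (laplacian ^^ p) f)"
  have su: "smooth_on G (u p)" for p
    unfolding u_def using smooth_on_iterated_laplacian[OF K(3) f] .
  have uSuc: "u (Suc p) = (\<lambda>y. \<Sum>i\<in>UNIV. partial i (partial i (u p)) y)" for p
    by (simp add: u_def laplacian_def[abs_def])
  have cu: "continuous_on K (u p)" "continuous_on K (partial i (u p))" "continuous_on K (partial i (partial i (u p)))" for p i
    using K(2) by (auto intro!: continuous_on_subset[OF smooth_on_continuous] smooth_on_partial su)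
  have nz: "shifted_qform e z y \<noteq> 0" if "y \<in> K" for y using reg[OF that] by auto
  have ck: "continuous_on K (kernel0 e l z p)" "continuous_on K (kernel1 e l z p i)"
     "continuous_on K (kernel2 e l z p i)" "continuous_on K (kernel_error e l z p)" for p i
    using continuous_on_kernel[where S=K and e="\<lambda>_. e" and l="\<lambda>_. l" and z="\<lambda>_. z" and y="\<lambda>y. y"] reg
    by simp_all
  define s where "s = kexp TYPE('n)"
  define B where "B = (\<lambda>p. LINT y:K|lborel. cut_term w1 w2 e l z p y * u p y)"
  define R where "R = (\<lambda>p q. LINT y:K|lborel. w y * kernel0 e l z p y * u q y)"
  define E where "E = (\<lambda>p. LINT y:K|lborel. w y * kernel_error e l z p y * u p y)"
  have cB: "continuous_on K (\<lambda>y. cut_term w1 w2 e l z p y * u p y)" for p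
    unfolding cut_term_def by (intro continuous_intros ck cu cw)
  have cE: "continuous_on K (\<lambda>y. w y * kernel_error e l z p y * u p y)" for p
    by (intro continuous_intros ck cu cw)
  have cR: "continuous_on K (\<lambda>y. w y * kernel0 e l z p y * u q y)" for p q
    by (intro continuous_intros ck cu cw)
  have ibp: "R p (Suc p) = (LINT y:K|lborel. (\<Sum>i\<in>UNIV. w2 i y * kernel0 e l z p y + 2 * w1 i y * kernel1 e l z p i y +
      w y * kernel2 e l z p i y) * u p y)" for p
    unfolding R_def uSuc
    by (rule integral_laplacian_by_parts[OF K(1) w w0 _ _ _ _ cw ck(1-3) cu])
       (use reg su K(2) in \<open>auto intro!: has_partial_kernel0 has_partial_kernel1 smooth_on_has_partial[of G] smooth_on_partial\<close>)
  have pt: "(\<Sum>i\<in>UNIV. w2 i y * kernel0 e l z p y + 2 * w1 i y * kernel1 e l z p i y + w y * kernel2 e l z p i y) * u p y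
     = cut_term w1 w2 e l z p y * u p y + (w y * (4 * of_nat p * (of_nat p + s) * (kernel0 e l z p y / shifted_qform e z y)) * u p y
        - w y * kernel_error e l z p y * u p y)" if "y \<in> K" for p y
  proof -
    have A: "(\<Sum>i\<in>UNIV. w2 i y * kernel0 e l z p y + 2 * w1 i y * kernel1 e l z p i y + w y * kernel2 e l z p i y)
        = cut_term w1 w2 e l z p y + w y * (\<Sum>i\<in>UNIV. kernel2 e l z p i y)"
      by (simp add: sum.distrib cut_term_def sum_distrib_left)
    have gen: "(c + v * (m - r)) * x = c * x + (v * m * x - v * r * x)" for c v m r x :: complex
      by (simp add: algebra_simps)
    show ?thesis
      unfolding A sum_kernel2[OF nz[OF that]] s_def by (rule gen)
  qed
  \<comment> \<open>At index 0 the factor 4 p (p + s) vanishes, so the recursion starts without a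
    predecessor.\<close>
  have R0: "R 0 1 = B 0 - E 0"
  proof -
    have "R 0 1 = (LINT y:K|lborel. cut_term w1 w2 e l z 0 y * u 0 y - w y * kernel_error e l z 0 y * u 0 y)"
      unfolding One_nat_def ibp by (rule set_lebesgue_integral_cong) (use K(1) pt[of _ 0] in \<open>auto simp: compact_imp_closed borel_closed\<close>)
    then show ?thesis
      using set_integral_add_continuous(2)[OF K(1) cB[of 0] cE[of 0]] by (simp add: B_def E_def)
  qed
  have RSuc: "R (Suc p) (Suc (Suc p)) = B (Suc p) + (4 * of_nat (Suc p) * (of_nat (Suc p) + s) * R p (Suc p) - E (Suc p))" for p
  proof -
    define c where "c = 4 * of_nat (Suc p) * (of_nat (Suc p) + s)"
    have "R (Suc p) (Suc (Suc p)) = (LINT y:K|lborel. cut_term w1 w2 e l z (Suc p) y * u (Suc p) y +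
        (c * (w y * kernel0 e l z p y * u (Suc p) y) - w y * kernel_error e l z (Suc p) y * u (Suc p) y))"
      unfolding ibp
      by (rule set_lebesgue_integral_cong)
         (use K(1) pt[of _ "Suc p"] in \<open>auto simp: compact_imp_closed borel_closed c_def kernel0_Suc_div nz mult_ac simp del: of_nat_Suc\<close>)
    also have "\<dots> = B (Suc p) + ((LINT y:K|lborel. c * (w y * kernel0 e l z p y * u (Suc p) y)) - E (Suc p))"
      using cB[of "Suc p"] cE[of "Suc p"] cR[of p "Suc p"] K(1)
      by (simp add: set_integral_add_continuous B_def E_def continuous_on_diff continuous_on_mult_left)
    also have "(LINT y:K|lborel. c * (w y * kernel0 e l z p y * u (Suc p) y)) = c * R p (Suc p)"
      by (simp add: R_def)
    finally show ?thesis by (simp add: c_def)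
  qed
  have "(\<Sum>p\<le>N. kcoeff TYPE('n) p * B p) = kcoeff TYPE('n) N * R N (Suc N) + (\<Sum>p\<le>N. kcoeff TYPE('n) p * E p)"
  proof (induction N)
    case 0
    then show ?case using R0 by simp
  next
    case (Suc N)
    have "kcoeff TYPE('n) (Suc N) * R (Suc N) (Suc (Suc N)) = kcoeff TYPE('n) (Suc N) * B (Suc N)
        + (kcoeff TYPE('n) (Suc N) * (4 * of_nat (Suc N) * (of_nat (Suc N) + s))) * R N (Suc N)
        - kcoeff TYPE('n) (Suc N) * E (Suc N)"
      unfolding RSuc by (simp only: ring_distribs mult.assoc add_diff_eq)
    also have "\<dots> = kcoeff TYPE('n) (Suc N) * B (Suc N) + kcoeff TYPE('n) N * R N (Suc N)
        - kcoeff TYPE('n) (Suc N) * E (Suc N)"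
      using kcoeff_Suc_mult[OF odd, of N] by (simp only: s_def)
    finally show ?case
      using Suc by (simp only: sum.atMost_Suc) (simp add: algebra_simps)
  qed
  then show ?thesis
    unfolding B_def R_def E_def u_def by simp
qed

section \<open>An approximate identity\<close>

text \<open>The profile of the regularisation error: delta^2 / (|y|^2 + delta^2)^((d+2)/2) equals
  delta^(-d) times this function at y / delta.\<close>

definition bump :: "real^'n::finite \<Rightarrow> real" where
  "bump t = 1 / sqrt (1 + (norm t)\<^sup>2) ^ (CARD('n) + 2)"

lemma bump_nonneg: "0 \<le> bump t"
  by (simp add: bump_def)

lemma continuous_on_bump: "continuous_on S bump"
proof -
  have "sqrt (1 + (norm t)\<^sup>2) \<noteq> 0" for t :: "real^'n"
    using sum_power2_gt_zero_iff[of 1 "norm t"] by simp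
  then show ?thesis
    unfolding bump_def[abs_def] by (intro continuous_intros ballI) auto
qed

text \<open>For the least k with |t| <= 2^k, the number 2^k is at most 2 sqrt (1 + |t|^2).\<close>

lemma bump_le_dyadic:
  fixes t :: "real^'n::finite"
  shows "\<exists>k. norm t \<le> 2 ^ k \<and> bump t \<le> 2 ^ (CARD('n) + 2) / (2 ^ k) ^ (CARD('n) + 2)"
proof -
  define d where "d = CARD('n) + 2"
  have "\<exists>k. norm t \<le> 2 ^ k"
    using real_arch_pow[of 2 "norm t"] less_imp_le by auto
  then obtain k where k: "norm t \<le> 2 ^ k" "\<And>j. j < k \<Longrightarrow> \<not> norm t \<le> 2 ^ j"
    using exists_least_iff[of "\<lambda>k. norm t \<le> 2 ^ k"] by blast
  have "2 ^ k \<le> 2 * sqrt (1 + (norm t)\<^sup>2)"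
  proof (cases k)
    case 0
    have "1 \<le> sqrt (1 + (norm t)\<^sup>2)" by (rule real_le_rsqrt) simp
    then have "1 \<le> 2 * sqrt (1 + (norm t)\<^sup>2)" by linarith
    then show ?thesis using 0 by (simp del: real_sqrt_ge_1_iff)
  next
    case (Suc j)
    have "2 ^ j < norm t" using k(2)[of j] Suc by simp
    also have "norm t \<le> sqrt (1 + (norm t)\<^sup>2)" by (rule real_le_rsqrt) simp
    finally show ?thesis using Suc by simp
  qed
  then have "(2 ^ k) ^ d \<le> (2 * sqrt (1 + (norm t)\<^sup>2)) ^ d"
    by (intro power_mono) auto
  moreover have "sqrt (1 + (norm t)\<^sup>2) > 0" by (simp add: add_pos_nonneg)
  ultimately have "bump t \<le> 2 ^ d / (2 ^ k) ^ d"
    unfolding bump_def d_def[symmetric] by (simp add: divide_simps power_mult_distrib mult.commute)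
  then show ?thesis using k(1) d_def by blast
qed

text \<open>The ball of radius 2^k has volume proportional to 2^(k d), and the weight on it is
  proportional to 2^(-k (d + 2)): a geometric series of ratio 1/4.\<close>

lemma integrable_bump: "integrable lborel (bump :: real^'n::finite \<Rightarrow> real)"
proof (rule integrableI_bounded)
  define d where "d = CARD('n)"
  define v where "v = unit_ball_vol (real d)"
  have v: "v \<ge> 0" by (simp add: v_def)
  define c where "c = (\<lambda>k. 2 ^ (d + 2) / (2 ^ k) ^ (d + 2) :: real)"
  have cpos: "c k \<ge> 0" for k by (simp add: c_def)
  show "(bump :: real^'n \<Rightarrow> real) \<in> borel_measurable lborel"
    using borel_measurable_continuous_onI[OF continuous_on_bump] by simp
  have "(\<integral>\<^sup>+ t. ennreal (norm (bump (t :: real^'n))) \<partial>lborel) \<le>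
      (\<integral>\<^sup>+ t. (\<Sum>k. ennreal (c k) * indicator (cball 0 (2 ^ k)) (t :: real^'n)) \<partial>lborel)"
  proof (rule nn_integral_mono)
    fix t :: "real^'n"
    obtain k where k: "norm t \<le> 2 ^ k" "bump t \<le> c k"
      using bump_le_dyadic[of t] unfolding c_def d_def by blast
    define h where "h = (\<lambda>k. ennreal (c k) * indicator (cball 0 (2 ^ k)) t)"
    have "ennreal (norm (bump t)) \<le> h k"
      using k bump_nonneg[of t] by (simp add: ennreal_leI h_def)
    also have "\<dots> \<le> suminf h"
      using sum_le_suminf[of h "{k}"] by (simp add: summableI)
    finally show "ennreal (norm (bump t)) \<le> (\<Sum>k. ennreal (c k) * indicator (cball 0 (2 ^ k)) t)" unfolding h_def .
  qed
  also have "\<dots> = (\<Sum>k. \<integral>\<^sup>+ t. ennreal (c k) * indicator (cball 0 (2 ^ k)) (t :: real^'n) \<partial>lborel)"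
    by (rule nn_integral_suminf) (auto intro!: borel_measurable_times_ennreal borel_measurable_indicator)
  also have "\<dots> = (\<Sum>k. ennreal (2 ^ (d + 2) * v * (1/4) ^ k))"
  proof (rule suminf_cong)
    fix k
    have "(\<integral>\<^sup>+ t. ennreal (c k) * indicator (cball 0 (2 ^ k)) (t :: real^'n) \<partial>lborel) =
        ennreal (c k) * ennreal (v * (2 ^ k) ^ d)"
      by (simp add: nn_integral_cmult_indicator emeasure_cball v_def d_def)
    also have "\<dots> = ennreal (c k * (v * (2 ^ k) ^ d))"
      using cpos v by (simp add: ennreal_mult)
    also have "c k * (v * (2 ^ k) ^ d) = 2 ^ (d + 2) * v / (2 ^ k)\<^sup>2"
      by (simp add: c_def power_add divide_simps power2_eq_square)
    also have "\<dots> = 2 ^ (d + 2) * v * (1/4) ^ k"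
      by (simp add: power_one_over divide_simps flip: power_mult power_mult_distrib) (simp add: power_mult mult.commute power2_eq_square flip: power_mult_distrib)
    finally show "(\<integral>\<^sup>+ t. ennreal (c k) * indicator (cball 0 (2 ^ k)) (t :: real^'n) \<partial>lborel) =
        ennreal (2 ^ (d + 2) * v * (1/4) ^ k)" .
  qed
  also have "\<dots> = ennreal (\<Sum>k. 2 ^ (d + 2) * v * (1/4) ^ k)"
    by (rule suminf_ennreal2) (use v in \<open>auto intro!: summable_mult summable_geometric\<close>)
  finally show "(\<integral>\<^sup>+ t. ennreal (norm (bump (t :: real^'n))) \<partial>lborel) < \<infinity>"
    using le_less_trans ennreal_less_top by fastforce
qed

definition bump_mass :: "'n::finite itself \<Rightarrow> real" where
  "bump_mass _ = (LINT t|lborel. bump (t :: real^'n))"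

lemma bump_mass_pos: "0 < bump_mass TYPE('n::finite)"
proof -
  define c where "c = 1 / sqrt 2 ^ (CARD('n) + 2)"
  have c: "c > 0" by (simp add: c_def)
  have le: "indicator (cball 0 1) t *\<^sub>R c \<le> bump t" for t :: "real^'n"
  proof (cases "t \<in> cball 0 1")
    case True
    then have "(norm t)\<^sup>2 \<le> 1" by (simp add: abs_square_le_1)
    then have "sqrt (1 + (norm t)\<^sup>2) ^ (CARD('n) + 2) \<le> sqrt 2 ^ (CARD('n) + 2)"
      by (intro power_mono) auto
    moreover have "0 < sqrt (1 + (norm t)\<^sup>2) ^ (CARD('n) + 2)"
      by (intro zero_less_power) (simp add: add_pos_nonneg)
    ultimately show ?thesis
      using True unfolding c_def bump_def by (simp add: frac_le del: power_Suc power_Suc2)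
  qed (simp add: bump_nonneg)
  have "(LINT t|lborel. indicator (cball 0 1) (t :: real^'n) *\<^sub>R c) \<le> bump_mass TYPE('n)"
    unfolding bump_mass_def
    by (intro integral_mono integrable_bump borel_integrable_compact le) auto
  moreover have "(LINT t|lborel. indicator (cball 0 1) (t :: real^'n) *\<^sub>R c) = unit_ball_vol (real CARD('n)) * c"
    by (simp add: content_cball)
  moreover have "unit_ball_vol (real CARD('n)) > 0" by simp
  ultimately show ?thesis using c by (metis mult_pos_pos less_le_trans)
qed

text \<open>The substitution y = x + delta t turns the kernel with its Jacobian delta^d into
  \<open>bump t\<close>, which is independent of n. The factor \<open>\<phi>\<close> varies with n
  because in the application it contains a power of |x - y|^2 + delta^2.\<close>

lemma tendsto_integral_bump:
  fixes \<phi> :: "nat \<Rightarrow> real^'n::finite \<Rightarrow> complex"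
  assumes meas: "\<And>n. \<phi> n \<in> borel_measurable borel" and B: "\<And>n y. norm (\<phi> n y) \<le> B"
    and \<delta>: "\<And>n. 0 < \<delta> n" and lim: "\<And>t. (\<lambda>n. \<phi> n (x + \<delta> n *\<^sub>R t)) \<longlonglongrightarrow> L"
  shows "(\<lambda>n. LINT y|lborel. \<phi> n y * of_real ((\<delta> n)\<^sup>2 / sqrt ((norm (y - x))\<^sup>2 + (\<delta> n)\<^sup>2) ^ (CARD('n) + 2)))
     \<longlonglongrightarrow> L * of_real (bump_mass TYPE('n))"
proof -
  have bm [measurable]: "(bump :: real^'n \<Rightarrow> real) \<in> borel_measurable borel"
    using borel_measurable_continuous_onI[OF continuous_on_bump] by simp
  have eq: "(LINT y|lborel. \<phi> n y * of_real ((\<delta> n)\<^sup>2 / sqrt ((norm (y - x))\<^sup>2 + (\<delta> n)\<^sup>2) ^ (CARD('n) + 2)))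
     = (LINT t|lborel. \<phi> n (x + \<delta> n *\<^sub>R t) * of_real (bump t))" for n
  proof -
    define G where "G = (\<lambda>y. \<phi> n y * of_real ((\<delta> n)\<^sup>2 / sqrt ((norm (y - x))\<^sup>2 + (\<delta> n)\<^sup>2) ^ (CARD('n) + 2)))"
    have [measurable]: "G \<in> borel_measurable borel"
      unfolding G_def using meas[of n] by measurable
    have "(LINT y|lborel. G y) = (LINT y|density (distr lborel borel (\<lambda>t. x + \<delta> n *\<^sub>R t)) (\<lambda>_. ennreal (\<bar>\<delta> n\<bar> ^ DIM(real^'n))). G y)"
      using lborel_affine[of "\<delta> n" x] \<delta>[of n] by simp
    also have "\<dots> = (LINT y|distr lborel borel (\<lambda>t. x + \<delta> n *\<^sub>R t). (\<bar>\<delta> n\<bar> ^ DIM(real^'n)) *\<^sub>R G y)"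
      by (rule integral_density) auto
    also have "\<dots> = (LINT t|lborel. (\<bar>\<delta> n\<bar> ^ DIM(real^'n)) *\<^sub>R G (x + \<delta> n *\<^sub>R t))"
      by (rule integral_distr) auto
    also have "\<dots> = (LINT t|lborel. \<phi> n (x + \<delta> n *\<^sub>R t) * of_real (bump t))"
    proof (rule Bochner_Integration.integral_cong[OF refl])
      fix t :: "real^'n"
      have scale: "a ^ k * (a\<^sup>2 / (a * S) ^ (k + 2)) = 1 / S ^ (k + 2)" if "a > 0" for a S :: real and k
        unfolding power_mult_distrib power_add using that by (simp add: divide_simps)
      have "sqrt ((norm (\<delta> n *\<^sub>R t))\<^sup>2 + (\<delta> n)\<^sup>2) = \<delta> n * sqrt (1 + (norm t)\<^sup>2)"
      proof -
        have "(norm (\<delta> n *\<^sub>R t))\<^sup>2 + (\<delta> n)\<^sup>2 = (\<delta> n)\<^sup>2 * (1 + (norm t)\<^sup>2)"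
          by (simp add: power_mult_distrib algebra_simps)
        then show ?thesis using \<delta>[of n] by (simp add: real_sqrt_mult)
      qed
      then have "\<delta> n ^ CARD('n) * ((\<delta> n)\<^sup>2 / sqrt ((norm (\<delta> n *\<^sub>R t))\<^sup>2 + (\<delta> n)\<^sup>2) ^ (CARD('n) + 2)) = bump t"
        using scale[OF \<delta>[of n], of "CARD('n)" "sqrt (1 + (norm t)\<^sup>2)"] unfolding bump_def by (simp only:)
      then have "complex_of_real (\<delta> n ^ CARD('n)) * of_real ((\<delta> n)\<^sup>2 / sqrt ((norm (\<delta> n *\<^sub>R t))\<^sup>2 + (\<delta> n)\<^sup>2) ^ (CARD('n) + 2)) = of_real (bump t)"
        by (simp only: flip: of_real_mult)
      then show "(\<bar>\<delta> n\<bar> ^ DIM(real^'n)) *\<^sub>R G (x + \<delta> n *\<^sub>R t) = \<phi> n (x + \<delta> n *\<^sub>R t) * of_real (bump t)"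
        using \<delta>[of n] by (simp add: G_def scaleR_conv_of_real mult.left_commute del: of_real_divide of_real_power)
    qed
    finally show ?thesis unfolding G_def .
  qed
  have "(\<lambda>n. LINT t|lborel. \<phi> n (x + \<delta> n *\<^sub>R t) * of_real (bump t)) \<longlonglongrightarrow> (LINT t|lborel. L * of_real (bump (t :: real^'n)))"
  proof (rule integral_dominated_convergence[where w = "\<lambda>t. B * bump t"])
    show "integrable lborel (\<lambda>t. B * bump (t :: real^'n))" by (intro integrable_mult_right integrable_bump)
    show "(\<lambda>t. \<phi> n (x + \<delta> n *\<^sub>R t) * of_real (bump t)) \<in> borel_measurable lborel" for n
      using meas[of n] by measurable
    show "AE t in lborel. norm (\<phi> n (x + \<delta> n *\<^sub>R t) * of_real (bump t)) \<le> B * bump t" for n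
      by (rule AE_I2) (simp add: norm_mult bump_nonneg mult_right_mono B)
    show "AE t in lborel. (\<lambda>n. \<phi> n (x + \<delta> n *\<^sub>R t) * of_real (bump t)) \<longlonglongrightarrow> L * of_real (bump t)"
      by (rule AE_I2) (intro tendsto_mult lim tendsto_const)
  qed measurable
  then show ?thesis
    unfolding eq by (simp add: bump_mass_def)
qed

section \<open>Lie norms\<close>

definition Re_vec :: "complex^'n::finite \<Rightarrow> real^'n" where "Re_vec z = (\<chi> k. Re (z $ k))"
definition Im_vec :: "complex^'n::finite \<Rightarrow> real^'n" where "Im_vec z = (\<chi> k. Im (z $ k))"

lemma qform_Re_Im:
  "Re (qform z) = Re_vec z \<bullet> Re_vec z - Im_vec z \<bullet> Im_vec z" "Im (qform z) = 2 * (Re_vec z \<bullet> Im_vec z)"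
  by (simp_all add: qform_def inner_vec_def Re_vec_def Im_vec_def power2_eq_square sum_subtractf
      sum_distrib_left sum.distrib mult.commute)

lemma sqnormC_Re_Im: "sqnormC z = Re_vec z \<bullet> Re_vec z + Im_vec z \<bullet> Im_vec z"
  by (simp add: sqnormC_def cmod_def inner_vec_def Re_vec_def Im_vec_def power2_eq_square sum.distrib)

lemma sqnormC_nonneg: "0 \<le> sqnormC z"
  by (simp add: sqnormC_Re_Im)

text \<open>The Gram determinant of the real and imaginary parts. Four times it is the inner
  radicand of the Lie norms, which makes their squares \<open>sqnormC z\<close> plus or minus 2 sqrt
  (gram z).\<close>

definition gram :: "complex^'n::finite \<Rightarrow> real" where
  "gram z = (Re_vec z \<bullet> Re_vec z) * (Im_vec z \<bullet> Im_vec z) - (Re_vec z \<bullet> Im_vec z)\<^sup>2"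

lemma gram_nonneg: "0 \<le> gram z"
  by (simp add: gram_def Cauchy_Schwarz_ineq)

lemma sqnormC_qform_gram: "(sqnormC z)\<^sup>2 - (cmod (qform z))\<^sup>2 = 4 * gram z"
  unfolding cmod_power2 qform_Re_Im sqnormC_Re_Im gram_def
  by (simp add: power2_eq_square algebra_simps)

lemma sqrt_4_gram: "sqrt (4 * gram z) = 2 * sqrt (gram z)"
  by (simp add: real_sqrt_mult)

lemma gram_le: "2 * sqrt (gram z) \<le> sqnormC z"
proof (rule power2_le_imp_le[OF _ sqnormC_nonneg])
  show "(2 * sqrt (gram z))\<^sup>2 \<le> (sqnormC z)\<^sup>2"
  proof -
    have "4 * gram z \<le> (sqnormC z)\<^sup>2"
      using sqnormC_qform_gram[of z] zero_le_power2[of "cmod (qform z)"] by linarith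
    then show ?thesis using gram_nonneg[of z] by (simp add: power_mult_distrib)
  qed
qed

lemma Lie_plus_sq: "(Lie_plus z)\<^sup>2 = sqnormC z + 2 * sqrt (gram z)"
  using sqnormC_nonneg[of z] gram_nonneg[of z]
  by (simp add: Lie_plus_def sqnormC_qform_gram sqrt_4_gram)

lemma Lie_minus_sq: "(Lie_minus z)\<^sup>2 = sqnormC z - 2 * sqrt (gram z)"
  using gram_le[of z] by (simp add: Lie_minus_def sqnormC_qform_gram sqrt_4_gram)

lemma Lie_plus_nonneg: "0 \<le> Lie_plus z"
  using sqnormC_nonneg[of z] gram_nonneg[of z]
  by (simp add: Lie_plus_def sqnormC_qform_gram sqrt_4_gram)

lemma Lie_minus_nonneg: "0 \<le> Lie_minus z"
  using gram_le[of z] by (simp add: Lie_minus_def sqnormC_qform_gram sqrt_4_gram)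

lemma Lie_minus_le_plus: "Lie_minus z \<le> Lie_plus z"
  by (rule power2_le_imp_le[OF _ Lie_plus_nonneg]) (simp add: Lie_plus_sq Lie_minus_sq gram_nonneg)

lemma Lie_plus_minus_mult: "Lie_plus z * Lie_minus z = cmod (qform z)"
proof (rule power2_eq_imp_eq)
  have "(Lie_plus z * Lie_minus z)\<^sup>2 = (sqnormC z)\<^sup>2 - 4 * gram z"
    unfolding power_mult_distrib Lie_plus_sq Lie_minus_sq
    using gram_nonneg[of z] by (simp add: algebra_simps power2_eq_square)
  then show "(Lie_plus z * Lie_minus z)\<^sup>2 = (cmod (qform z))\<^sup>2"
    using sqnormC_qform_gram[of z] by simp
qed (auto simp: Lie_plus_nonneg Lie_minus_nonneg)

lemma qform_nonzero: "0 < Lie_minus z \<Longrightarrow> qform z \<noteq> 0"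
  using Lie_plus_minus_mult[of z] Lie_minus_le_plus[of z] by auto

lemma Re_Im_vec_diff: "Re_vec (z - complexify y) = Re_vec z - y" "Im_vec (z - complexify y) = Im_vec z"
  by (simp_all add: Re_vec_def Im_vec_def complexify_def vec_eq_iff)

text \<open>If the value is real and nonpositive, then \<open>s = Re z - y\<close> is orthogonal to \<open>Im z\<close> and not longer than it,
  so \<open>(Re z \<bullet> s)\<^sup>2\<close> is at most the Gram determinant and \<open>\<bar>y\<bar>\<^sup>2 \<le> L\<^sub>+(z)\<^sup>2\<close>.\<close>

lemma shifted_qform_notin_nonpos:
  assumes "Lie_plus z < norm y"
  shows "shifted_qform 0 z y \<notin> \<real>\<^sub>\<le>\<^sub>0"
proof
  assume "shifted_qform 0 z y \<in> \<real>\<^sub>\<le>\<^sub>0"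
  then have "Re (qform (z - complexify y)) \<le> 0" "Im (qform (z - complexify y)) = 0"
    by (simp_all add: shifted_qform_def complex_nonpos_Reals_iff)
  moreover define u v s where "u = Re_vec z" and "v = Im_vec z" and "s = u - y"
  ultimately have s: "s \<bullet> s \<le> v \<bullet> v" "s \<bullet> v = 0"
    by (simp_all add: qform_Re_Im Re_Im_vec_diff)
  have G: "gram z = (u \<bullet> u) * (v \<bullet> v) - (u \<bullet> v)\<^sup>2" by (simp add: gram_def u_def v_def)
  have "(u \<bullet> s)\<^sup>2 \<le> gram z"
  proof (cases "v = 0")
    case True
    then have "s = 0" using s(1) by (metis inner_eq_zero_iff inner_ge_zero inner_zero_left order_antisym)
    then show ?thesis by (simp add: gram_nonneg)
  next
    case False
    \<comment> \<open>The component of \<open>u\<close> orthogonal to \<open>v\<close>. As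
      \<open>s\<close> is orthogonal to \<open>v\<close>, it has the same inner product with
      \<open>s\<close> as \<open>u\<close> has, and |t|^2 |v|^2 is the Gram determinant.\<close>
    define t where "t = u - ((u \<bullet> v) / (v \<bullet> v)) *\<^sub>R v"
    have vv: "v \<bullet> v > 0" using False by simp
    have "u \<bullet> s = t \<bullet> s" using s(2) inner_commute[of v s] by (simp add: t_def inner_diff_left)
    then have "(u \<bullet> s)\<^sup>2 \<le> (t \<bullet> t) * (s \<bullet> s)" by (simp add: Cauchy_Schwarz_ineq)
    also have "\<dots> \<le> (t \<bullet> t) * (v \<bullet> v)" by (intro mult_left_mono s) auto
    also have "\<dots> = gram z"
      using vv by (simp add: t_def G inner_diff_left inner_diff_right inner_commute field_simps power2_eq_square)
    finally show ?thesis .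
  qed
  then have us: "\<bar>u \<bullet> s\<bar> \<le> sqrt (gram z)"
    by (rule real_le_rsqrt[of "\<bar>u \<bullet> s\<bar>", unfolded power2_abs])
  have "y = u - s" by (simp add: s_def)
  then have "y \<bullet> y = u \<bullet> u - 2 * (u \<bullet> s) + s \<bullet> s"
    by (simp add: inner_diff_left inner_diff_right inner_commute)
  also have "\<dots> \<le> (Lie_plus z)\<^sup>2"
    using us s(1) by (simp add: Lie_plus_sq sqnormC_Re_Im u_def[symmetric] v_def[symmetric])
  finally have "(norm y)\<^sup>2 \<le> (Lie_plus z)\<^sup>2" by (simp add: power2_norm_eq_inner)
  then show False using assms power2_le_imp_le[OF _ Lie_plus_nonneg] by fastforce
qed

definition bilin :: "complex^'n::finite \<Rightarrow> real^'n \<Rightarrow> complex" where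
  "bilin z y = (\<Sum>k\<in>UNIV. z $ k * of_real (y $ k))"

lemma qform_complexify: "qform (complexify y) = of_real ((norm y)\<^sup>2)"
  by (simp add: qform_def complexify_def norm_sq_vec)

lemma shifted_qform_expand: "shifted_qform 0 z y = qform z - 2 * bilin z y + of_real ((norm y)\<^sup>2)"
proof -
  have "shifted_qform 0 z y = (\<Sum>k\<in>UNIV. (z $ k)\<^sup>2 - 2 * (z $ k * of_real (y $ k)) + (of_real (y $ k))\<^sup>2)"
    unfolding shifted_qform_alt by (simp add: power2_diff algebra_simps)
  then show ?thesis
    by (simp add: sum.distrib sum_subtractf sum_distrib_left qform_def bilin_def norm_sq_vec)
qed

lemma qform_scale: "qform (c *s z) = c\<^sup>2 * qform z"
  by (simp add: qform_def power_mult_distrib sum_distrib_left)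

lemma bilin_scale: "bilin (c *s z) y = c * bilin z y"
  by (simp add: bilin_def sum_distrib_left mult.assoc)

lemma Lie_plus_scale: "Lie_plus (c *s z) = cmod c * Lie_plus z"
proof -
  have S: "sqnormC (c *s z) = (cmod c)\<^sup>2 * sqnormC z"
    by (simp add: sqnormC_def norm_mult power_mult_distrib sum_distrib_left)
  have "4 * gram (c *s z) = ((cmod c)\<^sup>2)\<^sup>2 * (4 * gram z)"
    unfolding sqnormC_qform_gram[symmetric]
    by (simp add: S qform_scale norm_mult norm_power algebra_simps power_mult_distrib)
  then have "gram (c *s z) = ((cmod c)\<^sup>2)\<^sup>2 * gram z" by simp
  then have "sqrt (gram (c *s z)) = (cmod c)\<^sup>2 * sqrt (gram z)"
    by (simp only: real_sqrt_mult real_sqrt_abs abs_of_nonneg zero_le_power2)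
  then have "(Lie_plus (c *s z))\<^sup>2 = (cmod c * Lie_plus z)\<^sup>2"
    by (simp add: Lie_plus_sq S power_mult_distrib algebra_simps)
  then show ?thesis
    by (rule power2_eq_imp_eq) (auto simp: Lie_plus_nonneg)
qed

text \<open>The inversion \<open>z \<mapsto> \<bar>y\<bar>\<^sup>2 z / q z\<close> exchanges \<open>L\<^sub>+\<close> and \<open>\<bar>y\<bar>\<^sup>2 / L\<^sub>-\<close>.\<close>

lemma shifted_qform_div_notin_nonpos:
  assumes "norm y < Lie_minus z"
  shows "shifted_qform 0 z y / qform z \<notin> \<real>\<^sub>\<le>\<^sub>0"
proof
  assume neg: "shifted_qform 0 z y / qform z \<in> \<real>\<^sub>\<le>\<^sub>0"
  have Lm: "0 < Lie_minus z" using assms norm_ge_zero[of y] by linarith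
  note q = qform_nonzero[OF Lm]
  have Lp: "0 < Lie_plus z" using Lm Lie_minus_le_plus[of z] by linarith
  show False
  proof (cases "y = 0")
    case True
    then have "shifted_qform 0 z y = qform z" by (simp add: shifted_qform_expand bilin_def)
    then show False using neg q by simp
  next
    case False
    \<comment> \<open>With this factor q(c z - y) = c q(z - y), since c q(z) = |y|^2. So a
      nonpositive quotient at \<open>z\<close> becomes a nonpositive value of the shifted form at
      \<open>c *s z\<close>.\<close>
    define c where "c = of_real ((norm y)\<^sup>2) / qform z"
    have nonpos_mult: "of_real r * w \<in> \<real>\<^sub>\<le>\<^sub>0" if "w \<in> \<real>\<^sub>\<le>\<^sub>0" "r \<ge> 0" for r and w :: complex
      using that by (auto simp: complex_nonpos_Reals_iff mult_nonneg_nonpos)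
    have "shifted_qform 0 (c *s z) y = c * shifted_qform 0 z y"
      unfolding shifted_qform_expand qform_scale bilin_scale using q
      by (simp add: c_def field_simps power2_eq_square)
    also have "\<dots> = of_real ((norm y)\<^sup>2) * (shifted_qform 0 z y / qform z)"
      by (simp add: c_def)
    also have "\<dots> \<in> \<real>\<^sub>\<le>\<^sub>0"
      by (intro nonpos_mult neg) simp
    finally have "\<not> Lie_plus (c *s z) < norm y" using shifted_qform_notin_nonpos by blast
    moreover have "Lie_plus (c *s z) = (norm y)\<^sup>2 / Lie_minus z"
      unfolding Lie_plus_scale c_def using Lp
      by (simp add: norm_divide norm_power flip: Lie_plus_minus_mult)
    moreover have "(norm y)\<^sup>2 / Lie_minus z < norm y"
      using assms Lm False by (simp add: pos_divide_less_eq power2_eq_square)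
    ultimately show False by simp
  qed
qed

text \<open>Expand the form and use |q(z)| = L_+ L_- <= L_+^2 together with Cauchy-Schwarz for the
  mixed term. This estimate sets the radius of convergence of every series below.\<close>

lemma cmod_shifted_qform_le: "cmod (shifted_qform 0 z y) \<le> (Lie_plus z + norm y)\<^sup>2"
proof -
  have "cmod (qform z) \<le> (Lie_plus z)\<^sup>2"
    using Lie_plus_minus_mult[of z] mult_left_mono[OF Lie_minus_le_plus Lie_plus_nonneg, of z z]
    by (simp add: power2_eq_square)
  moreover have "cmod (bilin z y) \<le> Lie_plus z * norm y"
  proof (rule power2_le_imp_le)
    have "Re (bilin z y) = Re_vec z \<bullet> y" "Im (bilin z y) = Im_vec z \<bullet> y"
      by (simp_all add: bilin_def inner_vec_def Re_vec_def Im_vec_def)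
    then have "(cmod (bilin z y))\<^sup>2 = (Re_vec z \<bullet> y)\<^sup>2 + (Im_vec z \<bullet> y)\<^sup>2"
      by (simp add: cmod_power2)
    also have "\<dots> \<le> (Re_vec z \<bullet> Re_vec z) * (y \<bullet> y) + (Im_vec z \<bullet> Im_vec z) * (y \<bullet> y)"
      by (intro add_mono Cauchy_Schwarz_ineq)
    also have "\<dots> \<le> (Lie_plus z)\<^sup>2 * (y \<bullet> y)"
      unfolding Lie_plus_sq sqnormC_Re_Im distrib_right[symmetric]
      by (intro mult_right_mono) (auto simp: gram_nonneg)
    finally show "(cmod (bilin z y))\<^sup>2 \<le> (Lie_plus z * norm y)\<^sup>2"
      by (simp add: power_mult_distrib power2_norm_eq_inner)
  qed (simp add: Lie_plus_nonneg)
  moreover have "cmod (shifted_qform 0 z y) \<le> cmod (qform z) + 2 * cmod (bilin z y) + (norm y)\<^sup>2"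
  proof -
    have "cmod (shifted_qform 0 z y) \<le> cmod (qform z - 2 * bilin z y) + cmod (of_real ((norm y)\<^sup>2))"
      unfolding shifted_qform_expand by (rule norm_triangle_ineq)
    also have "\<dots> \<le> cmod (qform z) + cmod (2 * bilin z y) + cmod (of_real ((norm y)\<^sup>2))"
      by (intro add_right_mono norm_triangle_ineq4)
    finally show ?thesis by (simp add: norm_mult norm_power)
  qed
  ultimately show ?thesis by (simp add: power2_sum)
qed

lemma continuous_on_qform: "continuous_on S qform"
  unfolding qform_def[abs_def] by (intro continuous_intros)

lemma continuous_on_Lie: "continuous_on S Lie_plus" "continuous_on S Lie_minus"
  unfolding Lie_plus_def[abs_def] Lie_minus_def[abs_def] sqnormC_def[abs_def]
  by (intro continuous_intros continuous_on_qform)+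

lemma Lie_complexify: "Lie_plus (complexify x) = norm x" "Lie_minus (complexify x) = norm x"
proof -
  have v: "Im_vec (complexify x) = 0" "Re_vec (complexify x) = x"
    by (simp_all add: Im_vec_def Re_vec_def complexify_def vec_eq_iff)
  then have "gram (complexify x) = 0" "sqnormC (complexify x) = (norm x)\<^sup>2"
    by (simp_all add: gram_def sqnormC_Re_Im power2_norm_eq_inner)
  then have "(Lie_plus (complexify x))\<^sup>2 = (norm x)\<^sup>2" "(Lie_minus (complexify x))\<^sup>2 = (norm x)\<^sup>2"
    by (simp_all add: Lie_plus_sq Lie_minus_sq)
  then show "Lie_plus (complexify x) = norm x" "Lie_minus (complexify x) = norm x"
    by (auto intro: power2_eq_imp_eq simp: Lie_plus_nonneg Lie_minus_nonneg)
qed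

lemma shifted_qform_complexify: "shifted_qform e (complexify x) y = of_real ((norm (x - y))\<^sup>2) + e"
proof -
  have "complexify x - complexify y = complexify (x - y)" by (simp add: complexify_def vec_eq_iff)
  then show ?thesis by (simp only: shifted_qform_def qform_complexify)
qed

section \<open>Growth of the normalising coefficients\<close>

text \<open>Ratio test: passing to p + 1 divides \<open>kcoeff\<close> by 4 (p + 1)(p + 1 + s) and
  multiplies the factorial by (2p + 2)(2p + 1), so the ratio of terms tends to \<open>x\<close>. The
  coefficients thus decay like 1/(2p)! up to a polynomial factor.\<close>

lemma summable_kcoeff:
  assumes odd: "odd CARD('n::finite)" and x: "0 \<le> x" "x < 1" and c: "0 < c"
  shows "summable (\<lambda>p. norm (kcoeff TYPE('n) p) * fact (2 * p) * (real p + c)\<^sup>2 * x ^ p)"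
proof -
  define D where "D = real CARD('n)"
  define a where "a = (\<lambda>p. norm (kcoeff TYPE('n) p) * fact (2 * p) * (real p + c)\<^sup>2 * x ^ p)"
  define r where "r = (\<lambda>p. (2 * real p + 1) / (2 * (real p + 2 - D / 2)) * ((real p + 1 + c) / (real p + c))\<^sup>2)"
  have "r \<longlonglongrightarrow> 1" unfolding r_def by real_asymp
  then have "(\<lambda>p. r p * x) \<longlonglongrightarrow> 1 * x" by (intro tendsto_mult tendsto_const)
  then have "eventually (\<lambda>p. r p * x < (1 + x) / 2) sequentially"
    using x by (intro order_tendstoD) auto
  \<comment> \<open>This is p + 1 + s, which may be negative for small p; once it is positive its
    norm is the number itself.\<close>
  moreover have "eventually (\<lambda>p. real p + 2 - D / 2 > 0) sequentially" by real_asymp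
  ultimately have "eventually (\<lambda>p. r p * x < (1 + x) / 2 \<and> real p + 2 - D / 2 > 0) sequentially"
    by eventually_elim auto
  then obtain N where N: "\<And>p. p \<ge> N \<Longrightarrow> r p * x < (1 + x) / 2 \<and> real p + 2 - D / 2 > 0"
    by (auto simp: eventually_sequentially)
  have "norm (a (Suc p)) \<le> (1 + x) / 2 * norm (a p)" if "p \<ge> N" for p
  proof -
    define k where "k = norm (kcoeff TYPE('n) p)"
    define m where "m = real p + 2 - D / 2"
    have m: "m > 0" using N[OF that] by (simp add: m_def)
    have "of_nat (Suc p) + kexp TYPE('n) = complex_of_real m"
      by (simp add: kexp_def m_def D_def)
    then have "norm (kcoeff TYPE('n) (Suc p)) = k / (4 * (real p + 1) * m)"
      using m by (simp add: norm_divide norm_mult k_def norm_of_nat del: of_nat_Suc) simp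
    moreover have "fact (2 * Suc p) = (2 * (real p + 1)) * ((2 * real p + 1) * fact (2 * p))"
      by (simp add: algebra_simps)
    ultimately have "a (Suc p) = k / (4 * (real p + 1) * m) * ((2 * (real p + 1)) * ((2 * real p + 1) * fact (2 * p))) * (real p + 1 + c)\<^sup>2 * (x * x ^ p)"
      unfolding a_def by (simp add: add_ac)
    also have "\<dots> = r p * x * a p"
    proof -
      have "k / (4 * P * m) * ((2 * P) * (Q * F)) * Y\<^sup>2 * (x * X) = Q / (2 * m) * (Y / Z)\<^sup>2 * x * (k * F * Z\<^sup>2 * X)"
        if "P > 0" "Z > 0" for P Q F Y Z X :: real
        using that m by (simp add: field_simps)
      from this[of "real p + 1" "real p + c" "2 * real p + 1" "fact (2 * p)" "real p + 1 + c" "x ^ p"] c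
      show ?thesis
        unfolding r_def a_def k_def m_def by (simp add: add_nonneg_pos del: fact_Suc of_nat_Suc)
    qed
    finally have "a (Suc p) = r p * x * a p" .
    moreover have "a p \<ge> 0" "a (Suc p) \<ge> 0" using x by (simp_all add: a_def)
    ultimately show ?thesis
      using mult_right_mono[of "r p * x" "(1 + x) / 2" "a p"] N[OF that] by simp
  qed
  then have "summable a"
    using x by (intro summable_ratio_test[of "(1 + x) / 2" N]) auto
  then show ?thesis by (simp add: a_def)
qed

section \<open>Osgood's lemma\<close>

definition vec_upd :: "'a^'n \<Rightarrow> 'n \<Rightarrow> 'a \<Rightarrow> 'a^'n::finite" where
  "vec_upd z j t = (\<chi> i. if i = j then t else z $ i)"

lemma vec_upd_nth [simp]: "vec_upd z j t $ i = (if i = j then t else z $ i)"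
  by (simp add: vec_upd_def)

lemma vec_upd_upd [simp]: "vec_upd (vec_upd z j s) j t = vec_upd z j t"
  by (simp add: vec_eq_iff)

lemma vec_upd_triv [simp]: "vec_upd z j (z $ j) = z"
  by (simp add: vec_eq_iff)

lemma vec_upd_commute: "i \<noteq> j \<Longrightarrow> vec_upd (vec_upd z i s) j t = vec_upd (vec_upd z j t) i s"
  by (auto simp: vec_eq_iff)

definition sep_holomorphic :: "(complex^'n::finite) set \<Rightarrow> (complex^'n \<Rightarrow> complex) \<Rightarrow> bool" where
  "sep_holomorphic S g \<longleftrightarrow>
     (\<forall>z\<in>S. \<forall>j. (\<lambda>t. g (vec_upd z j t)) field_differentiable (at (z $ j)))"

definition locally_bounded :: "(complex^'n::finite) set \<Rightarrow> (complex^'n \<Rightarrow> complex) \<Rightarrow> bool" where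
  "locally_bounded S g \<longleftrightarrow> (\<forall>a\<in>S. \<exists>r>0. \<exists>B. \<forall>z\<in>ball a r \<inter> S. norm (g z) \<le> B)"

definition polydisc :: "complex^'n::finite \<Rightarrow> real \<Rightarrow> (complex^'n) set" where
  "polydisc a r = {z. \<forall>k. norm (z $ k - a $ k) < r}"

lemma vec_upd_in_polydisc: "z \<in> polydisc a r \<Longrightarrow> t \<in> ball (a $ j) r \<Longrightarrow> vec_upd z j t \<in> polydisc a r"
  by (auto simp: polydisc_def dist_norm norm_minus_commute)

text \<open>Cauchy's formula on a circle, rewritten as a Lebesgue integral over the unit interval so
  that differentiation in a parameter applies to it.\<close>

lemma higher_deriv_eq_integral:
  assumes f: "f holomorphic_on ball w r" and \<rho>: "0 < \<rho>" "\<rho> < r"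
  shows "(deriv ^^ m) f w / fact m =
    (LINT x|lborel. indicator {0..1} x *\<^sub>R
       (f (w + of_real \<rho> * exp (2 * of_real pi * \<i> * of_real x)) / (of_real \<rho> * exp (2 * of_real pi * \<i> * of_real x)) ^ m))"
proof -
  define e where "e = (\<lambda>x::real. exp (2 * of_real pi * \<i> * of_real x))"
  define h where "h = (\<lambda>x. f (w + of_real \<rho> * e x) / (of_real \<rho> * e x) ^ m)"
  have sub: "cball w \<rho> \<subseteq> ball w r" using \<rho> by auto
  have fc: "continuous_on (cball w \<rho>) f"
    using holomorphic_on_imp_continuous_on[OF holomorphic_on_subset[OF f sub]] .
  have "f holomorphic_on ball w \<rho>" by (rule holomorphic_on_subset[OF f]) (use \<rho> in auto)
  from Cauchy_has_contour_integral_higher_derivative_circlepath[OF fc this, of w m] \<rho>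
  have "((\<lambda>u. f u / (u - w) ^ (Suc m)) has_contour_integral ((2 * pi * \<i>) / (fact m) * (deriv ^^ m) f w)) (circlepath w \<rho>)"
    by simp
  then have 1: "((\<lambda>x. f (circlepath w \<rho> x) / (circlepath w \<rho> x - w) ^ (Suc m) * vector_derivative (circlepath w \<rho>) (at x within {0..1}))
      has_integral ((2 * pi * \<i>) / (fact m) * (deriv ^^ m) f w)) {0..1}"
    by (simp add: has_contour_integral_def)
  have ne: "of_real \<rho> * e x \<noteq> 0" for x using \<rho> by (simp add: e_def)
  have 2: "f (circlepath w \<rho> x) / (circlepath w \<rho> x - w) ^ (Suc m) * vector_derivative (circlepath w \<rho>) (at x within {0..1})
     = (2 * pi * \<i>) * h x" if "x \<in> {0..1}" for x
  proof -
    have c: "circlepath w \<rho> x = w + of_real \<rho> * e x" by (simp add: circlepath e_def)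
    have v: "vector_derivative (circlepath w \<rho>) (at x within {0..1}) = (2 * pi * \<i>) * (of_real \<rho> * e x)"
      using that by (subst vector_derivative_circlepath01) (auto simp: e_def)
    have gen: "F / (X ^ Suc m) * (c * X) = c * (F / X ^ m)" if "X \<noteq> 0" for F X c :: complex
      using that by (simp add: field_simps)
    show ?thesis unfolding c v h_def by (simp only: add_diff_cancel_left' gen[OF ne])
  qed
  have "((\<lambda>x. (2 * pi * \<i>) * h x) has_integral ((2 * pi * \<i>) / (fact m) * (deriv ^^ m) f w)) {0..1}"
    using 1 by (rule has_integral_eq[rotated]) (use 2 in auto)
  then have hi: "(h has_integral (deriv ^^ m) f w / fact m) {0..1}"
    using has_integral_mult_right[of "\<lambda>x. (2 * pi * \<i>) * h x" _ "{0..1}" "1 / (2 * pi * \<i>)"] by fastforce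
  have ch: "continuous_on {0..1} h"
  proof -
    have ce: "continuous_on {0..1} (\<lambda>x. w + of_real \<rho> * e x)"
      unfolding e_def by (intro continuous_intros)
    have img: "w + of_real \<rho> * e x \<in> cball w \<rho>" for x
      using \<rho> by (simp add: e_def dist_norm norm_mult)
    have "continuous_on {0..1} (\<lambda>x. f (w + of_real \<rho> * e x))"
      by (rule continuous_on_compose2[OF fc ce]) (use img in auto)
    moreover have "continuous_on {0..1} (\<lambda>x. (of_real \<rho> * e x) ^ m)"
      unfolding e_def by (intro continuous_intros)
    ultimately show ?thesis
      unfolding h_def using ne by (intro continuous_on_divide) auto
  qed
  have "integrable lborel (\<lambda>x. indicator {0..1} x *\<^sub>R h x)"
    by (intro borel_integrable_compact ch) auto
  from has_integral_integral_lborel[OF this]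
  have "((\<lambda>x. if x \<in> {0..1} then h x else 0) has_integral (LINT x|lborel. indicator {0..1} x *\<^sub>R h x)) UNIV"
    by (rule has_integral_eq[rotated]) (auto simp: indicator_def)
  then have "(h has_integral (LINT x|lborel. indicator {0..1} x *\<^sub>R h x)) {0..1}"
    by (simp only: has_integral_restrict_UNIV)
  with hi have "(deriv ^^ m) f w / fact m = (LINT x|lborel. indicator {0..1} x *\<^sub>R h x)"
    by (rule has_integral_unique)
  then show ?thesis by (simp add: h_def e_def)
qed

text \<open>The result still takes the full vector \<open>z\<close> but ignores its j-th coordinate,
  so it can be expanded again in the remaining ones.\<close>

definition taylor_coeff :: "complex^'n::finite \<Rightarrow> 'n \<Rightarrow> nat \<Rightarrow> (complex^'n \<Rightarrow> complex) \<Rightarrow> complex^'n \<Rightarrow> complex" where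
  "taylor_coeff a j m g z = (deriv ^^ m) (\<lambda>t. g (vec_upd z j t)) (a $ j) / fact m"

text \<open>Exponents outside \<open>I\<close> are pinned to 0; the induction over \<open>I\<close>
  can thus keep one type of multi-indices.\<close>

definition multi_index :: "'n set \<Rightarrow> ('n \<Rightarrow> nat) set" where
  "multi_index I = {\<alpha>. \<forall>k. k \<notin> I \<longrightarrow> \<alpha> k = 0}"

lemma multi_index_insert_bij:
  assumes "j \<notin> I"
  shows "bij_betw (\<lambda>(m, \<beta>). \<beta>(j := m)) (UNIV \<times> multi_index I) (multi_index (insert j I))"
proof (rule bij_betw_byWitness[where f' = "\<lambda>\<alpha>. (\<alpha> j, \<alpha>(j := 0))"])
  show "\<forall>x\<in>UNIV \<times> multi_index I. (\<lambda>\<alpha>. (\<alpha> j, \<alpha>(j := 0))) ((\<lambda>(m, \<beta>). \<beta>(j := m)) x) = x"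
    using assms by (auto simp: multi_index_def fun_eq_iff)
qed (use assms in \<open>auto simp: multi_index_def\<close>)

context
  fixes a :: "complex^'n::finite" and r \<rho> :: real
  assumes \<rho>: "0 < \<rho>" "\<rho> < r"
begin

lemma sep_holomorphic_slice:
  assumes "sep_holomorphic (polydisc a r) g" "z \<in> polydisc a r"
  shows "(\<lambda>t. g (vec_upd z j t)) holomorphic_on ball (a $ j) r"
  unfolding holomorphic_on_def
proof
  fix t assume t: "t \<in> ball (a $ j) r"
  have "(\<lambda>s. g (vec_upd (vec_upd z j t) j s)) field_differentiable (at (vec_upd z j t $ j))"
    using assms(1) vec_upd_in_polydisc[OF assms(2) t] unfolding sep_holomorphic_def by blast
  then show "(\<lambda>t. g (vec_upd z j t)) field_differentiable at t within ball (a $ j) r"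
    by (simp add: field_differentiable_at_within)
qed

lemma taylor_coeff_bound:
  assumes g: "sep_holomorphic (polydisc a r) g" "\<And>z. z \<in> polydisc a r \<Longrightarrow> norm (g z) \<le> B"
    and z: "z \<in> polydisc a r"
  shows "norm (taylor_coeff a j m g z) \<le> B / \<rho> ^ m"
proof -
  have "norm ((deriv ^^ m) (\<lambda>t. g (vec_upd z j t)) (a $ j)) \<le> fact m * B / \<rho> ^ m"
  proof (rule Cauchy_inequality)
    have hol: "(\<lambda>t. g (vec_upd z j t)) holomorphic_on ball (a $ j) r"
      by (rule sep_holomorphic_slice[OF g(1) z])
    then show "(\<lambda>t. g (vec_upd z j t)) holomorphic_on ball (a $ j) \<rho>"
      using \<rho> by (auto intro: holomorphic_on_subset)
    show "continuous_on (cball (a $ j) \<rho>) (\<lambda>t. g (vec_upd z j t))"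
      using \<rho> by (intro holomorphic_on_imp_continuous_on holomorphic_on_subset[OF hol]) auto
    show "norm (g (vec_upd z j t)) \<le> B" if "norm (a $ j - t) = \<rho>" for t
      using \<rho> that by (intro g(2) vec_upd_in_polydisc z) (auto simp: dist_norm)
  qed (use \<rho> in auto)
  from divide_right_mono[OF this, of "fact m"] show ?thesis
    by (simp add: taylor_coeff_def norm_divide)
qed

text \<open>In direction \<open>j\<close> the coefficient is constant. In any other direction it is
  a Cauchy integral whose integrand is holomorphic in the parameter and bounded by B /
  \<rho>^m.\<close>

lemma sep_holomorphic_taylor_coeff:
  assumes g: "sep_holomorphic (polydisc a r) g" "\<And>z. z \<in> polydisc a r \<Longrightarrow> norm (g z) \<le> B"
  shows "sep_holomorphic (polydisc a r) (taylor_coeff a j m g)"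
  unfolding sep_holomorphic_def
proof (intro ballI allI)
  fix z i assume z: "z \<in> polydisc a r"
  show "(\<lambda>t. taylor_coeff a j m g (vec_upd z i t)) field_differentiable (at (z $ i))"
  proof (cases "i = j")
    case True
    then show ?thesis by (simp add: taylor_coeff_def)
  next
    case False
    define e where "e = (\<lambda>x::real. of_real \<rho> * exp (2 * of_real pi * \<i> * of_real x))"
    have ne: "norm (e x) = \<rho>" for x using \<rho> by (simp add: e_def norm_mult)
    then have eb: "a $ j + e x \<in> ball (a $ j) r" for x using \<rho> by (simp add: dist_norm)
    define s where "s = r - norm (z $ i - a $ i)"
    have s: "s > 0" using z by (simp add: s_def polydisc_def)
    have tb: "t \<in> ball (a $ i) r" if "t \<in> ball (z $ i) s" for t
      using that norm_triangle_ineq[of "t - z $ i" "z $ i - a $ i"] by (simp add: s_def dist_norm norm_minus_commute)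
    define F where "F = (\<lambda>t x. indicator {0..1} x *\<^sub>R (g (vec_upd (vec_upd z i t) j (a $ j + e x)) / e x ^ m))"
    have inD: "vec_upd (vec_upd z i t) j (a $ j + e x) \<in> polydisc a r" if "t \<in> ball (z $ i) s" for t x
      by (intro vec_upd_in_polydisc z eb tb that)
    have fd: "(\<lambda>t. LINT x|lborel. F t x) field_differentiable (at (z $ i))"
    proof (rule field_differentiable_integral_parameter[OF s])
      show "(\<lambda>t. F t x) holomorphic_on ball (z $ i) s" for x
      proof -
        have "(\<lambda>t. g (vec_upd (vec_upd z j (a $ j + e x)) i t)) holomorphic_on ball (a $ i) r"
          by (intro sep_holomorphic_slice g vec_upd_in_polydisc z eb)
        then have "(\<lambda>t. g (vec_upd (vec_upd z i t) j (a $ j + e x))) holomorphic_on ball (a $ i) r"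
          by (simp only: vec_upd_commute[OF False])
        then have "(\<lambda>t. g (vec_upd (vec_upd z i t) j (a $ j + e x))) holomorphic_on ball (z $ i) s"
          by (rule holomorphic_on_subset) (use tb in auto)
        moreover have "e x \<noteq> 0" using ne[of x] \<rho> by auto
        ultimately show ?thesis
          unfolding F_def scaleR_conv_of_real by (intro holomorphic_intros) auto
      qed
      show "F t \<in> borel_measurable lborel" if t: "t \<in> ball (z $ i) s" for t
      proof -
        have z': "vec_upd z i t \<in> polydisc a r" by (intro vec_upd_in_polydisc z tb t)
        have "continuous_on {0..1} (\<lambda>x. g (vec_upd (vec_upd z i t) j (a $ j + e x)))"
          by (rule continuous_on_compose2[OF holomorphic_on_imp_continuous_on[OF sep_holomorphic_slice[OF g(1) z', of j]]])
             (use eb in \<open>auto simp: e_def intro!: continuous_intros\<close>)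
        moreover have "continuous_on {0..1} (\<lambda>x. e x ^ m)"
          unfolding e_def by (intro continuous_intros)
        moreover have "e x \<noteq> 0" for x using ne[of x] \<rho> by auto
        ultimately have "continuous_on {0..1} (\<lambda>x. g (vec_upd (vec_upd z i t) j (a $ j + e x)) / e x ^ m)"
          by (intro continuous_on_divide) auto
        then have "integrable lborel (F t)"
          unfolding F_def by (intro borel_integrable_compact) auto
        then show ?thesis by simp
      qed
      show "norm (F t x) \<le> indicator {0..1} x *\<^sub>R (B / \<rho> ^ m)" if t: "t \<in> ball (z $ i) s" for t x
        using g(2)[OF inD[OF t, of x]] ne[of x] \<rho>
        by (cases "x \<in> {0..1}") (simp_all add: F_def norm_divide norm_power divide_right_mono)
      show "integrable lborel (\<lambda>x::real. indicator {0..1} x *\<^sub>R (B / \<rho> ^ m))"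
        by (intro borel_integrable_compact) auto
    qed
    have eq: "taylor_coeff a j m g (vec_upd z i t) = (LINT x|lborel. F t x)" if t: "t \<in> ball (z $ i) s" for t
      unfolding taylor_coeff_def F_def e_def
      by (rule higher_deriv_eq_integral[OF sep_holomorphic_slice \<rho>]) (intro g vec_upd_in_polydisc z tb t)+
    show ?thesis
      by (rule field_differentiable_transform_within[OF s _ _ fd]) (use eq in \<open>auto simp: dist_commute\<close>)
  qed
qed

text \<open>Induction over the set of coordinates allowed to move: expand in one variable and apply
  the hypothesis to its Taylor coefficients, which are bounded by B / \<rho>^m. At radius \<rho>/2
  the bounds form a geometric series of sum at most 2, hence the factor 2 per coordinate. The bound
  on finite sums yields the unconditional convergence that merges the iterated series into one over
  multi-indices.\<close>

lemma power_series_induct: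
  fixes I :: "'n set"
  assumes "sep_holomorphic (polydisc a r) g" "\<And>z. z \<in> polydisc a r \<Longrightarrow> norm (g z) \<le> B"
  shows "\<exists>c. (\<forall>F. finite F \<longrightarrow> F \<subseteq> multi_index I \<longrightarrow>
        (\<Sum>\<alpha>\<in>F. norm (c \<alpha>) * (\<Prod>k\<in>I. (\<rho> / 2) ^ \<alpha> k)) \<le> B * 2 ^ card I) \<and>
     (\<forall>z. (\<forall>k. k \<notin> I \<longrightarrow> z $ k = a $ k) \<longrightarrow> (\<forall>k. norm (z $ k - a $ k) \<le> \<rho> / 2) \<longrightarrow>
        ((\<lambda>\<alpha>. c \<alpha> * (\<Prod>k\<in>I. (z $ k - a $ k) ^ \<alpha> k)) has_sum g z) (multi_index I))"
  using finite[of I] assms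
proof (induction I arbitrary: g B rule: finite_induct)
  case empty
  have mi: "multi_index {} = {\<lambda>_. 0}" by (auto simp: multi_index_def)
  have "a \<in> polydisc a r" using \<rho> by (simp add: polydisc_def)
  then have B: "norm (g a) \<le> B" by (rule empty(2))
  show ?case
  proof (intro exI[of _ "\<lambda>_. g a"] conjI allI impI)
    fix F :: "('n \<Rightarrow> nat) set" assume "finite F" "F \<subseteq> multi_index {}"
    then have "F = {} \<or> F = {\<lambda>_. 0}" unfolding mi by blast
    then show "(\<Sum>\<alpha>\<in>F. norm (g a) * (\<Prod>k\<in>{}. (\<rho> / 2) ^ \<alpha> k)) \<le> B * 2 ^ card {}"
      using B order_trans[OF norm_ge_zero B] by auto
  next
    fix z :: "complex^'n" assume "\<forall>k. k \<notin> {} \<longrightarrow> z $ k = a $ k"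
    then have "z = a" by (simp add: vec_eq_iff)
    then show "((\<lambda>\<alpha>. g a * (\<Prod>k\<in>{}. (z $ k - a $ k) ^ \<alpha> k)) has_sum g z) (multi_index {})"
      using has_sum_finite[of "{\<lambda>_. 0}" "\<lambda>_. g a"] by (simp add: mi)
  qed
next
  case (insert j I)
  define P where "P = (\<lambda>m c. (\<forall>F. finite F \<longrightarrow> F \<subseteq> multi_index I \<longrightarrow>
        (\<Sum>\<alpha>\<in>F. norm (c \<alpha>) * (\<Prod>k\<in>I. (\<rho> / 2) ^ \<alpha> k)) \<le> B / \<rho> ^ m * 2 ^ card I) \<and>
     (\<forall>z. (\<forall>k. k \<notin> I \<longrightarrow> z $ k = a $ k) \<longrightarrow> (\<forall>k. norm (z $ k - a $ k) \<le> \<rho> / 2) \<longrightarrow>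
        ((\<lambda>\<alpha>. c \<alpha> * (\<Prod>k\<in>I. (z $ k - a $ k) ^ \<alpha> k)) has_sum taylor_coeff a j m g z) (multi_index I)))"
  have "\<exists>c. P m c" for m
    unfolding P_def
    by (rule insert.IH[OF sep_holomorphic_taylor_coeff[OF insert.prems] taylor_coeff_bound[OF insert.prems]])
  then obtain c where c: "\<And>m. P m (c m)" by metis
  have c1: "(\<Sum>\<alpha>\<in>F. norm (c m \<alpha>) * (\<Prod>k\<in>I. (\<rho> / 2) ^ \<alpha> k)) \<le> B / \<rho> ^ m * 2 ^ card I"
    if "finite F" "F \<subseteq> multi_index I" for m F
    using c[of m] that unfolding P_def by blast
  have c2: "((\<lambda>\<alpha>. c m \<alpha> * (\<Prod>k\<in>I. (z $ k - a $ k) ^ \<alpha> k)) has_sum taylor_coeff a j m g z) (multi_index I)"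
    if "\<And>k. k \<notin> I \<Longrightarrow> z $ k = a $ k" "\<And>k. norm (z $ k - a $ k) \<le> \<rho> / 2" for m z
    using c[of m] that unfolding P_def by blast
  define c' where "c' = (\<lambda>\<alpha>. c (\<alpha> j) (\<alpha>(j := 0)))"
  have c'_upd: "c' (\<beta>(j := m)) = c m \<beta>" if "\<beta> \<in> multi_index I" for m \<beta>
  proof -
    have "\<beta>(j := 0) = \<beta>" using that insert.hyps(2) by (auto simp: multi_index_def fun_eq_iff)
    then show ?thesis by (simp add: c'_def)
  qed
  have prod_upd: "(\<Prod>k\<in>insert j I. f k ^ (\<beta>(j := m)) k) = f j ^ m * (\<Prod>k\<in>I. f k ^ \<beta> k)"
    for f :: "'n \<Rightarrow> 'b::comm_monoid_mult" and m \<beta>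
  proof -
    have "(\<Prod>k\<in>I. f k ^ (\<beta>(j := m)) k) = (\<Prod>k\<in>I. f k ^ \<beta> k)"
      using insert.hyps by (intro prod.cong) auto
    then show ?thesis using insert.hyps by simp
  qed
  have prod_updR: "(\<Prod>k\<in>insert j I. (\<rho> / 2) ^ (\<beta>(j := m)) k) = (\<rho> / 2) ^ m * (\<Prod>k\<in>I. (\<rho> / 2) ^ \<beta> k)" for m \<beta>
    using prod_upd[of "\<lambda>_. \<rho> / 2"] by simp
  note bij = multi_index_insert_bij[OF insert.hyps(2)]
  have "a \<in> polydisc a r" using \<rho> by (simp add: polydisc_def)
  then have B0: "0 \<le> B" using insert.prems(2)[of a] norm_ge_zero[of "g a"] by linarith
  have bound: "(\<Sum>\<alpha>\<in>F. norm (c' \<alpha>) * (\<Prod>k\<in>insert j I. (\<rho> / 2) ^ \<alpha> k)) \<le> B * 2 ^ card (insert j I)"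
    if F: "finite F" "F \<subseteq> multi_index (insert j I)" for F
  proof -
    \<comment> \<open>One more than the largest j-th exponent in \<open>F\<close>; the inserted 0
      covers an empty \<open>F\<close>.\<close>
    define n where "n = Suc (Max (insert 0 ((\<lambda>\<alpha>. \<alpha> j) ` F)))"
    define F' where "F' = (\<lambda>\<alpha>. \<alpha>(j := 0)) ` F"
    have F': "finite F'" "F' \<subseteq> multi_index I"
      using F by (auto simp: F'_def multi_index_def)
    define T where "T = (\<lambda>\<alpha>. norm (c' \<alpha>) * (\<Prod>k\<in>insert j I. (\<rho> / 2) ^ \<alpha> k))"
    have T0: "0 \<le> T \<alpha>" for \<alpha> using \<rho> by (simp add: T_def prod_nonneg)
    have sub: "F \<subseteq> (\<lambda>(m, \<beta>). \<beta>(j := m)) ` ({..<n} \<times> F')"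
    proof
      fix \<alpha> assume \<alpha>: "\<alpha> \<in> F"
      then have "\<alpha> j < n" using F(1) by (auto simp: n_def less_Suc_eq_le)
      moreover have "\<alpha> = (\<alpha>(j := 0))(j := \<alpha> j)" by simp
      ultimately show "\<alpha> \<in> (\<lambda>(m, \<beta>). \<beta>(j := m)) ` ({..<n} \<times> F')"
        using \<alpha> unfolding F'_def by (intro image_eqI[of _ _ "(\<alpha> j, \<alpha>(j := 0))"]) auto
    qed
    have inj: "inj_on (\<lambda>(m, \<beta>). \<beta>(j := m)) ({..<n} \<times> F')"
      by (rule inj_on_subset[OF bij_betw_imp_inj_on[OF bij]]) (use F'(2) in auto)
    have "sum T F \<le> sum T ((\<lambda>(m, \<beta>). \<beta>(j := m)) ` ({..<n} \<times> F'))"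
      by (rule sum_mono2) (use sub T0 F' in auto)
    also have "\<dots> = (\<Sum>(m, \<beta>)\<in>{..<n} \<times> F'. T (\<beta>(j := m)))"
      by (subst sum.reindex[OF inj]) (simp add: o_def case_prod_unfold)
    also have "\<dots> = (\<Sum>m<n. \<Sum>\<beta>\<in>F'. T (\<beta>(j := m)))"
      by (simp add: sum.cartesian_product)
    also have "\<dots> = (\<Sum>m<n. (\<rho> / 2) ^ m * (\<Sum>\<beta>\<in>F'. norm (c m \<beta>) * (\<Prod>k\<in>I. (\<rho> / 2) ^ \<beta> k)))"
    proof (rule sum.cong[OF refl])
      fix m
      have "T (\<beta>(j := m)) = (\<rho> / 2) ^ m * (norm (c m \<beta>) * (\<Prod>k\<in>I. (\<rho> / 2) ^ \<beta> k))" if "\<beta> \<in> F'" for \<beta>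
        using c'_upd[of \<beta> m] that F'(2) unfolding T_def prod_updR by auto
      then show "(\<Sum>\<beta>\<in>F'. T (\<beta>(j := m))) = (\<rho> / 2) ^ m * (\<Sum>\<beta>\<in>F'. norm (c m \<beta>) * (\<Prod>k\<in>I. (\<rho> / 2) ^ \<beta> k))"
        by (simp add: sum_distrib_left)
    qed
    also have "\<dots> \<le> (\<Sum>m<n. (\<rho> / 2) ^ m * (B / \<rho> ^ m * 2 ^ card I))"
      by (intro sum_mono mult_left_mono c1 F') (use \<rho> in auto)
    also have "\<dots> = (\<Sum>m<n. (1/2) ^ m) * (B * 2 ^ card I)"
      unfolding sum_distrib_right
    proof (rule sum.cong[OF refl])
      fix m :: nat
      show "(\<rho> / 2) ^ m * (B / \<rho> ^ m * 2 ^ card I) = (1/2) ^ m * (B * 2 ^ card I)"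
        using \<rho> by (simp add: power_divide)
    qed
    also have "\<dots> \<le> 2 * (B * 2 ^ card I)"
    proof (rule mult_right_mono)
      have "(\<Sum>m<n. (1/2) ^ m) \<le> (\<Sum>m. (1/2 :: real) ^ m)"
        by (intro sum_le_suminf summable_geometric) auto
      then show "(\<Sum>m<n. (1/2) ^ m) \<le> (2 :: real)" by (simp add: suminf_geometric)
    qed (use B0 in auto)
    finally show ?thesis using insert.hyps by (simp add: T_def mult_ac)
  qed
  have sums: "((\<lambda>\<alpha>. c' \<alpha> * (\<Prod>k\<in>insert j I. (z $ k - a $ k) ^ \<alpha> k)) has_sum g z) (multi_index (insert j I))"
    if z: "\<And>k. k \<notin> insert j I \<Longrightarrow> z $ k = a $ k" "\<And>k. norm (z $ k - a $ k) \<le> \<rho> / 2" for z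
  proof -
    define T where "T = (\<lambda>\<alpha>. c' \<alpha> * (\<Prod>k\<in>insert j I. (z $ k - a $ k) ^ \<alpha> k))"
    have zD: "z \<in> polydisc a r"
      unfolding polydisc_def
    proof (intro CollectI allI)
      fix k
      show "norm (z $ k - a $ k) < r" using z(2)[of k] \<rho> by linarith
    qed
    have "T summable_on multi_index (insert j I)"
    proof (rule abs_summable_summable, rule nonneg_bdd_above_summable_on)
      show "bdd_above (sum (\<lambda>\<alpha>. norm (T \<alpha>)) ` {F. F \<subseteq> multi_index (insert j I) \<and> finite F})"
      proof (rule bdd_aboveI2)
        fix F assume F: "F \<in> {F. F \<subseteq> multi_index (insert j I) \<and> finite F}"
        have "(\<Sum>\<alpha>\<in>F. norm (T \<alpha>)) \<le> (\<Sum>\<alpha>\<in>F. norm (c' \<alpha>) * (\<Prod>k\<in>insert j I. (\<rho> / 2) ^ \<alpha> k))"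
          unfolding T_def norm_mult
          by (intro sum_mono mult_left_mono) (auto simp: prod_norm[symmetric] norm_power intro!: prod_mono power_mono z(2))
        also have "\<dots> \<le> B * 2 ^ card (insert j I)" using F by (intro bound) auto
        finally show "(\<Sum>\<alpha>\<in>F. norm (T \<alpha>)) \<le> B * 2 ^ card (insert j I)" .
      qed
    qed auto
    then obtain S where S: "(T has_sum S) (multi_index (insert j I))"
      by (auto simp: summable_on_def)
    then have S': "((\<lambda>(m, \<beta>). T (\<beta>(j := m))) has_sum S) (UNIV \<times> multi_index I)"
      using has_sum_reindex_bij_betw[OF bij, of T S] by (simp add: case_prod_unfold)
    \<comment> \<open>The sum \<open>S\<close> exists already, so it may be computed fibre by fibre.
      The outer series is then the Taylor series in the j-th variable, which identifies
      \<open>S\<close>.\<close>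
    have "((\<lambda>m. (z $ j - a $ j) ^ m * taylor_coeff a j m g z) has_sum S) UNIV"
    proof (rule has_sum_SigmaD[OF S'])
      fix m :: nat
      define z' where "z' = vec_upd z j (a $ j)"
      have "((\<lambda>\<alpha>. c m \<alpha> * (\<Prod>k\<in>I. (z' $ k - a $ k) ^ \<alpha> k)) has_sum taylor_coeff a j m g z') (multi_index I)"
        by (rule c2) (use z \<rho> in \<open>auto simp: z'_def\<close>)
      moreover have "taylor_coeff a j m g z' = taylor_coeff a j m g z"
        by (simp add: taylor_coeff_def z'_def)
      moreover have "(\<Prod>k\<in>I. (z' $ k - a $ k) ^ \<alpha> k) = (\<Prod>k\<in>I. (z $ k - a $ k) ^ \<alpha> k)" for \<alpha>
        using insert.hyps by (intro prod.cong) (auto simp: z'_def)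
      ultimately have "((\<lambda>\<alpha>. c m \<alpha> * (\<Prod>k\<in>I. (z $ k - a $ k) ^ \<alpha> k)) has_sum taylor_coeff a j m g z) (multi_index I)"
        by simp
      then have "((\<lambda>\<alpha>. (z $ j - a $ j) ^ m * (c m \<alpha> * (\<Prod>k\<in>I. (z $ k - a $ k) ^ \<alpha> k))) has_sum
          ((z $ j - a $ j) ^ m * taylor_coeff a j m g z)) (multi_index I)"
        by (rule has_sum_cmult_right)
      moreover have "(z $ j - a $ j) ^ m * (c m \<beta> * (\<Prod>k\<in>I. (z $ k - a $ k) ^ \<beta> k)) = T (\<beta>(j := m))"
        if "\<beta> \<in> multi_index I" for \<beta>
        unfolding T_def prod_upd c'_upd[OF that] by simp
      ultimately show "((\<lambda>\<beta>. case (m, \<beta>) of (m, \<beta>) \<Rightarrow> T (\<beta>(j := m))) has_sum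
          ((z $ j - a $ j) ^ m * taylor_coeff a j m g z)) (multi_index I)"
        using has_sum_cong[of "multi_index I" "\<lambda>\<beta>. (z $ j - a $ j) ^ m * (c m \<beta> * (\<Prod>k\<in>I. (z $ k - a $ k) ^ \<beta> k))" "\<lambda>\<beta>. T (\<beta>(j := m))"] by simp
    qed
    then have 1: "(\<lambda>m. (z $ j - a $ j) ^ m * taylor_coeff a j m g z) sums S"
      by (rule has_sum_imp_sums)
    have "z $ j \<in> ball (a $ j) r"
      using zD by (simp add: polydisc_def dist_norm norm_minus_commute)
    from holomorphic_power_series[OF sep_holomorphic_slice[OF insert.prems(1) zD, of j] this]
    have "(\<lambda>m. (z $ j - a $ j) ^ m * taylor_coeff a j m g z) sums g z"
      by (simp add: taylor_coeff_def mult.commute)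
    with 1 have "S = g z" by (rule sums_unique2)
    then show ?thesis using S by (simp add: T_def)
  qed
  show ?case
    by (rule exI[of _ c']) (use bound sums in blast)
qed

end

lemma analytic_on_Cn_Osgood:
  assumes S: "open S" and g: "locally_bounded S g" "sep_holomorphic S g"
  shows "analytic_on_Cn S g"
  unfolding analytic_on_Cn_def
proof (intro conjI ballI S)
  fix a assume a: "a \<in> S"
  obtain r1 B where r1: "r1 > 0" "\<And>z. z \<in> ball a r1 \<inter> S \<Longrightarrow> norm (g z) \<le> B"
    using g(1) a unfolding locally_bounded_def by meson
  obtain r2 where r2: "r2 > 0" "ball a r2 \<subseteq> S"
    using S a openE by blast
  \<comment> \<open>The Euclidean norm is at most the sum of the coordinate norms, so dividing by
    the dimension puts the polydisc inside both balls.\<close>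
  define r where "r = min r1 r2 / real (CARD('a))"
  have r: "r > 0" using r1 r2 by (simp add: r_def)
  have sub: "z \<in> ball a (min r1 r2)" if "z \<in> polydisc a r" for z
  proof -
    have "norm (z - a) \<le> (\<Sum>k\<in>UNIV. norm ((z - a) $ k))" unfolding norm_vec_def by (rule L2_set_le_sum) simp
    also have "\<dots> < (\<Sum>k\<in>(UNIV :: 'a set). r)"
      using that by (intro sum_strict_mono) (auto simp: polydisc_def)
    finally show ?thesis by (simp add: r_def dist_norm norm_minus_commute)
  qed
  have "polydisc a r \<subseteq> S" using sub r2 by auto
  then have sep: "sep_holomorphic (polydisc a r) g"
    using g(2) unfolding sep_holomorphic_def by blast
  have bd: "norm (g z) \<le> B" if "z \<in> polydisc a r" for z
    using sub[OF that] r2 by (intro r1) auto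
  have \<rho>: "0 < r / 2" "r / 2 < r" using r by auto
  have mi: "multi_index UNIV = UNIV" by (simp add: multi_index_def)
  obtain c where c: "\<And>z. (\<And>k. norm (z $ k - a $ k) \<le> r / 4) \<Longrightarrow>
      ((\<lambda>\<alpha>. c \<alpha> * (\<Prod>k\<in>UNIV. (z $ k - a $ k) ^ \<alpha> k)) has_sum g z) UNIV"
    using power_series_induct[OF \<rho> sep bd, of UNIV] unfolding mi by auto
  show "\<exists>r>0. \<exists>c. \<forall>z\<in>ball a r. ((\<lambda>\<alpha>. c \<alpha> * (\<Prod>k\<in>UNIV. (z $ k - a $ k) ^ \<alpha> k)) has_sum g z) UNIV"
  proof (intro exI[of _ "r / 4"] conjI exI[of _ c] ballI c)
    fix z k assume "z \<in> ball a (r / 4)"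
    then have "norm (z - a) < r / 4" by (simp add: dist_norm norm_minus_commute)
    moreover have "norm ((z - a) $ k) \<le> norm (z - a)" by (rule Finite_Cartesian_Product.norm_nth_le)
    ultimately show "norm (z $ k - a $ k) \<le> r / 4" by simp
  qed (use r in auto)
qed

section \<open>Series of cutoff terms\<close>

definition shell :: "real \<Rightarrow> real \<Rightarrow> (real^'n::finite) set" where
  "shell a b = {y. a \<le> norm y \<and> norm y \<le> b}"

lemma compact_shell: "compact (shell a b :: (real^'n::finite) set)"
proof -
  have "(shell a b :: (real^'n) set) = cball 0 b \<inter> (norm -` {a..})" by (auto simp: shell_def)
  moreover have "closed (norm -` {a..} :: (real^'n) set)"
    by (intro closed_vimage continuous_intros closed_atLeast)
  ultimately show ?thesis using compact_Int_closed[OF compact_cball] by metis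
qed

lemma norm_set_integral_le:
  fixes g :: "real^'n::finite \<Rightarrow> complex"
  assumes "compact K" "continuous_on K g" "\<And>y. y \<in> K \<Longrightarrow> norm (g y) \<le> B"
  shows "norm (LINT y:K|lborel. g y) \<le> measure lborel K * B"
proof -
  have "norm (LINT y|lborel. indicator K y *\<^sub>R g y) \<le> (LINT y|lborel. indicator K y *\<^sub>R B)"
  proof (rule order_trans[OF integral_norm_bound integral_mono])
    show "integrable lborel (\<lambda>y. norm (indicator K y *\<^sub>R g y))" by (intro integrable_norm borel_integrable_compact assms)
    show "integrable lborel (\<lambda>y. indicator K y *\<^sub>R B)" by (intro borel_integrable_compact assms continuous_on_const)
  qed (auto simp: indicator_def assms)
  also have "\<dots> = measure lborel K * B"
    using assms(1) by (simp add: compact_imp_closed borel_closed)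
  finally show ?thesis by (simp add: set_lebesgue_integral_def)
qed

lemma bounded_continuous_compact:
  fixes g :: "'a::topological_space \<Rightarrow> 'b::real_normed_vector"
  assumes "compact K" "continuous_on K g"
  obtains B where "B \<ge> 0" "\<And>y. y \<in> K \<Longrightarrow> norm (g y) \<le> B"
proof -
  have "bounded (g ` K)" by (intro compact_imp_bounded compact_continuous_image assms)
  then obtain B where "\<forall>y\<in>K. norm (g y) \<le> B" unfolding bounded_iff by auto
  then show ?thesis using that[of "max B 0"] by (meson max.cobounded1 max.cobounded2 order_trans)
qed

text \<open>Apart from the power of the shifted form, the dependence on p is affine, with
  coefficients built from the kernel of index 0. One compactness bound therefore serves all p, and
  holomorphy in \<open>z\<close> is reduced to index 0.\<close>

lemma cut_term_factor:
  fixes z :: "complex^'n::finite"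
  shows "cut_term w1 w2 e l z p y = shifted_qform e z y ^ p *
    ((\<Sum>i\<in>UNIV. w2 i y) * kernel0 e l z 0 y +
     (of_nat p + kexp TYPE('n)) * (- 4 * (\<Sum>i\<in>UNIV. w1 i y * (z $ i - of_real (y $ i))) * (kernel0 e l z 0 y / shifted_qform e z y)))"
proof -
  have k: "kernel0 e l z p y = shifted_qform e z y ^ p * kernel0 e l z 0 y"
    by (simp add: kernel0_def radial_power_def)
  have "2 * w1 i y * kernel1 e l z p i y = (shifted_qform e z y ^ p * ((of_nat p + kexp TYPE('n)) *
      (- 4 * (kernel0 e l z 0 y / shifted_qform e z y)))) * (w1 i y * (z $ i - of_real (y $ i)))" for i
  proof -
    have gen: "2 * W * (- 2 * c * Z * (P * K / Q)) = (P * (c * (- 4 * (K / Q)))) * (W * Z)"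
      for W c Z P K Q :: complex by simp
    show ?thesis unfolding kernel1_def k by (rule gen)
  qed
  then have "cut_term w1 w2 e l z p y = (\<Sum>i\<in>UNIV. w2 i y) * kernel0 e l z p y +
     (shifted_qform e z y ^ p * ((of_nat p + kexp TYPE('n)) *
      (- 4 * (kernel0 e l z 0 y / shifted_qform e z y)))) * (\<Sum>i\<in>UNIV. w1 i y * (z $ i - of_real (y $ i)))"
    unfolding cut_term_def sum.distrib by (simp only: sum_distrib_left sum_distrib_right)
  then show ?thesis unfolding k by (simp add: algebra_simps)
qed

lemma continuous_on_cut_term:
  fixes z :: "'a::topological_space \<Rightarrow> complex^'n::finite"
  assumes c: "continuous_on S e" "continuous_on S l" "continuous_on S z" "continuous_on S y"
    and w: "\<And>i. continuous_on S (\<lambda>x. w1 i (y x))" "\<And>i. continuous_on S (\<lambda>x. w2 i (y x))"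
    and reg: "\<And>x. x \<in> S \<Longrightarrow> shifted_qform (e x) (z x) (y x) / l x \<notin> \<real>\<^sub>\<le>\<^sub>0"
  shows "continuous_on S (\<lambda>x. cut_term w1 w2 (e x) (l x) (z x) p (y x))"
  unfolding cut_term_def
  by (intro continuous_intros w continuous_on_kernel(1,2)[OF c] reg)

lemma cut_term_bound:
  fixes z :: "'a::topological_space \<Rightarrow> complex^'n::finite"
  assumes T: "compact T" and K: "compact K"
    and c: "continuous_on T e" "continuous_on T l" "continuous_on T z"
    and w: "\<And>i. continuous_on K (w1 i)" "\<And>i. continuous_on K (w2 i)"
    and reg: "\<And>t y. t \<in> T \<Longrightarrow> y \<in> K \<Longrightarrow> shifted_qform (e t) (z t) y / l t \<notin> \<real>\<^sub>\<le>\<^sub>0"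
  obtains C where "C \<ge> 0" "\<And>t y p. t \<in> T \<Longrightarrow> y \<in> K \<Longrightarrow>
      norm (cut_term w1 w2 (e t) (l t) (z t) p y) \<le> C * (real p + (1 + norm (kexp TYPE('n)))) * norm (shifted_qform (e t) (z t) y) ^ p"
proof -
  define A0 where "A0 = (\<lambda>(t, y). (\<Sum>i\<in>UNIV. w2 i y) * kernel0 (e t) (l t) (z t) 0 y)"
  define A1 where "A1 = (\<lambda>(t, y). - 4 * (\<Sum>i\<in>UNIV. w1 i y * (z t $ i - of_real (y $ i))) *
     (kernel0 (e t) (l t) (z t) 0 y / shifted_qform (e t) (z t) y))"
  have ccc: "continuous_on (T \<times> K) (\<lambda>x. e (fst x))" "continuous_on (T \<times> K) (\<lambda>x. l (fst x))"
    "continuous_on (T \<times> K) (\<lambda>x. z (fst x))" "continuous_on (T \<times> K) (\<lambda>x. snd x)"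
    "continuous_on (T \<times> K) (\<lambda>x. w1 i (snd x))" "continuous_on (T \<times> K) (\<lambda>x. w2 i (snd x))" for i
    by (auto intro!: continuous_on_compose2[OF c(1)] continuous_on_compose2[OF c(2)] continuous_on_compose2[OF c(3)]
        continuous_on_compose2[OF w(1)] continuous_on_compose2[OF w(2)] continuous_intros)
  have reg': "shifted_qform (e (fst x)) (z (fst x)) (snd x) / l (fst x) \<notin> \<real>\<^sub>\<le>\<^sub>0" if "x \<in> T \<times> K" for x
    using that reg[of "fst x" "snd x"] by auto
  have nz: "\<forall>x\<in>T \<times> K. shifted_qform (e (fst x)) (z (fst x)) (snd x) \<noteq> 0"
    using reg' by force
  note k0 = continuous_on_kernel(1)[OF ccc(1-4) reg', of 0]
  have "continuous_on (T \<times> K) A0"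
    unfolding A0_def case_prod_unfold by (intro continuous_intros ccc k0)
  then obtain C0 where C0: "C0 \<ge> 0" "\<And>x. x \<in> T \<times> K \<Longrightarrow> norm (A0 x) \<le> C0"
    using bounded_continuous_compact[OF compact_Times[OF T K]] by metis
  have "continuous_on (T \<times> K) A1"
    unfolding A1_def case_prod_unfold by (intro continuous_intros ccc k0 continuous_on_shifted_qform nz)
  then obtain C1 where C1: "C1 \<ge> 0" "\<And>x. x \<in> T \<times> K \<Longrightarrow> norm (A1 x) \<le> C1"
    using bounded_continuous_compact[OF compact_Times[OF T K]] by metis
  show ?thesis
  proof (rule that[of "C0 + C1"])
    fix t y and p :: nat assume ty: "t \<in> T" "y \<in> K"
    define s where "s = kexp TYPE('n)"
    have "norm (cut_term w1 w2 (e t) (l t) (z t) p y) = norm (shifted_qform (e t) (z t) y) ^ p * norm (A0 (t, y) + (of_nat p + s) * A1 (t, y))"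
      unfolding cut_term_factor A0_def A1_def s_def by (simp add: norm_mult norm_power)
    moreover have "norm (A0 (t, y) + (of_nat p + s) * A1 (t, y)) \<le> C0 + (real p + norm s) * C1"
    proof -
      have "norm ((of_nat p + s) * A1 (t, y)) \<le> (real p + norm s) * C1"
        unfolding norm_mult
        by (intro mult_mono C1(2)) (use ty norm_triangle_ineq[of "of_nat p" s] in auto)
      then show ?thesis
        using C0(2)[of "(t, y)"] ty norm_triangle_ineq[of "A0 (t, y)" "(of_nat p + s) * A1 (t, y)"] by auto
    qed
    moreover have "C0 + (real p + norm s) * C1 \<le> (C0 + C1) * (real p + (1 + norm s))"
    proof -
      have "C0 * 1 \<le> C0 * (real p + (1 + norm s))" using C0(1) by (intro mult_left_mono) auto
      moreover have "(real p + norm s) * C1 \<le> C1 * (real p + (1 + norm s))" using C1(1) by (simp add: algebra_simps)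
      ultimately show ?thesis by (simp add: distrib_right)
    qed
    ultimately have "norm (cut_term w1 w2 (e t) (l t) (z t) p y) \<le>
        norm (shifted_qform (e t) (z t) y) ^ p * ((C0 + C1) * (real p + (1 + norm s)))"
      by (simp only:) (intro mult_left_mono, linarith, simp)
    then show "norm (cut_term w1 w2 (e t) (l t) (z t) p y) \<le> (C0 + C1) * (real p + (1 + norm (kexp TYPE('n)))) * norm (shifted_qform (e t) (z t) y) ^ p"
      by (simp only: s_def mult.commute)
  qed (use C0(1) C1(1) in auto)
qed

section \<open>Convergence of the series in an annulus and independence of the shell\<close>

abbreviation round_annulus :: "real \<Rightarrow> real \<Rightarrow> (real^'n::finite) set" where
  "round_annulus r0 r1 \<equiv> {x. r0 < norm x \<and> norm x < r1}"

text \<open>The outer radius is a real number here, and the type condition is written as a product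
  so that it covers \<tau> = 0.\<close>

locale polyharmonic_annulus =
  fixes f :: "real^'n::finite \<Rightarrow> complex" and r0 r1 \<tau> :: real
  assumes odd_dim: "odd CARD('n)"
    and r0: "0 \<le> r0" and r01: "r0 < r1" and \<tau>: "0 \<le> \<tau>" and type_bound: "2 * r1 * \<tau> < 1"
    and smooth: "smooth_on (round_annulus r0 r1) f"
    and growth: "\<And>K \<epsilon>. compact K \<Longrightarrow> K \<subseteq> (round_annulus r0 r1) \<Longrightarrow> 0 < \<epsilon> \<Longrightarrow>
      \<exists>C>0. \<forall>p. \<forall>x\<in>K. norm ((laplacian ^^ p) f x) \<le> C * fact (2 * p) * (\<tau> + \<epsilon>) ^ (2 * p)"
begin

abbreviation "u p \<equiv> (laplacian ^^ p) f"

lemma open_round_annulus: "open (round_annulus r0 r1 :: (real^'n) set)"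
proof -
  have "open ((\<lambda>x::real^'n. norm x) -` {r0<..<r1})" by (intro open_vimage continuous_intros open_greaterThanLessThan)
  moreover have "(\<lambda>x::real^'n. norm x) -` {r0<..<r1} = round_annulus r0 r1" by auto
  ultimately show ?thesis by simp
qed

lemma shell_subset: "r0 < a \<Longrightarrow> b < r1 \<Longrightarrow> (shell a b :: (real^'n) set) \<subseteq> round_annulus r0 r1"
  by (auto simp: shell_def)

lemma continuous_on_u: "K \<subseteq> round_annulus r0 r1 \<Longrightarrow> continuous_on K (u p)"
  using smooth_on_continuous[OF smooth_on_iterated_laplacian[OF open_round_annulus smooth]] continuous_on_subset by blast

text \<open>A suitable \<epsilon> keeps R (\<tau> + \<epsilon>) below 1, and its square is the ratio
  \<open>x\<close>. The type bound thus becomes geometric decay that absorbs p-th powers of R^2, up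
  to the factorial cancelled by \<open>kcoeff\<close>.\<close>

lemma growth_shell:
  assumes "r0 < a" "b < r1" "0 \<le> R" "R * \<tau> < 1"
  obtains C x where "C \<ge> 0" "0 \<le> x" "x < 1"
    "\<And>p y. y \<in> shell a b \<Longrightarrow> norm (u p y) * (R\<^sup>2) ^ p \<le> C * fact (2 * p) * x ^ p"
proof -
  \<comment> \<open>Half of the gap 1 - R \<tau>, divided by R + 1 instead of R so that R = 0 is
    allowed.\<close>
  define \<epsilon> where "\<epsilon> = ((1 - R * \<tau>) / 2) / (R + 1)"
  have \<epsilon>: "\<epsilon> > 0" using assms by (simp add: \<epsilon>_def)
  have "R * \<epsilon> \<le> (R + 1) * \<epsilon>" using \<epsilon> by simp
  also have "\<dots> = (1 - R * \<tau>) / 2"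
  proof -
    have "X * (Y / X) = Y" if "X > 0" for X Y :: real using that by simp
    from this[of "R + 1"] show ?thesis unfolding \<epsilon>_def using assms(3) by (simp only:)
  qed
  finally have lt: "R * (\<tau> + \<epsilon>) < 1" using assms by (simp add: distrib_left)
  have ge: "0 \<le> R * (\<tau> + \<epsilon>)" using assms \<tau> \<epsilon> by simp
  obtain C where C: "C > 0" "\<forall>p. \<forall>x\<in>shell a b. norm (u p x) \<le> C * fact (2 * p) * (\<tau> + \<epsilon>) ^ (2 * p)"
    using growth[OF compact_shell shell_subset[OF assms(1,2)] \<epsilon>] by auto
  show ?thesis
  proof (rule that[of C "(R * (\<tau> + \<epsilon>))\<^sup>2"])
    show "(R * (\<tau> + \<epsilon>))\<^sup>2 < 1" using lt ge by (simp add: power_less_one_iff abs_square_less_1)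
    fix p and y :: "real^'n" assume "y \<in> shell a b"
    then have "norm (u p y) \<le> C * fact (2 * p) * (\<tau> + \<epsilon>) ^ (2 * p)" using C by blast
    then have "norm (u p y) * (R\<^sup>2) ^ p \<le> C * fact (2 * p) * (\<tau> + \<epsilon>) ^ (2 * p) * (R\<^sup>2) ^ p"
      by (rule mult_right_mono) simp
    then show "norm (u p y) * (R\<^sup>2) ^ p \<le> C * fact (2 * p) * ((R * (\<tau> + \<epsilon>))\<^sup>2) ^ p"
      unfolding power_mult_distrib power_mult[of "\<tau> + \<epsilon>"] by (simp only: mult_ac)
  qed (use C in auto)
qed

definition cut_int :: "complex \<Rightarrow> complex \<Rightarrow> complex^'n \<Rightarrow> real \<Rightarrow> real \<Rightarrow> nat \<Rightarrow> complex" where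
  "cut_int e l z a b p = (LINT y:shell a b|lborel. cut_term (cut1 a b) (cut2 a b) e l z p y * u p y)"

definition regular :: "complex \<Rightarrow> complex \<Rightarrow> complex^'n \<Rightarrow> real \<Rightarrow> real \<Rightarrow> bool" where
  "regular e l z a b \<longleftrightarrow> (\<forall>y\<in>shell a b. shifted_qform e z y / l \<notin> \<real>\<^sub>\<le>\<^sub>0)"

lemma continuous_on_cut_integrand:
  assumes "regular e l z a b" "r0 < a" "b < r1"
  shows "continuous_on (shell a b) (\<lambda>y. cut_term (cut1 a b) (cut2 a b) e l z p y * u p y)"
  by (intro continuous_on_mult continuous_on_cut_term continuous_on_u shell_subset continuous_on_cut continuous_intros)
     (use assms in \<open>auto simp: regular_def\<close>)

lemma cut_term_eq_0: "(\<And>i. w1 i y = 0) \<Longrightarrow> (\<And>i. w2 i y = 0) \<Longrightarrow> cut_term w1 w2 e l z p y = 0"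
  by (simp add: cut_term_def)

text \<open>The derivatives of a cutoff vanish off its shell, so integrals over two shells can be
  compared on a common larger set.\<close>

lemma cut_int_indicator:
  assumes "0 \<le> a" "a < b" "shell a b \<subseteq> K"
  shows "indicator K y *\<^sub>R (cut_term (cut1 a b) (cut2 a b) e l z p y * u p y) =
    indicator (shell a b) y *\<^sub>R (cut_term (cut1 a b) (cut2 a b) e l z p y * u p y)"
proof (cases "y \<in> shell a b")
  case False
  then have "cut1 a b i y = 0" "cut2 a b i y = 0" for i
    using cut_inner[of a b y i] cut_outer[of a b y i] assms by (auto simp: shell_def)
  then show ?thesis by (simp add: cut_term_eq_0)
qed (use assms in auto)

lemma cut_int_diff:
  assumes ab: "r0 < a" "a < b" "b < r1" "r0 < a'" "a' < b'" "b' < r1"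
    and sub: "shell a b \<subseteq> K" "shell a' b' \<subseteq> K"
    and reg: "regular e l z a b" "regular e l z a' b'"
  shows "(LINT y:K|lborel. cut_term (\<lambda>i y. cut1 a b i y - cut1 a' b' i y) (\<lambda>i y. cut2 a b i y - cut2 a' b' i y) e l z p y * u p y)
    = cut_int e l z a b p - cut_int e l z a' b' p"
proof -
  have "cut_term (\<lambda>i y. cut1 a b i y - cut1 a' b' i y) (\<lambda>i y. cut2 a b i y - cut2 a' b' i y) e l z p y * u p y =
     cut_term (cut1 a b) (cut2 a b) e l z p y * u p y - cut_term (cut1 a' b') (cut2 a' b') e l z p y * u p y" for y
    unfolding cut_term_def left_diff_distrib[symmetric] sum_subtractf[symmetric]
    by (simp add: algebra_simps)
  moreover have "integrable lborel (\<lambda>y. indicator (shell a b) y *\<^sub>R (cut_term (cut1 a b) (cut2 a b) e l z p y * u p y))"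
    "integrable lborel (\<lambda>y. indicator (shell a' b') y *\<^sub>R (cut_term (cut1 a' b') (cut2 a' b') e l z p y * u p y))"
    using assms by (auto intro!: borel_integrable_compact compact_shell continuous_on_cut_integrand)
  moreover note cut_int_indicator[OF order_trans[OF r0 less_imp_le[OF ab(1)]] ab(2) sub(1)]
    cut_int_indicator[OF order_trans[OF r0 less_imp_le[OF ab(4)]] ab(5) sub(2)]
  ultimately show ?thesis
    unfolding set_lebesgue_integral_def cut_int_def
    by (simp only: scaleR_diff_right Bochner_Integration.integral_diff)
qed

text \<open>The terms of the series grow only linearly in the polynomial factor. The square leaves
  room for (2N + 2)(2N + 1), which the remainder acquires from its higher Laplacian power.\<close>

definition majorant :: "real \<Rightarrow> nat \<Rightarrow> real" where
  "majorant x p = norm (kcoeff TYPE('n) p) * fact (2 * p) * (real p + (1 + norm (kexp TYPE('n))))\<^sup>2 * x ^ p"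

lemma summable_majorant: "0 \<le> x \<Longrightarrow> x < 1 \<Longrightarrow> summable (majorant x)"
  unfolding majorant_def[abs_def] by (rule summable_kcoeff[OF odd_dim]) (auto simp: add_pos_nonneg)

text \<open>The bound is uniform over a compact parameter set: a one-point set gives convergence of
  a single series, a closed ball of \<open>z\<close> gives local uniformity.\<close>

lemma cut_int_bound:
  fixes T :: "'a::topological_space set"
  assumes T: "compact T" "continuous_on T l" "continuous_on T z"
    and ab: "r0 < a" "b < r1" and R: "0 \<le> R" "R * \<tau> < 1"
    and reg: "\<And>t. t \<in> T \<Longrightarrow> regular 0 (l t) (z t) a b"
    and le: "\<And>t y. t \<in> T \<Longrightarrow> y \<in> shell a b \<Longrightarrow> norm (shifted_qform 0 (z t) y) \<le> R\<^sup>2"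
  shows "\<exists>C x. 0 \<le> x \<and> x < 1 \<and> (\<forall>t\<in>T. \<forall>p. norm (kcoeff TYPE('n) p * cut_int 0 (l t) (z t) a b p) \<le> C * majorant x p)"
proof -
  obtain C where C: "C \<ge> 0" "\<And>t y p. t \<in> T \<Longrightarrow> y \<in> shell a b \<Longrightarrow>
      norm (cut_term (cut1 a b) (cut2 a b) 0 (l t) (z t) p y) \<le> C * (real p + (1 + norm (kexp TYPE('n)))) * norm (shifted_qform 0 (z t) y) ^ p"
    by (rule cut_term_bound[where e = "\<lambda>_. 0" and l = l and z = z and ?w1.0 = "cut1 a b" and ?w2.0 = "cut2 a b", OF T(1) compact_shell[of a b] continuous_on_const T(2,3) continuous_on_cut(2,3)])
       (use reg in \<open>auto simp: regular_def\<close>)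
  obtain D x where D: "D \<ge> 0" "0 \<le> x" "x < 1"
    "\<And>p y. y \<in> shell a b \<Longrightarrow> norm (u p y) * (R\<^sup>2) ^ p \<le> D * fact (2 * p) * x ^ p"
    by (rule growth_shell[OF ab R]) blast
  define V where "V = measure lborel (shell a b :: (real^'n) set)"
  have V: "V \<ge> 0" by (simp add: V_def)
  show ?thesis
  proof (rule exI[of _ "V * C * D"], rule exI[of _ x], intro conjI ballI allI D(2,3))
    fix t p assume t: "t \<in> T"
    have "norm (cut_int 0 (l t) (z t) a b p) \<le> V * (C * (real p + (1 + norm (kexp TYPE('n)))) * (D * fact (2 * p) * x ^ p))"
      unfolding cut_int_def V_def
    proof (rule norm_set_integral_le[OF compact_shell continuous_on_cut_integrand[OF reg[OF t] ab]])
      fix y :: "real^'n" assume y: "y \<in> shell a b"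
      have "norm (cut_term (cut1 a b) (cut2 a b) 0 (l t) (z t) p y) \<le> C * (real p + (1 + norm (kexp TYPE('n)))) * (R\<^sup>2) ^ p"
        by (rule order_trans[OF C(2)[OF t y] mult_left_mono[OF power_mono[OF le[OF t y]]]])
           (use C(1) in \<open>auto intro!: mult_nonneg_nonneg add_nonneg_nonneg\<close>)
      then have "norm (cut_term (cut1 a b) (cut2 a b) 0 (l t) (z t) p y * u p y) \<le> C * (real p + (1 + norm (kexp TYPE('n)))) * (R\<^sup>2) ^ p * norm (u p y)"
        unfolding norm_mult by (rule mult_right_mono) simp
      also have "\<dots> = C * (real p + (1 + norm (kexp TYPE('n)))) * (norm (u p y) * (R\<^sup>2) ^ p)" by simp
      also have "\<dots> \<le> C * (real p + (1 + norm (kexp TYPE('n)))) * (D * fact (2 * p) * x ^ p)"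
        by (rule mult_left_mono[OF D(4)[OF y]]) (use C(1) in \<open>auto intro!: mult_nonneg_nonneg add_nonneg_nonneg\<close>)
      finally show "norm (cut_term (cut1 a b) (cut2 a b) 0 (l t) (z t) p y * u p y) \<le> C * (real p + (1 + norm (kexp TYPE('n)))) * (D * fact (2 * p) * x ^ p)" .
    qed
    then have "norm (kcoeff TYPE('n) p * cut_int 0 (l t) (z t) a b p) \<le> norm (kcoeff TYPE('n) p) * (V * (C * (real p + (1 + norm (kexp TYPE('n)))) * (D * fact (2 * p) * x ^ p)))"
      unfolding norm_mult by (rule mult_left_mono) simp
    also have "\<dots> = (V * C * D) * (norm (kcoeff TYPE('n) p) * fact (2 * p) * (real p + (1 + norm (kexp TYPE('n)))) * x ^ p)" by simp
    also have "\<dots> \<le> (V * C * D) * majorant x p"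
    proof (rule mult_left_mono)
      have "(real p + (1 + norm (kexp TYPE('n)))) * 1 \<le> (real p + (1 + norm (kexp TYPE('n)))) * (real p + (1 + norm (kexp TYPE('n))))"
        by (intro mult_left_mono) (auto simp: add_nonneg_nonneg add_increasing)
      then have "norm (kcoeff TYPE('n) p) * fact (2 * p) * (real p + (1 + norm (kexp TYPE('n)))) * x ^ p \<le> norm (kcoeff TYPE('n) p) * fact (2 * p) * (real p + (1 + norm (kexp TYPE('n))))\<^sup>2 * x ^ p"
        using D(2) by (intro mult_right_mono mult_left_mono) (auto simp: power2_eq_square)
      then show "norm (kcoeff TYPE('n) p) * fact (2 * p) * (real p + (1 + norm (kexp TYPE('n)))) * x ^ p \<le> majorant x p" by (simp add: majorant_def)
    qed (use V C(1) D(1) in simp)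
    finally show "norm (kcoeff TYPE('n) p * cut_int 0 (l t) (z t) a b p) \<le> (V * C * D) * majorant x p" .
  qed
qed

lemma remainder_tendsto_0:
  assumes "0 \<le> x" "x < 1"
  shows "(\<lambda>N. C * (norm (kcoeff TYPE('n) N) * (fact (2 * Suc N) * x ^ Suc N))) \<longlonglongrightarrow> 0"
proof -
  have m: "majorant x \<longlonglongrightarrow> 0" by (intro summable_LIMSEQ_zero summable_majorant assms)
  have "(\<lambda>N. norm (kcoeff TYPE('n) N) * (fact (2 * Suc N) * x ^ Suc N)) \<longlonglongrightarrow> 0"
  proof (rule Lim_null_comparison)
    have "norm (norm (kcoeff TYPE('n) N) * (fact (2 * Suc N) * x ^ Suc N)) \<le> 4 * x * majorant x N" for N
    proof -
      have "(2 * real N + 2) * (2 * real N + 1) \<le> 4 * (real N + (1 + norm (kexp TYPE('n))))\<^sup>2"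
      proof -
        have "(2 * real N + 2) * (2 * real N + 1) \<le> (2 * (real N + (1 + norm (kexp TYPE('n))))) * (2 * (real N + (1 + norm (kexp TYPE('n)))))"
          by (intro mult_mono) auto
        moreover have "(2 * X) * (2 * X) = 4 * X\<^sup>2" for X :: real by (simp add: power2_eq_square)
        ultimately show ?thesis by (simp only:)
      qed
      then have "norm (kcoeff TYPE('n) N) * fact (2 * N) * x ^ N * x * ((2 * real N + 2) * (2 * real N + 1)) \<le>
          norm (kcoeff TYPE('n) N) * fact (2 * N) * x ^ N * x * (4 * (real N + (1 + norm (kexp TYPE('n))))\<^sup>2)"
        using assms by (intro mult_left_mono) auto
      moreover have "fact (2 * Suc N) = (2 * real N + 2) * (2 * real N + 1) * fact (2 * N)"
        by (simp add: algebra_simps)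
      ultimately show ?thesis using assms by (simp add: majorant_def mult_ac abs_mult)
    qed
    then show "\<forall>\<^sub>F N in sequentially. norm (norm (kcoeff TYPE('n) N) * (fact (2 * Suc N) * x ^ Suc N)) \<le> 4 * x * majorant x N"
      by simp
    show "(\<lambda>N. 4 * x * majorant x N) \<longlonglongrightarrow> 0" using tendsto_mult_right_zero[OF m] by simp
  qed
  then show ?thesis using tendsto_mult_right_zero by blast
qed

definition cut_series :: "complex \<Rightarrow> complex^'n \<Rightarrow> real \<Rightarrow> real \<Rightarrow> complex" where
  "cut_series l z a b = (\<Sum>p. kcoeff TYPE('n) p * cut_int 0 l z a b p)"

lemma cut_radius:
  assumes "(Lie_plus z + b) * \<tau> < 1" "y \<in> shell a b"
  shows "norm (shifted_qform 0 z y) \<le> (Lie_plus z + b)\<^sup>2"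
  using assms cmod_shifted_qform_le[of z y] power_mono[of "Lie_plus z + norm y" "Lie_plus z + b" 2] Lie_plus_nonneg[of z]
  by (auto simp: shell_def intro: order_trans)

lemma cut_series_sums:
  assumes ab: "r0 < a" "a < b" "b < r1" and R: "(Lie_plus z + b) * \<tau> < 1" and reg: "regular 0 l z a b"
  shows "(\<lambda>p. kcoeff TYPE('n) p * cut_int 0 l z a b p) sums cut_series l z a b"
proof -
  have b0: "0 \<le> Lie_plus z + b" using r0 ab Lie_plus_nonneg[of z] by simp
  have "\<exists>C x. 0 \<le> x \<and> x < 1 \<and> (\<forall>t\<in>{0::nat}. \<forall>p. norm (kcoeff TYPE('n) p * cut_int 0 l z a b p) \<le> C * majorant x p)"
  proof (rule cut_int_bound[where T = "{0::nat}" and l = "\<lambda>_. l" and z = "\<lambda>_. z" and R = "Lie_plus z + b"])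
    show "norm (shifted_qform 0 z y) \<le> (Lie_plus z + b)\<^sup>2" if "y \<in> shell a b" for y :: "real^'n"
      by (rule cut_radius[OF R that])
  qed (use ab R b0 reg in auto)
  then obtain C x where C: "0 \<le> x" "x < 1" "\<And>p. norm (kcoeff TYPE('n) p * cut_int 0 l z a b p) \<le> C * majorant x p"
    by auto
  have "summable (\<lambda>p. kcoeff TYPE('n) p * cut_int 0 l z a b p)"
    by (rule summable_comparison_test'[OF summable_mult[OF summable_majorant[OF C(1,2)], of C], of 0]) (rule C(3))
  then show ?thesis unfolding cut_series_def by (rule summable_sums)
qed

lemma has_partial_cut_diff:
  "has_partial i (\<lambda>y. cut0 a b y - cut0 a' b' y) (cut1 a b i y - cut1 a' b' i y) y"
  "has_partial i (\<lambda>y. cut1 a b i y - cut1 a' b' i y) (cut2 a b i y - cut2 a' b' i y) y"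
  by (intro has_partial_diff has_partial_cut0 has_partial_cut1)+

lemma cut_diff_eq_0:
  assumes "r0 < a" "a < b" "r0 < a'" "a' < b'" "y \<notin> shell (min a a') (max b b')"
  shows "cut0 a b y - cut0 a' b' y = 0" "cut1 a b i y - cut1 a' b' i y = 0" "cut2 a b i y - cut2 a' b' i y = 0"
proof -
  consider "norm y \<le> a \<and> norm y \<le> a'" | "norm y \<ge> b \<and> norm y \<ge> b'"
  proof -
    have "\<not> (min a a' \<le> norm y \<and> norm y \<le> max b b')" using assms(5) unfolding shell_def by simp
    then have "norm y < min a a' \<or> max b b' < norm y" by (simp only: de_Morgan_conj not_le)
    then have "(norm y \<le> a \<and> norm y \<le> a') \<or> (norm y \<ge> b \<and> norm y \<ge> b')"
      by (simp only: min_less_iff_conj max_less_iff_conj) linarith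
    then show thesis using that by blast
  qed
  then have "cut0 a b y - cut0 a' b' y = 0 \<and> cut1 a b i y - cut1 a' b' i y = 0 \<and> cut2 a b i y - cut2 a' b' i y = 0"
  proof cases
    case 1
    then show ?thesis using cut_inner[of a b y i] cut_inner[of a' b' y i] assms r0 by simp
  next
    case 2
    then show ?thesis using cut_outer[of a b y i] cut_outer[of a' b' y i] assms r0 by simp
  qed
  then show "cut0 a b y - cut0 a' b' y = 0" "cut1 a b i y - cut1 a' b' i y = 0" "cut2 a b i y - cut2 a' b' i y = 0"
    by auto
qed

text \<open>The difference of two cutoffs has compact support. With e = 0 there are no error terms,
  so the partial sums of the difference telescope to a single remainder, which tends to 0. That
  remainder integrates over the region between the shells, hence regularity on their common
  hull.\<close>

lemma cut_series_independent:
  assumes ab: "r0 < a" "a < b" "b < r1" "r0 < a'" "a' < b'" "b' < r1"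
    and R: "(Lie_plus z + max b b') * \<tau> < 1" and reg: "regular 0 l z (min a a') (max b b')"
  shows "cut_series l z a b = cut_series l z a' b'"
proof -
  define K where "K = (shell (min a a') (max b b') :: (real^'n) set)"
  define M where "M = max b b'"
  define w where "w = (\<lambda>y :: real^'n. cut0 a b y - cut0 a' b' y :: complex)"
  have KG: "K \<subseteq> round_annulus r0 r1" unfolding K_def by (rule shell_subset) (use ab in auto)
  have cK: "compact K" by (simp add: K_def compact_shell)
  have sub: "shell a b \<subseteq> K" "shell a' b' \<subseteq> K" by (auto simp: K_def shell_def)
  have regs: "regular 0 l z a b" "regular 0 l z a' b'"
    using reg sub by (auto simp: regular_def K_def)
  have mono: "(Lie_plus z + b) * \<tau> \<le> (Lie_plus z + M) * \<tau>" "(Lie_plus z + b') * \<tau> \<le> (Lie_plus z + M) * \<tau>"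
    using \<tau> by (auto intro!: mult_right_mono simp: M_def)
  have Rs: "(Lie_plus z + b) * \<tau> < 1" "(Lie_plus z + b') * \<tau> < 1" using mono R by (auto simp: M_def)
  have regK: "\<And>y. y \<in> K \<Longrightarrow> shifted_qform 0 z y / l \<notin> \<real>\<^sub>\<le>\<^sub>0" using reg by (auto simp: regular_def K_def)
  have R0: "0 \<le> Lie_plus z + M" using ab r0 Lie_plus_nonneg[of z] by (simp add: M_def)
  have w0: "cut0 a b y - cut0 a' b' y = 0" "cut1 a b i y - cut1 a' b' i y = 0" "cut2 a b i y - cut2 a' b' i y = 0"
    if "y \<notin> K" for y i
    using cut_diff_eq_0(1)[OF ab(1,2,4,5), of y] cut_diff_eq_0(2,3)[OF ab(1,2,4,5), of y i] that by (simp_all add: K_def)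
  define D where "D = (\<lambda>N. \<Sum>p\<le>N. kcoeff TYPE('n) p * (cut_int 0 l z a b p - cut_int 0 l z a' b' p))"
  have tel: "D N = kcoeff TYPE('n) N * (LINT y:K|lborel. w y * kernel0 0 l z N y * u (Suc N) y)" for N
  proof -
    have "(\<Sum>p\<le>N. kcoeff TYPE('n) p * (LINT y:K|lborel. cut_term (\<lambda>i y. cut1 a b i y - cut1 a' b' i y) (\<lambda>i y. cut2 a b i y - cut2 a' b' i y) 0 l z p y * u p y)) =
      kcoeff TYPE('n) N * (LINT y:K|lborel. w y * kernel0 0 l z N y * u (Suc N) y) +
      (\<Sum>p\<le>N. kcoeff TYPE('n) p * (LINT y:K|lborel. w y * kernel_error 0 l z p y * u p y))"
      unfolding w_def
      by (rule cut_term_telescope[OF odd_dim cK KG open_round_annulus smooth has_partial_cut_diff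
            w0 _ _ _ regK])
         (intro continuous_intros continuous_on_cut | assumption)+
    moreover have "kernel_error 0 l z p y = 0" for p y by (simp add: kernel_error_def)
    ultimately show ?thesis
      unfolding D_def cut_int_diff[OF ab sub regs] by simp
  qed
  have cwk: "continuous_on K (\<lambda>y. w y * kernel0 0 l z 0 y)"
    unfolding w_def by (intro continuous_intros continuous_on_cut continuous_on_kernel(1) regK)
  obtain B where B: "B \<ge> 0" "\<And>y. y \<in> K \<Longrightarrow> norm (w y * kernel0 0 l z 0 y) \<le> B"
    by (rule bounded_continuous_compact[OF cK cwk]) blast
  obtain C x where C: "C \<ge> 0" "0 \<le> x" "x < 1"
    "\<And>p y. y \<in> K \<Longrightarrow> norm (u p y) * ((Lie_plus z + M + 0)\<^sup>2) ^ p \<le> C * fact (2 * p) * x ^ p"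
    unfolding K_def by (rule growth_shell[of "min a a'" "max b b'" "Lie_plus z + M + 0"]) (use ab R R0 in \<open>auto simp: M_def\<close>)
  define R' where "R' = Lie_plus z + M"
  have R'0: "R' > 0" using ab r0 Lie_plus_nonneg[of z] by (simp add: M_def R'_def)
  define V where "V = measure lborel K"
  have Dn: "norm (D N) \<le> (V * B * C / R'\<^sup>2) * (norm (kcoeff TYPE('n) N) * (fact (2 * Suc N) * x ^ Suc N))" for N
  proof -
    have "norm (LINT y:K|lborel. w y * kernel0 0 l z N y * u (Suc N) y) \<le> V * (B * (C * fact (2 * Suc N) * x ^ Suc N / R'\<^sup>2))"
      unfolding V_def
    proof (rule norm_set_integral_le[OF cK])
      show "continuous_on K (\<lambda>y. w y * kernel0 0 l z N y * u (Suc N) y)"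
        unfolding w_def by (intro continuous_intros continuous_on_cut continuous_on_kernel(1) regK continuous_on_u KG)
      fix y assume y: "y \<in> K"
      have k: "w y * kernel0 0 l z N y * u (Suc N) y = (w y * kernel0 0 l z 0 y) * (u (Suc N) y * shifted_qform 0 z y ^ N)"
        by (simp add: kernel0_def radial_power_def)
      have "norm (shifted_qform 0 z y) \<le> R'\<^sup>2"
        using cut_radius[OF R, of y "min a a'"] y by (simp add: K_def M_def R'_def)
      then have "norm (shifted_qform 0 z y ^ N) \<le> (R'\<^sup>2) ^ N"
        unfolding norm_power by (intro power_mono) auto
      then have "norm (u (Suc N) y * shifted_qform 0 z y ^ N) \<le> norm (u (Suc N) y) * (R'\<^sup>2) ^ N"
        unfolding norm_mult by (intro mult_left_mono) auto
      \<comment> \<open>The kernel has index N but the Laplacian power is N + 1, so one factor R'^2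
        is inserted and divided out again.\<close>
      also have "\<dots> = norm (u (Suc N) y) * (R'\<^sup>2) ^ Suc N / R'\<^sup>2" using R'0 by simp
      also have "\<dots> \<le> C * fact (2 * Suc N) * x ^ Suc N / R'\<^sup>2"
        using C(4)[OF y, of "Suc N"] by (intro divide_right_mono) (auto simp: R'_def)
      finally show "norm (w y * kernel0 0 l z N y * u (Suc N) y) \<le> B * (C * fact (2 * Suc N) * x ^ Suc N / R'\<^sup>2)"
        unfolding k norm_mult[of "w y * kernel0 0 l z 0 y"] using B(1) by (intro mult_mono B y) auto
    qed
    from mult_left_mono[OF this, of "norm (kcoeff TYPE('n) N)"] show ?thesis
      unfolding tel norm_mult by (simp add: mult_ac)
  qed
  have "D \<longlonglongrightarrow> 0"
    by (rule Lim_null_comparison[OF always_eventually[OF allI[OF Dn]] remainder_tendsto_0[OF C(2,3)]])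
  moreover have "D \<longlonglongrightarrow> cut_series l z a b - cut_series l z a' b'"
  proof -
    have "(\<lambda>p. kcoeff TYPE('n) p * cut_int 0 l z a b p - kcoeff TYPE('n) p * cut_int 0 l z a' b' p) sums (cut_series l z a b - cut_series l z a' b')"
      by (intro sums_diff cut_series_sums ab Rs regs)
    then show ?thesis unfolding D_def sums_def_le right_diff_distrib .
  qed
  ultimately show ?thesis using LIMSEQ_unique by fastforce
qed

end

section \<open>The representation formula\<close>

lemma radial_power_of_real:
  assumes "0 < \<rho>"
  shows "radial_power (kexp TYPE('n::finite)) 1 p (of_real \<rho>) = of_real (\<rho> ^ Suc p / sqrt \<rho> ^ CARD('n))"
proof -
  have k: "kexp TYPE('n) = of_real (1 - real CARD('n) / 2)" by (simp add: kexp_def)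
  have "sqrt \<rho> ^ CARD('n) = (\<rho> powr (1 / 2)) powr real CARD('n)"
    using assms by (simp add: powr_realpow powr_half_sqrt)
  also have "\<dots> = \<rho> powr (real CARD('n) / 2)" by (simp add: powr_powr)
  finally have "\<rho> powr (1 - real CARD('n) / 2) = \<rho> / sqrt \<rho> ^ CARD('n)"
    using assms by (simp add: powr_diff)
  moreover have "complex_of_real \<rho> powr of_real (1 - real CARD('n) / 2) = of_real (\<rho> powr (1 - real CARD('n) / 2))"
    using assms by (intro powr_of_real) simp
  ultimately show ?thesis
    unfolding radial_power_def k by simp
qed

lemma of_real_pos_notin_nonpos: "0 < \<rho> \<Longrightarrow> complex_of_real \<rho> / 1 \<notin> \<real>\<^sub>\<le>\<^sub>0"
  by (simp add: complex_nonpos_Reals_iff)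

context polyharmonic_annulus
begin

abbreviation \<rho> :: "real^'n \<Rightarrow> real \<Rightarrow> real^'n \<Rightarrow> real" where
  "\<rho> x \<delta> y \<equiv> (norm (x - y))\<^sup>2 + \<delta>\<^sup>2"

lemma shifted_qform_real: "shifted_qform (of_real (\<delta>\<^sup>2)) (complexify x) y = of_real (\<rho> x \<delta> y)"
  by (simp add: shifted_qform_complexify)

lemma kernel0_real:
  assumes "0 < \<delta>"
  shows "kernel0 (of_real (\<delta>\<^sup>2)) 1 (complexify x) p y = of_real (\<rho> x \<delta> y ^ Suc p / sqrt (\<rho> x \<delta> y) ^ CARD('n))"
  unfolding kernel0_def shifted_qform_real by (rule radial_power_of_real) (use assms in \<open>simp add: add_nonneg_pos\<close>)

lemma kernel_error_real:
  assumes "0 < \<delta>"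
  shows "kernel_error (of_real (\<delta>\<^sup>2)) 1 (complexify x) p y =
    4 * (of_nat p + kexp TYPE('n)) * (of_nat p + kexp TYPE('n) - 1) * of_real (\<rho> x \<delta> y ^ p) *
      of_real (\<delta>\<^sup>2 / sqrt ((norm (y - x))\<^sup>2 + \<delta>\<^sup>2) ^ (CARD('n) + 2))"
proof -
  define r where "r = \<rho> x \<delta> y"
  have r: "r > 0" using assms by (simp add: r_def add_nonneg_pos)
  have "\<delta>\<^sup>2 * (r ^ Suc p / sqrt r ^ CARD('n)) / r\<^sup>2 = r ^ p * (\<delta>\<^sup>2 / (sqrt r ^ CARD('n) * r))"
    using r by (simp add: field_simps power2_eq_square)
  also have "sqrt r ^ CARD('n) * r = sqrt r ^ (CARD('n) + 2)"
    using r by (simp add: power_add)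
  finally have "complex_of_real (\<delta>\<^sup>2) * of_real (r ^ Suc p / sqrt r ^ CARD('n)) / (of_real r)\<^sup>2
     = of_real (r ^ p) * of_real (\<delta>\<^sup>2 / sqrt r ^ (CARD('n) + 2))"
    by (simp only: of_real_mult[symmetric] of_real_power[symmetric] of_real_divide[symmetric])
  then show ?thesis
    unfolding kernel_error_def kernel0_real[OF assms] shifted_qform_real r_def norm_minus_commute[of y x]
    by (simp only: mult.assoc)
qed

text \<open>The point \<open>x\<close> lies off the shell, so |x - y|^2 + delta^2 stays positive
  there even at delta = 0. The integrand is then jointly continuous on a compact set and dominated
  convergence applies.\<close>

lemma cut_int_tendsto:
  assumes ab: "r0 < a" "b < r1" and x: "norm x < a \<or> b < norm x"
    and \<delta>: "\<delta> \<longlonglongrightarrow> 0" "\<And>n. \<delta> n \<in> {0..1}"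
  shows "(\<lambda>n. cut_int (of_real ((\<delta> n)\<^sup>2)) 1 (complexify x) a b p) \<longlonglongrightarrow> cut_int 0 1 (complexify x) a b p"
proof -
  define H where "H = (\<lambda>q. cut_term (cut1 a b) (cut2 a b) (of_real ((fst q)\<^sup>2)) 1 (complexify x) p (snd q) * u p (snd q))"
  define K where "K = (shell a b :: (real^'n) set)"
  have pos: "0 < \<rho> x t y" if "y \<in> K" for t y
  proof -
    have "x \<noteq> y" using x that by (auto simp: K_def shell_def)
    then show ?thesis by (simp add: add_pos_nonneg)
  qed
  have cH: "continuous_on ({0..1} \<times> K) H"
    unfolding H_def
  proof (intro continuous_on_mult continuous_on_cut_term)
    show "continuous_on ({0..1} \<times> K) (\<lambda>q. cut1 a b i (snd q))" "continuous_on ({0..1} \<times> K) (\<lambda>q. cut2 a b i (snd q))" for i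
      by (rule continuous_on_compose2[OF continuous_on_cut(2)[of UNIV]] continuous_on_compose2[OF continuous_on_cut(3)[of UNIV]],
          intro continuous_intros, simp)+
    show "continuous_on ({0..1} \<times> K) (\<lambda>q. u p (snd q))"
      by (rule continuous_on_compose2[OF continuous_on_u[OF shell_subset[OF ab]]]) (auto simp: K_def intro!: continuous_intros)
    show "shifted_qform (of_real ((fst q)\<^sup>2)) (complexify x) (snd q) / 1 \<notin> \<real>\<^sub>\<le>\<^sub>0" if "q \<in> {0..1} \<times> K" for q
      unfolding shifted_qform_real by (rule of_real_pos_notin_nonpos, rule pos) (use that in auto)
  qed (intro continuous_intros)+
  obtain B where B: "B \<ge> 0" "\<And>q. q \<in> {0..1} \<times> K \<Longrightarrow> norm (H q) \<le> B"
    by (rule bounded_continuous_compact[OF compact_Times[OF compact_Icc] cH]) (auto simp: K_def compact_shell)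
  have cK: "continuous_on K (\<lambda>y. H (t, y))" if "t \<in> {0..1}" for t
    by (rule continuous_on_compose2[OF cH]) (use that in \<open>auto intro!: continuous_intros\<close>)
  have int: "integrable lborel (\<lambda>y. indicator K y *\<^sub>R H (t, y))" if "t \<in> {0..1}" for t
    by (intro borel_integrable_compact cK that) (simp add: K_def compact_shell)
  have "(\<lambda>n. LINT y|lborel. indicator K y *\<^sub>R H (\<delta> n, y)) \<longlonglongrightarrow> (LINT y|lborel. indicator K y *\<^sub>R H (0, y))"
  proof (rule integral_dominated_convergence[where w = "\<lambda>y. indicator K y *\<^sub>R B"])
    show "(\<lambda>y. indicator K y *\<^sub>R H (0, y)) \<in> borel_measurable lborel"
      by (rule borel_measurable_integrable[OF int]) simp
    show "(\<lambda>y. indicator K y *\<^sub>R H (\<delta> n, y)) \<in> borel_measurable lborel" for n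
      by (rule borel_measurable_integrable[OF int[OF \<delta>(2)]])
    show "integrable lborel (\<lambda>y. indicator K y *\<^sub>R B)"
      by (intro borel_integrable_compact continuous_on_const) (simp add: K_def compact_shell)
    show "AE y in lborel. (\<lambda>n. indicator K y *\<^sub>R H (\<delta> n, y)) \<longlonglongrightarrow> indicator K y *\<^sub>R H (0, y)"
    proof (rule AE_I2)
      fix y
      show "(\<lambda>n. indicator K y *\<^sub>R H (\<delta> n, y)) \<longlonglongrightarrow> indicator K y *\<^sub>R H (0, y)"
      proof (cases "y \<in> K")
        case True
        have "(\<lambda>n. H (\<delta> n, y)) \<longlonglongrightarrow> H (0, y)"
          by (rule continuous_on_tendsto_compose[OF cH])
             (use True \<delta>(2) in \<open>auto intro!: tendsto_Pair \<delta>(1) always_eventually\<close>)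
        then show ?thesis by (intro tendsto_scaleR tendsto_const)
      qed simp
    qed
    show "AE y in lborel. norm (indicator K y *\<^sub>R H (\<delta> n, y)) \<le> indicator K y *\<^sub>R B" for n
      using B(2) \<delta>(2)[of n] by (intro AE_I2) (auto simp: indicator_def)
  qed
  then show ?thesis
    by (simp add: cut_int_def set_lebesgue_integral_def H_def K_def)
qed

text \<open>The coefficient 4 s (s - 1) = d (d - 2) of \<open>kernel_error\<close> at p = 0, times
  the mass of the approximate identity.\<close>

definition repr_const :: complex where
  "repr_const = 4 * kexp TYPE('n) * (kexp TYPE('n) - 1) * of_real (bump_mass TYPE('n))"

lemma repr_const_nonzero: "repr_const \<noteq> 0"
proof -
  have "kexp TYPE('n) \<noteq> 0" using kexp_nonint[OF odd_dim, of 0] by simp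
  moreover have "kexp TYPE('n) - 1 \<noteq> 0" by (simp add: kexp_def)
  ultimately show ?thesis using bump_mass_pos[where 'n='n] by (simp add: repr_const_def)
qed

text \<open>At the scale of the approximate identity the factor (|x - y|^2 + delta^2)^p tends to
  0^p, so only index 0 sees the value of \<open>f\<close>.\<close>

lemma error_tendsto:
  assumes ab: "r0 < a" "b' < r1" and x: "a < norm x" "norm x < b'"
    and cw: "\<And>S. continuous_on S w" and wx: "w x = 1"
    and \<delta>: "\<delta> \<longlonglongrightarrow> 0" "\<And>n. 0 < \<delta> n" "\<And>n. \<delta> n \<le> 1"
  shows "(\<lambda>n. LINT y:shell a b'|lborel. w y * kernel_error (of_real ((\<delta> n)\<^sup>2)) 1 (complexify x) p y * u p y)
    \<longlonglongrightarrow> (if p = 0 then repr_const * f x else 0)"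
proof -
  define K where "K = (shell a b' :: (real^'n) set)"
  have cK: "compact K" by (simp add: K_def compact_shell)
  have KG: "K \<subseteq> round_annulus r0 r1" unfolding K_def by (rule shell_subset[OF ab])
  define c where "c = 4 * (of_nat p + kexp TYPE('n)) * (of_nat p + kexp TYPE('n) - 1)"
  define \<psi> where "\<psi> = (\<lambda>y. indicator K y *\<^sub>R (w y * u p y))"
  define \<phi> where "\<phi> = (\<lambda>n y. \<psi> y * c * of_real (\<rho> x (\<delta> n) y ^ p))"
  have cwu: "continuous_on K (\<lambda>y. w y * u p y)" by (intro continuous_on_mult cw continuous_on_u KG)
  have [measurable]: "\<psi> \<in> borel_measurable borel"
    using borel_measurable_integrable[OF borel_integrable_compact[OF cK cwu]] by (simp add: \<psi>_def)
  obtain B where B: "B \<ge> 0" "\<And>y. y \<in> K \<Longrightarrow> norm (w y * u p y) \<le> B"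
    by (rule bounded_continuous_compact[OF cK cwu]) blast
  define Rm where "Rm = (norm x + b')\<^sup>2 + 1"
  have Rm: "\<rho> x (\<delta> n) y \<le> Rm" if "y \<in> K" for n y
  proof -
    have "norm (x - y) \<le> norm x + b'" using norm_triangle_ineq4[of x y] that by (simp add: K_def shell_def)
    then have "(norm (x - y))\<^sup>2 \<le> (norm x + b')\<^sup>2" by (intro power_mono) auto
    moreover have "(\<delta> n)\<^sup>2 \<le> 1" using \<delta>(2)[of n] \<delta>(3)[of n] by (simp add: abs_square_le_1)
    ultimately show ?thesis by (simp add: Rm_def)
  qed
  have eq: "(LINT y:K|lborel. w y * kernel_error (of_real ((\<delta> n)\<^sup>2)) 1 (complexify x) p y * u p y) =
     (LINT y|lborel. \<phi> n y * of_real ((\<delta> n)\<^sup>2 / sqrt ((norm (y - x))\<^sup>2 + (\<delta> n)\<^sup>2) ^ (CARD('n) + 2)))" for n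
    unfolding set_lebesgue_integral_def \<phi>_def \<psi>_def kernel_error_real[OF \<delta>(2)] c_def[symmetric]
    by (rule Bochner_Integration.integral_cong[OF refl]) (simp add: mult_ac scaleR_conv_of_real del: of_real_divide of_real_power of_real_add)
  have "(\<lambda>n. LINT y|lborel. \<phi> n y * of_real ((\<delta> n)\<^sup>2 / sqrt ((norm (y - x))\<^sup>2 + (\<delta> n)\<^sup>2) ^ (CARD('n) + 2)))
     \<longlonglongrightarrow> (\<psi> x * c * of_real (0 ^ p)) * of_real (bump_mass TYPE('n))"
  proof (rule tendsto_integral_bump[OF _ _ \<delta>(2)])
    show "\<phi> n \<in> borel_measurable borel" for n unfolding \<phi>_def by measurable
    show "norm (\<phi> n y) \<le> B * norm c * Rm ^ p" for n y
    proof (cases "y \<in> K")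
      case True
      have "norm (complex_of_real (\<rho> x (\<delta> n) y ^ p)) = \<rho> x (\<delta> n) y ^ p"
        by (simp add: norm_power flip: of_real_power of_real_add)
      also have "\<dots> \<le> Rm ^ p" by (intro power_mono Rm True) auto
      finally have "norm (complex_of_real (\<rho> x (\<delta> n) y ^ p)) \<le> Rm ^ p" .
      moreover have "norm (\<psi> y) \<le> B" using B(2)[OF True] True by (simp add: \<psi>_def)
      ultimately show ?thesis
        unfolding \<phi>_def norm_mult using B(1) by (intro mult_mono) auto
    next
      case False
      then show ?thesis using B(1) by (simp add: \<phi>_def \<psi>_def Rm_def)
    qed
    fix t :: "real^'n"
    define U where "U = {y :: real^'n. a < norm y \<and> norm y < b'}"
    have "open U"
      unfolding U_def by (intro open_Collect_conj open_Collect_less continuous_intros)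
    moreover have "continuous_on U \<psi>"
    proof (rule continuous_on_eq)
      show "continuous_on U (\<lambda>y. w y * u p y)"
        by (rule continuous_on_subset[OF cwu]) (auto simp: U_def K_def shell_def)
    qed (auto simp: \<psi>_def U_def K_def shell_def)
    ultimately have "isCont \<psi> x"
      using x by (simp add: continuous_on_eq_continuous_at U_def)
    moreover have lim: "(\<lambda>n. x + \<delta> n *\<^sub>R t) \<longlonglongrightarrow> x + 0 *\<^sub>R t" by (intro tendsto_intros \<delta>)
    ultimately have "(\<lambda>n. \<psi> (x + \<delta> n *\<^sub>R t)) \<longlonglongrightarrow> \<psi> x"
      by (intro isCont_tendsto_compose[of x \<psi>]) auto
    moreover have "(\<lambda>n. \<rho> x (\<delta> n) (x + \<delta> n *\<^sub>R t) ^ p) \<longlonglongrightarrow> \<rho> x 0 (x + 0 *\<^sub>R t) ^ p"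
      by (intro tendsto_intros \<delta>)
    ultimately show "(\<lambda>n. \<phi> n (x + \<delta> n *\<^sub>R t)) \<longlonglongrightarrow> \<psi> x * c * of_real (0 ^ p)"
      unfolding \<phi>_def by (intro tendsto_mult tendsto_const tendsto_of_real) simp_all
  qed
  moreover have "(\<psi> x * c * of_real (0 ^ p)) * of_real (bump_mass TYPE('n)) = (if p = 0 then repr_const * f x else 0)"
    using x wx by (auto simp: \<psi>_def K_def shell_def repr_const_def c_def mult_ac)
  ultimately show ?thesis
    unfolding K_def[symmetric] eq by (simp only:)
qed

text \<open>The order of limits matters: with N fixed, delta tends to 0 and the error terms turn
  into a multiple of \<open>f x\<close>; afterwards N tends to infinity. For this the remainder is
  bounded by a null sequence in N that does not involve delta.\<close>

lemma representation:
  assumes ab: "r0 < a" "a < b" "b < norm x" "norm x < a'" "a' < b'" "b' < r1"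
  shows "cut_series 1 (complexify x) a b - cut_series 1 (complexify x) a' b' = repr_const * f x"
proof -
  define z where "z = complexify x"
  define K where "K = (shell a b' :: (real^'n) set)"
  define w where "w = (\<lambda>y :: real^'n. cut0 a b y - cut0 a' b' y :: complex)"
  define \<delta> where "\<delta> = (\<lambda>n. 1 / (real n + 1))"
  have \<delta>: "\<delta> \<longlonglongrightarrow> 0" "\<And>n. 0 < \<delta> n" "\<And>n. \<delta> n \<le> 1"
    unfolding \<delta>_def by real_asymp auto
  have \<delta>01: "\<delta> n \<in> {0..1}" for n using \<delta>(2,3)[of n] by simp
  have cK: "compact K" by (simp add: K_def compact_shell)
  have ab': "r0 < a'" "b < r1" using ab by auto
  have KG: "K \<subseteq> round_annulus r0 r1" unfolding K_def by (rule shell_subset) (use ab in auto)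
  have sub: "shell a b \<subseteq> K" "shell a' b' \<subseteq> K" using ab by (auto simp: K_def shell_def)
  have K_eq: "K = shell (min a a') (max b b')" using ab by (simp add: K_def)
  \<comment> \<open>Strictly larger than \<open>norm x + b'\<close>, so that delta^2 still fits
    under R^2 for large n, while R \<tau> < 1 is the type condition.\<close>
  define R where "R = 2 * r1"
  have R: "norm x + b' < R" "R * \<tau> < 1" "0 < R"
    using ab r0 type_bound by (auto simp: R_def)
  have pos: "0 < \<rho> x (\<delta> n) y" for n y using \<delta>(2)[of n] by (simp add: add_nonneg_pos)
  have reg: "shifted_qform (of_real ((\<delta> n)\<^sup>2)) z y / 1 \<notin> \<real>\<^sub>\<le>\<^sub>0" for n y
    unfolding z_def shifted_qform_real by (rule of_real_pos_notin_nonpos[OF pos])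
  define Bn where "Bn = (\<lambda>n p. cut_int (of_real ((\<delta> n)\<^sup>2)) 1 z a b p - cut_int (of_real ((\<delta> n)\<^sup>2)) 1 z a' b' p)"
  define B0 where "B0 = (\<lambda>p. cut_int 0 1 z a b p - cut_int 0 1 z a' b' p)"
  define En where "En = (\<lambda>n p. LINT y:K|lborel. w y * kernel_error (of_real ((\<delta> n)\<^sup>2)) 1 z p y * u p y)"
  define Rn where "Rn = (\<lambda>n N. LINT y:K|lborel. w y * kernel0 (of_real ((\<delta> n)\<^sup>2)) 1 z N y * u (Suc N) y)"
  have w0: "cut0 a b y - cut0 a' b' y = 0" "cut1 a b i y - cut1 a' b' i y = 0" "cut2 a b i y - cut2 a' b' i y = 0"
    if "y \<notin> K" for y i
    using cut_diff_eq_0(1)[OF ab(1,2) ab'(1) ab(5), of y] cut_diff_eq_0(2,3)[OF ab(1,2) ab'(1) ab(5), of y i] that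
    by (simp_all add: K_eq)
  have tel: "(\<Sum>p\<le>N. kcoeff TYPE('n) p * Bn n p) = kcoeff TYPE('n) N * Rn n N + (\<Sum>p\<le>N. kcoeff TYPE('n) p * En n p)" for n N
  proof -
    have "(\<Sum>p\<le>N. kcoeff TYPE('n) p * (LINT y:K|lborel. cut_term (\<lambda>i y. cut1 a b i y - cut1 a' b' i y) (\<lambda>i y. cut2 a b i y - cut2 a' b' i y) (of_real ((\<delta> n)\<^sup>2)) 1 z p y * u p y)) =
      kcoeff TYPE('n) N * Rn n N + (\<Sum>p\<le>N. kcoeff TYPE('n) p * En n p)"
      unfolding w_def Rn_def En_def
      by (rule cut_term_telescope[OF odd_dim cK KG open_round_annulus smooth has_partial_cut_diff w0 _ _ _ reg])
         (intro continuous_intros continuous_on_cut | assumption)+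
    then show ?thesis
      unfolding Bn_def by (subst (asm) cut_int_diff) (use ab ab' sub reg in \<open>auto simp: regular_def\<close>)
  qed
  have limB: "(\<lambda>n. Bn n p) \<longlonglongrightarrow> B0 p" for p
    unfolding Bn_def B0_def z_def
    by (intro tendsto_diff cut_int_tendsto ab ab' \<delta> \<delta>01) (use ab in auto)
  have wx: "w x = 1"
    using cut_outer[of a b x] cut_inner[of a' b' x] ab r0 by (simp add: w_def)
  have limE: "(\<lambda>n. En n p) \<longlonglongrightarrow> (if p = 0 then repr_const * f x else 0)" for p
    unfolding En_def K_def z_def
    by (rule error_tendsto) (use ab \<delta> wx in \<open>auto simp: w_def intro!: continuous_intros continuous_on_cut\<close>)
  define D where "D = (\<lambda>N. (\<Sum>p\<le>N. kcoeff TYPE('n) p * B0 p) - repr_const * f x)"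
  have limD: "(\<lambda>n. kcoeff TYPE('n) N * Rn n N) \<longlonglongrightarrow> D N" for N
  proof -
    have "(\<lambda>n. (\<Sum>p\<le>N. kcoeff TYPE('n) p * Bn n p) - (\<Sum>p\<le>N. kcoeff TYPE('n) p * En n p)) \<longlonglongrightarrow>
      (\<Sum>p\<le>N. kcoeff TYPE('n) p * B0 p) - (\<Sum>p\<le>N. kcoeff TYPE('n) p * (if p = 0 then repr_const * f x else 0))"
      by (intro tendsto_diff tendsto_sum tendsto_mult tendsto_const limB limE)
    moreover have "(\<Sum>p\<le>N. kcoeff TYPE('n) p * (if p = 0 then repr_const * f x else 0)) = repr_const * f x"
      by (simp add: if_distrib cong: if_cong)
    ultimately show ?thesis by (simp add: tel D_def)
  qed
  have "continuous_on K w" unfolding w_def by (intro continuous_intros continuous_on_cut)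
  then obtain W where W: "W \<ge> 0" "\<And>y. y \<in> K \<Longrightarrow> norm (w y) \<le> W"
    using bounded_continuous_compact[OF cK, of w] by metis
  obtain C q where C: "C \<ge> 0" "0 \<le> q" "q < 1"
    "\<And>p y. y \<in> K \<Longrightarrow> norm (u p y) * (R\<^sup>2) ^ p \<le> C * fact (2 * p) * q ^ p"
    unfolding K_def by (rule growth_shell[OF ab(1,6) less_imp_le[OF R(3)] R(2)]) blast
  define V where "V = measure lborel K"
  have ev: "eventually (\<lambda>n. (norm x + b')\<^sup>2 + (\<delta> n)\<^sup>2 \<le> R\<^sup>2) sequentially"
  proof -
    have "(norm x + b')\<^sup>2 < R\<^sup>2" using R ab r0 by (intro power_strict_mono) (auto intro: add_nonneg_nonneg)
    moreover have "(\<lambda>n. (norm x + b')\<^sup>2 + (\<delta> n)\<^sup>2) \<longlonglongrightarrow> (norm x + b')\<^sup>2 + 0\<^sup>2" by (intro tendsto_intros \<delta>)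
    ultimately have "eventually (\<lambda>n. (norm x + b')\<^sup>2 + (\<delta> n)\<^sup>2 < R\<^sup>2) sequentially"
      by (intro order_tendstoD) auto
    then show ?thesis by eventually_elim simp
  qed
  define Q where "Q = V * W * C / R ^ CARD('n)"
  \<comment> \<open>For N >= d the exponent 2 (N + 1) - d of the regularised distance is
    nonnegative, so the kernel stays bounded at y = x uniformly in delta.\<close>
  have Dn: "norm (D N) \<le> Q * (norm (kcoeff TYPE('n) N) * (fact (2 * Suc N) * q ^ Suc N))" if N: "CARD('n) \<le> N" for N
  proof (rule Lim_norm_ubound[OF _ limD])
    have "norm (kcoeff TYPE('n) N * Rn n N) \<le> Q * (norm (kcoeff TYPE('n) N) * (fact (2 * Suc N) * q ^ Suc N))"
      if n: "(norm x + b')\<^sup>2 + (\<delta> n)\<^sup>2 \<le> R\<^sup>2" for n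
    proof -
      have "norm (Rn n N) \<le> V * (W * (C * fact (2 * Suc N) * q ^ Suc N / R ^ CARD('n)))"
        unfolding Rn_def V_def
      proof (rule norm_set_integral_le[OF cK])
        show "continuous_on K (\<lambda>y. w y * kernel0 (of_real ((\<delta> n)\<^sup>2)) 1 z N y * u (Suc N) y)"
          unfolding w_def by (intro continuous_intros continuous_on_cut continuous_on_kernel(1) reg continuous_on_u KG)
        fix y assume y: "y \<in> K"
        define r where "r = \<rho> x (\<delta> n) y"
        have r: "r > 0" using pos by (simp add: r_def)
        have "norm (x - y) \<le> norm x + b'" using norm_triangle_ineq4[of x y] y by (simp add: K_def shell_def)
        then have "(norm (x - y))\<^sup>2 \<le> (norm x + b')\<^sup>2" by (intro power_mono) auto
        then have "r \<le> R\<^sup>2" using n by (simp add: r_def)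
        then have sr: "sqrt r \<le> R" using R(3) by (intro real_le_lsqrt) auto
        have ds: "2 * Suc N = CARD('n) + (2 * Suc N - CARD('n))" using N by simp
        have "r ^ Suc N = sqrt r ^ (2 * Suc N)" using r by (simp only: power_mult real_sqrt_pow2 less_imp_le)
        also have "\<dots> = sqrt r ^ CARD('n) * sqrt r ^ (2 * Suc N - CARD('n))"
          using ds by (metis power_add)
        finally have "r ^ Suc N / sqrt r ^ CARD('n) = sqrt r ^ (2 * Suc N - CARD('n))"
          using r by simp
        also have "\<dots> \<le> R ^ (2 * Suc N - CARD('n))" using r by (intro power_mono sr) auto
        also have "\<dots> = (R\<^sup>2) ^ Suc N / R ^ CARD('n)"
        proof -
          have "R ^ (2 * Suc N) = R ^ CARD('n) * R ^ (2 * Suc N - CARD('n))"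
            using ds by (metis power_add)
          then show ?thesis using R(3) by (simp only: power_mult) simp
        qed
        finally have "norm (kernel0 (of_real ((\<delta> n)\<^sup>2)) 1 z N y) \<le> (R\<^sup>2) ^ Suc N / R ^ CARD('n)"
          unfolding z_def kernel0_real[OF \<delta>(2)] r_def[symmetric] norm_of_real using r by simp
        then have "norm (kernel0 (of_real ((\<delta> n)\<^sup>2)) 1 z N y) * norm (u (Suc N) y) \<le> (R\<^sup>2) ^ Suc N / R ^ CARD('n) * norm (u (Suc N) y)"
          by (rule mult_right_mono) simp
        also have "\<dots> = norm (u (Suc N) y) * (R\<^sup>2) ^ Suc N / R ^ CARD('n)" by simp
        also have "\<dots> \<le> C * fact (2 * Suc N) * q ^ Suc N / R ^ CARD('n)"
          using C(4)[OF y, of "Suc N"] R(3) by (intro divide_right_mono) auto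
        finally show "norm (w y * kernel0 (of_real ((\<delta> n)\<^sup>2)) 1 z N y * u (Suc N) y) \<le> W * (C * fact (2 * Suc N) * q ^ Suc N / R ^ CARD('n))"
          unfolding norm_mult mult.assoc[of "norm (w y)"] using W y by (intro mult_mono) auto
      qed
      from mult_left_mono[OF this, of "norm (kcoeff TYPE('n) N)"] show ?thesis
        unfolding norm_mult by (simp add: Q_def mult_ac)
    qed
    then show "eventually (\<lambda>n. norm (kcoeff TYPE('n) N * Rn n N) \<le> Q * (norm (kcoeff TYPE('n) N) * (fact (2 * Suc N) * q ^ Suc N))) sequentially"
      using ev by (rule eventually_mono[rotated])
  qed simp
  have "D \<longlonglongrightarrow> 0"
    by (rule Lim_null_comparison[OF _ remainder_tendsto_0[OF C(2,3), of Q]])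
       (use Dn in \<open>auto simp: eventually_sequentially\<close>)
  moreover have "D \<longlonglongrightarrow> (cut_series 1 z a b - cut_series 1 z a' b') - repr_const * f x"
  proof -
    have regs: "regular 0 1 z a b" "regular 0 1 z a' b'"
    proof -
      have reg0: "shifted_qform 0 z y / 1 \<notin> \<real>\<^sub>\<le>\<^sub>0" if "y \<noteq> x" for y
        using of_real_pos_notin_nonpos[of "\<rho> x 0 y"] shifted_qform_real[of 0 x y] that by (simp add: z_def)
      have "y \<noteq> x" if "y \<in> shell a b" for y using that ab by (auto simp: shell_def)
      then show "regular 0 1 z a b" unfolding regular_def by (intro ballI reg0)
      have "y \<noteq> x" if "y \<in> shell a' b'" for y using that ab by (auto simp: shell_def)
      then show "regular 0 1 z a' b'" unfolding regular_def by (intro ballI reg0)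
    qed
    have L: "Lie_plus z = norm x" by (simp add: z_def Lie_complexify)
    have "(Lie_plus z + b) * \<tau> \<le> R * \<tau>" "(Lie_plus z + b') * \<tau> \<le> R * \<tau>"
      unfolding L using R ab \<tau> by (auto intro!: mult_right_mono)
    then have Rs: "(Lie_plus z + b) * \<tau> < 1" "(Lie_plus z + b') * \<tau> < 1" using R(2) by auto
    have "(\<lambda>p. kcoeff TYPE('n) p * cut_int 0 1 z a b p - kcoeff TYPE('n) p * cut_int 0 1 z a' b' p) sums (cut_series 1 z a b - cut_series 1 z a' b')"
      by (intro sums_diff cut_series_sums ab ab' Rs regs)
    then have "(\<lambda>N. \<Sum>p\<le>N. kcoeff TYPE('n) p * B0 p) \<longlonglongrightarrow> cut_series 1 z a b - cut_series 1 z a' b'"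
      unfolding B0_def sums_def_le right_diff_distrib .
    then show ?thesis unfolding D_def by (intro tendsto_diff tendsto_const)
  qed
  ultimately have "(cut_series 1 z a b - cut_series 1 z a' b') - repr_const * f x = 0"
    using LIMSEQ_unique by blast
  then show ?thesis by (simp add: z_def)
qed

end

section \<open>Holomorphic extension\<close>

lemma norm_vec_upd_diff: "norm (vec_upd z j t - z) \<le> norm (t - z $ j)" for z :: "complex^'n::finite"
proof -
  have "norm (vec_upd z j t - z) \<le> (\<Sum>k\<in>UNIV. norm ((vec_upd z j t - z) $ k))"
    unfolding norm_vec_def by (rule L2_set_le_sum) simp
  also have "\<dots> = (\<Sum>k\<in>UNIV. if k = j then norm (t - z $ j) else 0)"
    by (intro sum.cong) auto
  finally show ?thesis by simp
qed

lemma vec_upd_in_ball: "t \<in> ball (z $ j) r \<Longrightarrow> vec_upd z j t \<in> ball z r" for z :: "complex^'n::finite"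
  using norm_vec_upd_diff[of z j t] by (simp add: dist_norm norm_minus_commute)

lemma continuous_on_vec_upd: "continuous_on S (vec_upd z j)" for z :: "complex^'n::finite"
  unfolding vec_upd_def[abs_def]
proof (rule continuous_on_vec_lambda)
  show "continuous_on S (\<lambda>t. if i = j then t else z $ i)" for i
    by (cases "i = j") (simp_all add: continuous_on_id)
qed

text \<open>Meant for functions whose defining formula changes with the point, such as a series over
  a shell that moves with \<open>z\<close>.\<close>

lemma sep_holomorphic_locallyI:
  assumes "\<And>a. a \<in> S \<Longrightarrow> \<exists>V s. open V \<and> a \<in> V \<and> sep_holomorphic V s \<and> (\<forall>z\<in>V. g z = s z)"
  shows "sep_holomorphic S g"
  unfolding sep_holomorphic_def
proof (intro ballI allI)
  fix a j assume "a \<in> S"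
  then obtain V s where V: "open V" "a \<in> V" "sep_holomorphic V s" "\<forall>z\<in>V. g z = s z"
    using assms by blast
  obtain r where r: "r > 0" "ball a r \<subseteq> V" using V openE by blast
  show "(\<lambda>t. g (vec_upd a j t)) field_differentiable at (a $ j)"
  proof (rule field_differentiable_transform_within[OF r(1)])
    show "(\<lambda>t. s (vec_upd a j t)) field_differentiable at (a $ j)"
      using V unfolding sep_holomorphic_def by blast
    fix t assume "dist t (a $ j) < r"
    then have "vec_upd a j t \<in> V" using vec_upd_in_ball[of t a j r] r(2) by (auto simp: dist_commute)
    then show "s (vec_upd a j t) = g (vec_upd a j t)" using V(4) by simp
  qed simp
qed

lemma locally_bounded_locallyI:
  assumes "\<And>a. a \<in> S \<Longrightarrow> \<exists>V s. open V \<and> a \<in> V \<and> locally_bounded V s \<and> (\<forall>z\<in>V. g z = s z)"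
  shows "locally_bounded S g"
  unfolding locally_bounded_def
proof
  fix a assume "a \<in> S"
  then obtain V s where V: "open V" "a \<in> V" "locally_bounded V s" "\<forall>z\<in>V. g z = s z"
    using assms by blast
  obtain r B where r: "r > 0" "\<forall>z\<in>ball a r \<inter> V. norm (s z) \<le> B"
    using V(2,3) unfolding locally_bounded_def by meson
  obtain r' where r': "r' > 0" "ball a r' \<subseteq> V" using V openE by blast
  have "norm (g z) \<le> B" if "z \<in> ball a (min r r') \<inter> S" for z
  proof -
    have "z \<in> ball a r \<inter> V" using that r'(2) by auto
    then show ?thesis using r(2) V(4) by simp
  qed
  then show "\<exists>r>0. \<exists>B. \<forall>z\<in>ball a r \<inter> S. norm (g z) \<le> B"
    using r(1) r'(1) by (intro exI[of _ "min r r'"] conjI exI[of _ B] ballI) auto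
qed

lemma sep_holomorphic_add_mult:
  assumes "sep_holomorphic S f" "sep_holomorphic S g"
  shows "sep_holomorphic S (\<lambda>z. f z + g z)" "sep_holomorphic S (\<lambda>z. f z * g z)"
  using assms unfolding sep_holomorphic_def
  by (auto intro!: field_differentiable_add field_differentiable_mult)

lemma locally_bounded_add_mult:
  assumes "locally_bounded S f" "locally_bounded S g"
  shows "locally_bounded S (\<lambda>z. f z + g z)" "locally_bounded S (\<lambda>z. f z * g z)"
proof -
  have "\<exists>r>0. \<exists>B\<ge>0. \<forall>z\<in>ball a r \<inter> S. norm (f z) \<le> B \<and> norm (g z) \<le> B" if a: "a \<in> S" for a
  proof -
    obtain r1 B1 where 1: "r1 > 0" "\<forall>z\<in>ball a r1 \<inter> S. norm (f z) \<le> B1"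
      using assms(1) a unfolding locally_bounded_def by meson
    obtain r2 B2 where 2: "r2 > 0" "\<forall>z\<in>ball a r2 \<inter> S. norm (g z) \<le> B2"
      using assms(2) a unfolding locally_bounded_def by meson
    have "norm (f z) \<le> max 0 (max B1 B2) \<and> norm (g z) \<le> max 0 (max B1 B2)" if "z \<in> ball a (min r1 r2) \<inter> S" for z
      using that 1(2)[rule_format, of z] 2(2)[rule_format, of z] by (auto simp: le_max_iff_disj)
    then show ?thesis
      using 1(1) 2(1) by (intro exI[of _ "min r1 r2"] conjI exI[of _ "max 0 (max B1 B2)"]) auto
  qed
  note b = this
  show "locally_bounded S (\<lambda>z. f z + g z)"
    unfolding locally_bounded_def
  proof
    fix a assume "a \<in> S"
    then obtain r B where r: "r > 0" "B \<ge> 0" "\<forall>z\<in>ball a r \<inter> S. norm (f z) \<le> B \<and> norm (g z) \<le> B" using b by meson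
    have "norm (f z + g z) \<le> B + B" if "z \<in> ball a r \<inter> S" for z
    proof -
      have "norm (f z) \<le> B" "norm (g z) \<le> B" using r(3) that by auto
      then show ?thesis using norm_triangle_ineq[of "f z" "g z"] by linarith
    qed
    then show "\<exists>r>0. \<exists>B. \<forall>z\<in>ball a r \<inter> S. norm (f z + g z) \<le> B" using r(1) by meson
  qed
  show "locally_bounded S (\<lambda>z. f z * g z)"
    unfolding locally_bounded_def
  proof
    fix a assume "a \<in> S"
    then obtain r B where r: "r > 0" "B \<ge> 0" "\<forall>z\<in>ball a r \<inter> S. norm (f z) \<le> B \<and> norm (g z) \<le> B" using b by meson
    have "norm (f z * g z) \<le> B * B" if "z \<in> ball a r \<inter> S" for z
      unfolding norm_mult using r that by (intro mult_mono) auto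
    then show "\<exists>r>0. \<exists>B. \<forall>z\<in>ball a r \<inter> S. norm (f z * g z) \<le> B" using r(1) by meson
  qed
qed

lemma sep_holomorphic_subset: "sep_holomorphic S g \<Longrightarrow> T \<subseteq> S \<Longrightarrow> sep_holomorphic T g"
  unfolding sep_holomorphic_def by blast

lemma locally_bounded_subset:
  assumes "locally_bounded S g" "T \<subseteq> S" shows "locally_bounded T g"
  unfolding locally_bounded_def
proof
  fix a assume "a \<in> T"
  then obtain r B where r: "r > 0" "\<forall>z\<in>ball a r \<inter> S. norm (g z) \<le> B"
    using assms unfolding locally_bounded_def by (meson subsetD)
  then show "\<exists>r>0. \<exists>B. \<forall>z\<in>ball a r \<inter> T. norm (g z) \<le> B"
    using assms(2) by (intro exI[of _ r]) (auto intro!: exI[of _ B])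
qed

lemma continuous_imp_locally_bounded:
  assumes "continuous_on S g" shows "locally_bounded S g"
  unfolding locally_bounded_def
proof
  fix a assume "a \<in> S"
  then obtain r where r: "r > 0" "\<forall>z\<in>S. dist z a < r \<longrightarrow> dist (g z) (g a) < 1"
    using assms unfolding continuous_on_iff by (meson zero_less_one)
  have "norm (g z) \<le> norm (g a) + 1" if "z \<in> ball a r \<inter> S" for z
  proof -
    have "norm (g z - g a) < 1" using r(2) that by (auto simp: dist_norm norm_minus_commute)
    then show ?thesis using norm_triangle_ineq2[of "g z" "g a"] by linarith
  qed
  then show "\<exists>r>0. \<exists>B. \<forall>z\<in>ball a r \<inter> S. norm (g z) \<le> B" using r(1) by meson
qed

lemma holomorphic_qform_slice: "(\<lambda>t. qform (vec_upd z j t)) holomorphic_on S"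
  unfolding qform_def
proof (rule holomorphic_on_sum)
  show "(\<lambda>t. (vec_upd z j t $ k)\<^sup>2) holomorphic_on S" for k
    by (cases "k = j") (auto intro!: holomorphic_intros)
qed

lemma holomorphic_shifted_qform_slice: "(\<lambda>t. shifted_qform 0 (vec_upd z j t) y) holomorphic_on S"
proof -
  have slice: "(\<lambda>t. (vec_upd z j t $ k - c)\<^sup>2) holomorphic_on S" for k c
    by (cases "k = j") (auto intro!: holomorphic_intros)
  show ?thesis
    unfolding shifted_qform_alt by (intro holomorphic_on_add holomorphic_on_sum holomorphic_on_const slice)
qed

lemma holomorphic_cut_term_slice:
  fixes z :: "complex^'n::finite"
  assumes L: "L holomorphic_on S" and reg: "\<And>t. t \<in> S \<Longrightarrow> shifted_qform 0 (vec_upd z j t) y / L t \<notin> \<real>\<^sub>\<le>\<^sub>0"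
  shows "(\<lambda>t. cut_term w1 w2 0 (L t) (vec_upd z j t) p y) holomorphic_on S"
proof -
  have nz: "shifted_qform 0 (vec_upd z j t) y \<noteq> 0" "L t \<noteq> 0" if "t \<in> S" for t
    using reg[OF that] by auto
  note P = holomorphic_shifted_qform_slice[of z j y S]
  have k: "(\<lambda>t. kernel0 0 (L t) (vec_upd z j t) 0 y) holomorphic_on S"
    unfolding kernel0_def radial_power_def power_0 mult_1
    by (intro holomorphic_on_powr holomorphic_on_divide P L holomorphic_on_const nz reg)
  have c: "(\<lambda>t. vec_upd z j t $ i - of_real (y $ i)) holomorphic_on S" for i
    by (cases "i = j") (auto intro!: holomorphic_intros)
  show ?thesis
    unfolding cut_term_factor by (intro holomorphic_intros P k c nz)
qed

section \<open>Analyticity of the series and construction of the two extensions\<close>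

context polyharmonic_annulus
begin

lemma cut_int_holomorphic:
  assumes ab: "r0 < a" "b < r1" and S: "open S" and L: "L holomorphic_on S"
    and reg: "\<And>t. t \<in> S \<Longrightarrow> regular 0 (L t) (vec_upd z j t) a b"
  shows "(\<lambda>t. cut_int 0 (L t) (vec_upd z j t) a b p) holomorphic_on S"
  unfolding holomorphic_on_def
proof
  fix t0 assume "t0 \<in> S"
  then obtain r where r: "r > 0" "cball t0 r \<subseteq> S" using S open_contains_cball by blast
  define K where "K = (shell a b :: (real^'n) set)"
  have cK: "compact K" by (simp add: K_def compact_shell)
  define H where "H = (\<lambda>(t, y). cut_term (cut1 a b) (cut2 a b) 0 (L t) (vec_upd z j t) p y * u p y)"
  have reg': "shifted_qform 0 (vec_upd z j t) y / L t \<notin> \<real>\<^sub>\<le>\<^sub>0" if "t \<in> cball t0 r" "y \<in> K" for t y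
    using reg[of t] that r(2) unfolding regular_def K_def by blast
  have cL: "continuous_on (cball t0 r) L"
    using continuous_on_subset[OF holomorphic_on_imp_continuous_on[OF L] r(2)] .
  have cH: "continuous_on (cball t0 r \<times> K) H"
    unfolding H_def case_prod_unfold
  proof (intro continuous_on_mult continuous_on_cut_term)
    show "continuous_on (cball t0 r \<times> K) (\<lambda>q. cut1 a b i (snd q))" "continuous_on (cball t0 r \<times> K) (\<lambda>q. cut2 a b i (snd q))" for i
      by (rule continuous_on_compose2[OF continuous_on_cut(2)[of UNIV]] continuous_on_compose2[OF continuous_on_cut(3)[of UNIV]],
          intro continuous_intros, simp)+
    show "continuous_on (cball t0 r \<times> K) (\<lambda>q. u p (snd q))"
      by (rule continuous_on_compose2[OF continuous_on_u[OF shell_subset[OF ab]]]) (auto simp: K_def intro!: continuous_intros)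
    show "continuous_on (cball t0 r \<times> K) (\<lambda>q. L (fst q))"
      by (rule continuous_on_compose2[OF cL]) (auto intro!: continuous_intros)
    show "continuous_on (cball t0 r \<times> K) (\<lambda>q. vec_upd z j (fst q))"
      by (rule continuous_on_compose2[OF continuous_on_vec_upd[of UNIV]]) (auto intro!: continuous_intros)
    show "shifted_qform 0 (vec_upd z j (fst q)) (snd q) / L (fst q) \<notin> \<real>\<^sub>\<le>\<^sub>0" if "q \<in> cball t0 r \<times> K" for q
      by (rule reg') (use that in auto)
  qed (intro continuous_intros)+
  obtain B where B: "B \<ge> 0" "\<And>q. q \<in> cball t0 r \<times> K \<Longrightarrow> norm (H q) \<le> B"
    by (rule bounded_continuous_compact[OF compact_Times[OF compact_cball cK] cH]) auto
  have "(\<lambda>t. LINT y|lborel. indicator K y *\<^sub>R H (t, y)) field_differentiable (at t0)"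
  proof (rule field_differentiable_integral_parameter[where f = "\<lambda>t y. indicator K y *\<^sub>R H (t, y)" and M = lborel
        and B = "\<lambda>y. indicator K y *\<^sub>R B", OF r(1)])
    show "(\<lambda>t. indicator K y *\<^sub>R H (t, y)) holomorphic_on ball t0 r" for y
    proof (cases "y \<in> K")
      case True
      have "(\<lambda>t. cut_term (cut1 a b) (cut2 a b) 0 (L t) (vec_upd z j t) p y) holomorphic_on ball t0 r"
        by (rule holomorphic_cut_term_slice[OF holomorphic_on_subset[OF L] reg'])
           (use True r(2) ball_subset_cball in auto)
      then show ?thesis using True by (auto simp: H_def intro!: holomorphic_intros)
    qed simp
    show "(\<lambda>y. indicator K y *\<^sub>R H (t, y)) \<in> borel_measurable lborel" if "t \<in> ball t0 r" for t
    proof (rule borel_measurable_integrable, rule borel_integrable_compact[OF cK])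
      show "continuous_on K (\<lambda>y. H (t, y))"
        by (rule continuous_on_compose2[OF cH]) (use that in \<open>auto intro!: continuous_intros\<close>)
    qed
    show "norm (indicator K y *\<^sub>R H (t, y)) \<le> indicator K y *\<^sub>R B" if "t \<in> ball t0 r" for t y
      using B(2)[of "(t, y)"] that by (cases "y \<in> K") auto
    show "integrable lborel (\<lambda>y. indicator K y *\<^sub>R B)"
      by (rule borel_integrable_compact[OF cK continuous_on_const])
  qed
  then have "(\<lambda>t. cut_int 0 (L t) (vec_upd z j t) a b p) field_differentiable at t0"
    by (simp add: cut_int_def set_lebesgue_integral_def H_def K_def)
  then show "(\<lambda>t. cut_int 0 (L t) (vec_upd z j t) a b p) field_differentiable at t0 within S"
    by (rule field_differentiable_at_within)
qed

text \<open>On a small ball all terms obey one summable majorant. This bounds the sum, and by the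
  M-test each one-variable slice is a uniform limit of holomorphic functions.\<close>

lemma cut_series_analytic:
  assumes ab: "r0 < a" "a < b" "b < r1" and U: "open U" and l: "continuous_on U l"
    and lhol: "\<And>z j S. (\<lambda>t. l (vec_upd z j t)) holomorphic_on S"
    and reg: "\<And>z. z \<in> U \<Longrightarrow> regular 0 (l z) z a b"
    and rad: "\<And>z. z \<in> U \<Longrightarrow> (Lie_plus z + b) * \<tau> < 1"
  shows "sep_holomorphic U (\<lambda>z. cut_series (l z) z a b)" "locally_bounded U (\<lambda>z. cut_series (l z) z a b)"
proof -
  have main: "\<exists>r>0. \<exists>M. summable M \<and> ball z0 r \<subseteq> U \<and> (\<forall>z\<in>ball z0 r. \<forall>p. norm (kcoeff TYPE('n) p * cut_int 0 (l z) z a b p) \<le> M p)"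
    if z0: "z0 \<in> U" for z0
  proof -
    obtain r where r: "r > 0" "cball z0 r \<subseteq> U" using U z0 open_contains_cball by blast
    \<comment> \<open>The largest L_+ on the closed ball gives a single radius for all its points.
      It is attained inside \<open>U\<close>, so the radius still satisfies the strict convergence
      condition.\<close>
    have "\<exists>zm\<in>cball z0 r. \<forall>z\<in>cball z0 r. Lie_plus z \<le> Lie_plus zm"
      by (rule continuous_attains_sup) (use r in \<open>auto intro: continuous_on_Lie\<close>)
    then obtain zm where zm: "zm \<in> cball z0 r" "\<And>z. z \<in> cball z0 r \<Longrightarrow> Lie_plus z \<le> Lie_plus zm" by blast
    have R0: "0 \<le> Lie_plus zm + b" using Lie_plus_nonneg[of zm] ab r0 by linarith
    have "\<exists>C x. 0 \<le> x \<and> x < 1 \<and> (\<forall>z\<in>cball z0 r. \<forall>p. norm (kcoeff TYPE('n) p * cut_int 0 (l z) z a b p) \<le> C * majorant x p)"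
    proof (rule cut_int_bound[where T = "cball z0 r" and l = l and z = "\<lambda>z. z" and R = "Lie_plus zm + b"])
      show "(Lie_plus zm + b) * \<tau> < 1" using rad[of zm] zm(1) r(2) by blast
      show "regular 0 (l z) z a b" if "z \<in> cball z0 r" for z using reg that r(2) by blast
      show "norm (shifted_qform 0 z y) \<le> (Lie_plus zm + b)\<^sup>2" if "z \<in> cball z0 r" "y \<in> shell a b" for z and y :: "real^'n"
      proof -
        have "norm (shifted_qform 0 z y) \<le> (Lie_plus z + b)\<^sup>2"
          by (rule cut_radius[OF rad that(2)]) (use that(1) r(2) in blast)
        also have "\<dots> \<le> (Lie_plus zm + b)\<^sup>2"
          using zm(2)[OF that(1)] Lie_plus_nonneg[of z] ab r0 by (intro power_mono) auto
        finally show ?thesis .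
      qed
      show "continuous_on (cball z0 r) l" using continuous_on_subset[OF l r(2)] .
    qed (use ab R0 in \<open>auto intro: continuous_on_id\<close>)
    then obtain C x where C: "0 \<le> x" "x < 1" "\<forall>z\<in>cball z0 r. \<forall>p. norm (kcoeff TYPE('n) p * cut_int 0 (l z) z a b p) \<le> C * majorant x p"
      by blast
    have "summable (\<lambda>p. C * majorant x p)" by (intro summable_mult summable_majorant C)
    then show ?thesis
      using r C(3) ball_subset_cball by (intro exI[of _ r] conjI exI[of _ "\<lambda>p. C * majorant x p"]) auto
  qed
  show "locally_bounded U (\<lambda>z. cut_series (l z) z a b)"
    unfolding locally_bounded_def
  proof
    fix z0 assume "z0 \<in> U"
    then obtain r M where r: "r > 0" "summable M"
      "\<forall>z\<in>ball z0 r. \<forall>p. norm (kcoeff TYPE('n) p * cut_int 0 (l z) z a b p) \<le> M p"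
      using main by meson
    have "norm (cut_series (l z) z a b) \<le> suminf M" if "z \<in> ball z0 r \<inter> U" for z
      unfolding cut_series_def by (rule norm_suminf_le[OF _ r(2)]) (use r(3) that in auto)
    then show "\<exists>r>0. \<exists>B. \<forall>z\<in>ball z0 r \<inter> U. norm (cut_series (l z) z a b) \<le> B" using r(1) by meson
  qed
  show "sep_holomorphic U (\<lambda>z. cut_series (l z) z a b)"
    unfolding sep_holomorphic_def
  proof (intro ballI allI)
    fix z0 j assume "z0 \<in> U"
    then obtain r M where r: "r > 0" "summable M" "ball z0 r \<subseteq> U"
      "\<forall>z\<in>ball z0 r. \<forall>p. norm (kcoeff TYPE('n) p * cut_int 0 (l z) z a b p) \<le> M p"
      using main by meson
    define S where "S = ball (z0 $ j) r"
    define Z where "Z = vec_upd z0 j"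
    have ZS: "Z t \<in> ball z0 r" if "t \<in> S" for t
      using that unfolding Z_def S_def by (rule vec_upd_in_ball)
    define h where "h = (\<lambda>p t. kcoeff TYPE('n) p * cut_int 0 (l (Z t)) (Z t) a b p)"
    have regZ: "regular 0 (l (Z t)) (Z t) a b" if "t \<in> S" for t
      by (rule reg[OF subsetD[OF r(3) ZS[OF that]]])
    have hh: "h p holomorphic_on S" for p
      unfolding h_def Z_def
      by (intro holomorphic_on_mult holomorphic_on_const cut_int_holomorphic ab lhol)
         (use regZ in \<open>auto simp: S_def Z_def\<close>)
    have ul: "uniform_limit S (\<lambda>n t. \<Sum>p<n. h p t) (\<lambda>t. suminf (\<lambda>p. h p t)) sequentially"
      by (rule Weierstrass_m_test[OF _ r(2)]) (use r(4) ZS in \<open>auto simp: h_def\<close>)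
    have "(\<lambda>t. suminf (\<lambda>p. h p t)) holomorphic_on S"
    proof (rule holomorphic_uniform_sequence)
      show "open S" by (simp add: S_def)
      show "(\<lambda>t. \<Sum>p<n. h p t) holomorphic_on S" for n by (intro holomorphic_on_sum hh)
      fix t assume "t \<in> S"
      then obtain d where d: "d > 0" "cball t d \<subseteq> S" unfolding S_def using open_contains_cball open_ball by blast
      then show "\<exists>d>0. cball t d \<subseteq> S \<and> uniform_limit (cball t d) (\<lambda>n t. \<Sum>p<n. h p t) (\<lambda>t. suminf (\<lambda>p. h p t)) sequentially"
        using uniform_limit_on_subset[OF ul d(2)] by blast
    qed
    moreover have "z0 $ j \<in> S" using r(1) by (simp add: S_def)
    ultimately have "(\<lambda>t. suminf (\<lambda>p. h p t)) field_differentiable at (z0 $ j)"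
      unfolding S_def by (metis holomorphic_on_imp_differentiable_at open_ball)
    then show "(\<lambda>t. cut_series (l (vec_upd z0 j t)) (vec_upd z0 j t) a b) field_differentiable at (z0 $ j)"
      by (simp add: cut_series_def h_def Z_def)
  qed
qed

text \<open>The shell sits at the third points between max r0 L_+(z) and r1: beyond L_+(z) and
  inside the annulus. The maximum is there because L_+(z) may fall below r0. The sign is that of the
  outer shell in the representation formula.\<close>

definition outer_part :: "complex^'n \<Rightarrow> complex" where
  "outer_part z = (let m = max r0 (Lie_plus z) in
     - cut_series 1 z (m + (r1 - m) / 3) (m + 2 * (r1 - m) / 3) / repr_const)"

text \<open>The minimum keeps the shell inside the annulus, since L_-(z) may exceed r1 on the domain
  of f2. Taking l = q(z) builds the division by the power of q(z) into the kernel, with a branch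
  that is continuous in \<open>z\<close>.\<close>

definition inner_part :: "complex^'n \<Rightarrow> complex" where
  "inner_part z = (let m = min r1 (Lie_minus z) in
     cut_series (qform z) z (r0 + (m - r0) / 3) (r0 + 2 * (m - r0) / 3) / repr_const)"

lemma third_points:
  fixes s t :: real
  assumes "s < t"
  shows "s < s + (t - s) / 3" "s + (t - s) / 3 < s + 2 * (t - s) / 3" "s + 2 * (t - s) / 3 < t"
  using assms by (simp_all add: field_simps)

lemma open_Lie_less: "open {z :: complex^'n. Lie_plus z < c}"
  by (intro open_Collect_less continuous_on_Lie continuous_intros)

lemma open_Lie_greater: "open {z :: complex^'n. c < Lie_minus z}"
  by (intro open_Collect_less continuous_on_Lie continuous_intros)

lemma sep_holomorphic_const: "sep_holomorphic U (\<lambda>_. c)"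
  by (simp add: sep_holomorphic_def)

lemma locally_bounded_const: "locally_bounded U (\<lambda>_. c)"
  by (rule continuous_imp_locally_bounded) simp

text \<open>The moving shell depends on \<open>z\<close> through L_+, hence not holomorphically. On
  \<open>V\<close> the shell belonging to \<open>z0\<close> is admissible for every
  \<open>z\<close>, and shell independence replaces the moving shell by this fixed one.\<close>

lemma outer_part_local:
  assumes "Lie_plus z0 < r1"
  shows "\<exists>V s. open V \<and> z0 \<in> V \<and> sep_holomorphic V s \<and> locally_bounded V s \<and> (\<forall>z\<in>V. outer_part z = s z)"
proof -
  define m where "m = (\<lambda>z. max r0 (Lie_plus (z :: complex^'n)))"
  define A where "A = (\<lambda>z. m z + (r1 - m z) / 3)"
  define B where "B = (\<lambda>z. m z + 2 * (r1 - m z) / 3)"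
  have AB: "r0 < A z" "Lie_plus z < A z" "A z < B z" "B z < r1" if "Lie_plus z < r1" for z
  proof -
    have m: "m z < r1" "r0 \<le> m z" "Lie_plus z \<le> m z" using that r01 by (auto simp: m_def)
    show "r0 < A z" "Lie_plus z < A z" "A z < B z" "B z < r1"
      using third_points[OF m(1)] m(2,3) unfolding A_def B_def by linarith+
  qed
  note AB0 = AB[OF assms]
  define V where "V = {z :: complex^'n. Lie_plus z < A z0}"
  have VL: "Lie_plus z < r1" if "z \<in> V" for z using that AB0 by (simp add: V_def)
  have reg: "regular 0 1 z a b" if "Lie_plus z < a" for z a b
    unfolding regular_def using shifted_qform_notin_nonpos[of z] that by (auto simp: shell_def)
  have rad: "(Lie_plus z + b) * \<tau> < 1" if "Lie_plus z < r1" "b < r1" for z b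
  proof -
    have "(Lie_plus z + b) * \<tau> \<le> (2 * r1) * \<tau>" using that \<tau> by (intro mult_right_mono) auto
    then show ?thesis using type_bound by linarith
  qed
  have V: "open V" unfolding V_def by (rule open_Lie_less)
  have an: "sep_holomorphic V (\<lambda>z. cut_series 1 z (A z0) (B z0))" "locally_bounded V (\<lambda>z. cut_series 1 z (A z0) (B z0))"
    by (rule cut_series_analytic[where l = "\<lambda>_. 1", OF AB0(1,3,4) V];
        use AB0 VL in \<open>auto intro: reg rad simp: V_def\<close>)+
  show ?thesis
  proof (intro exI[of _ V] exI[of _ "\<lambda>z. (- 1 / repr_const) * cut_series 1 z (A z0) (B z0)"] conjI ballI V)
    show "z0 \<in> V" using AB0 by (simp add: V_def)
    show "sep_holomorphic V (\<lambda>z. (- 1 / repr_const) * cut_series 1 z (A z0) (B z0))"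
      by (intro sep_holomorphic_add_mult(2) sep_holomorphic_const an)
    show "locally_bounded V (\<lambda>z. (- 1 / repr_const) * cut_series 1 z (A z0) (B z0))"
      by (intro locally_bounded_add_mult(2) locally_bounded_const an)
    fix z assume z: "z \<in> V"
    note ABz = AB[OF VL[OF z]]
    have "cut_series 1 z (A z) (B z) = cut_series 1 z (A z0) (B z0)"
      by (rule cut_series_independent[OF ABz(1,3,4) AB0(1,3,4)])
         (use ABz AB0 z VL[OF z] in \<open>auto intro!: reg rad simp: V_def\<close>)
    then show "outer_part z = (- 1 / repr_const) * cut_series 1 z (A z0) (B z0)"
      by (simp add: outer_part_def Let_def A_def B_def m_def)
  qed
qed

text \<open>As for the outer part, the shell of \<open>z0\<close> can be frozen; it stays admissible
  while L_- exceeds its outer radius and L_+ stays below 1/(2 \<tau>).\<close>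

lemma inner_part_local:
  assumes "r0 < Lie_minus z0" "2 * \<tau> * Lie_plus z0 < 1"
  shows "\<exists>V s. open V \<and> z0 \<in> V \<and> sep_holomorphic V s \<and> locally_bounded V s \<and> (\<forall>z\<in>V. inner_part z = s z)"
proof -
  define m where "m = (\<lambda>z. min r1 (Lie_minus (z :: complex^'n)))"
  define A where "A = (\<lambda>z. r0 + (m z - r0) / 3)"
  define B where "B = (\<lambda>z. r0 + 2 * (m z - r0) / 3)"
  have AB: "r0 < A z" "A z < B z" "B z < Lie_minus z" "B z < r1" if "r0 < Lie_minus z" for z
  proof -
    have m: "r0 < m z" "m z \<le> r1" "m z \<le> Lie_minus z" using that r01 by (auto simp: m_def)
    show "r0 < A z" "A z < B z" "B z < Lie_minus z" "B z < r1"
      using third_points[OF m(1)] m(2,3) unfolding A_def B_def by linarith+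
  qed
  note AB0 = AB[OF assms(1)]
  define V where "V = {z :: complex^'n. B z0 < Lie_minus z} \<inter> {z. 2 * \<tau> * Lie_plus z < 1}"
  have VL: "r0 < Lie_minus z" if "z \<in> V" for z using that AB0 by (simp add: V_def)
  have reg: "regular 0 (qform z) z a b" if "b < Lie_minus z" for z a b
    unfolding regular_def using shifted_qform_div_notin_nonpos[of _ z] that by (auto simp: shell_def)
  \<comment> \<open>Each of the two summands, L_+(z) \<tau> and b \<tau>, stays below 1/2.\<close>
  have rad: "(Lie_plus z + b) * \<tau> < 1" if "2 * \<tau> * Lie_plus z < 1" "b < r1" for z b
  proof -
    have "b * \<tau> \<le> r1 * \<tau>" using that \<tau> by (intro mult_right_mono) auto
    then show ?thesis using type_bound that(1) by (simp add: algebra_simps)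
  qed
  have V: "open V" unfolding V_def
    by (intro open_Int open_Lie_greater open_Collect_less continuous_on_Lie continuous_intros)
  have an: "sep_holomorphic V (\<lambda>z. cut_series (qform z) z (A z0) (B z0))" "locally_bounded V (\<lambda>z. cut_series (qform z) z (A z0) (B z0))"
    by (rule cut_series_analytic[where l = qform, OF AB0(1,2,4) V];
        use AB0 VL in \<open>auto intro: reg rad continuous_on_qform holomorphic_qform_slice simp: V_def\<close>)+
  show ?thesis
  proof (intro exI[of _ V] exI[of _ "\<lambda>z. (1 / repr_const) * cut_series (qform z) z (A z0) (B z0)"] conjI ballI V)
    show "z0 \<in> V" using AB0 assms by (simp add: V_def)
    show "sep_holomorphic V (\<lambda>z. (1 / repr_const) * cut_series (qform z) z (A z0) (B z0))"
      by (intro sep_holomorphic_add_mult(2) sep_holomorphic_const an)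
    show "locally_bounded V (\<lambda>z. (1 / repr_const) * cut_series (qform z) z (A z0) (B z0))"
      by (intro locally_bounded_add_mult(2) locally_bounded_const an)
    fix z assume z: "z \<in> V"
    note ABz = AB[OF VL[OF z]]
    have "cut_series (qform z) z (A z) (B z) = cut_series (qform z) z (A z0) (B z0)"
      by (rule cut_series_independent[OF ABz(1,2,4) AB0(1,2,4)])
         (use ABz AB0 z in \<open>auto intro!: reg rad simp: V_def\<close>)
    then show "inner_part z = (1 / repr_const) * cut_series (qform z) z (A z0) (B z0)"
      by (simp add: inner_part_def Let_def A_def B_def m_def)
  qed
qed

text \<open>At a real point both q(z) and q(z - y) are positive on the shell, so the principal
  powers multiply without a branch correction. This matches the inner series with l = q(z) to the
  one with l = 1 in the representation formula.\<close>

lemma powr_mult_cut_series: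
  assumes ab: "r0 < a" "a < b" "b < norm x" "b < r1" and rad: "(norm x + b) * \<tau> < 1"
  shows "qform (complexify x) powr kexp TYPE('n) * cut_series (qform (complexify x)) (complexify x) a b
    = cut_series 1 (complexify x) a b"
proof -
  define z where "z = complexify x"
  define \<kappa> where "\<kappa> = (norm x)\<^sup>2"
  have L: "Lie_minus z = norm x" "Lie_plus z = norm x" by (simp_all add: z_def Lie_complexify)
  have "norm x > 0" using ab r0 by linarith
  then have \<kappa>: "\<kappa> > 0" by (simp add: \<kappa>_def)
  have q: "qform z = of_real \<kappa>" by (simp add: z_def qform_complexify \<kappa>_def)
  have s: "kexp TYPE('n) = of_real (1 - real CARD('n) / 2)" by (simp add: kexp_def)
  have P: "shifted_qform 0 z y = of_real (\<rho> x 0 y)" for y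
    using shifted_qform_real[of 0 x y] by (simp add: z_def)
  have pos: "\<rho> x 0 y > 0" if "y \<in> shell a b" for y
  proof -
    have "x \<noteq> y" using that ab by (auto simp: shell_def)
    then show ?thesis by simp
  qed
  have ker: "qform z powr kexp TYPE('n) * kernel0 0 (qform z) z 0 y = kernel0 0 1 z 0 y" if "y \<in> shell a b" for y
  proof -
    have p: "0 < \<rho> x 0 y" by (rule pos[OF that])
    have d: "complex_of_real (\<rho> x 0 y) / of_real \<kappa> = of_real (\<rho> x 0 y / \<kappa>)" by (simp only: of_real_divide)
    have "\<kappa> powr e * (\<rho> x 0 y / \<kappa>) powr e = \<rho> x 0 y powr e" for e
      using p \<kappa> by (simp add: powr_divide)
    then show ?thesis
      unfolding kernel0_def radial_power_def P q s d power_0 mult_1 div_by_1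
      using p \<kappa> by (subst (1 2 3) powr_of_real) (auto simp flip: of_real_mult simp del: of_real_add of_real_power)
  qed
  have ct: "qform z powr kexp TYPE('n) * cut_term (cut1 a b) (cut2 a b) 0 (qform z) z p y = cut_term (cut1 a b) (cut2 a b) 0 1 z p y"
    if "y \<in> shell a b" for p y
    unfolding cut_term_factor ker[OF that, symmetric] by (simp add: algebra_simps)
  have ci: "qform z powr kexp TYPE('n) * cut_int 0 (qform z) z a b p = cut_int 0 1 z a b p" for p
  proof -
    have "qform z powr kexp TYPE('n) * cut_int 0 (qform z) z a b p =
      (LINT y:shell a b|lborel. qform z powr kexp TYPE('n) * (cut_term (cut1 a b) (cut2 a b) 0 (qform z) z p y * u p y))"
      by (simp add: cut_int_def)
    also have "\<dots> = cut_int 0 1 z a b p"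
      unfolding cut_int_def
      by (rule set_lebesgue_integral_cong)
         (use ct in \<open>auto simp: mult.assoc[symmetric] compact_shell compact_imp_closed borel_closed\<close>)
    finally show ?thesis .
  qed
  have "regular 0 (qform z) z a b"
    unfolding regular_def using shifted_qform_div_notin_nonpos[of _ z] ab(3) by (auto simp: shell_def L)
  then have "(\<lambda>p. kcoeff TYPE('n) p * cut_int 0 (qform z) z a b p) sums cut_series (qform z) z a b"
    by (intro cut_series_sums ab) (use rad in \<open>simp add: L\<close>)
  from sums_mult[OF this, of "qform z powr kexp TYPE('n)"]
  have "(\<lambda>p. kcoeff TYPE('n) p * cut_int 0 1 z a b p) sums (qform z powr kexp TYPE('n) * cut_series (qform z) z a b)"
    by (simp only: mult.left_commute[of "qform z powr kexp TYPE('n)"] ci)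
  then show ?thesis
    unfolding z_def[symmetric] cut_series_def[of 1] by (rule sums_unique)
qed

lemma outer_inner_representation:
  assumes x: "r0 < norm x" "norm x < r1"
  shows "outer_part (complexify x) + qform (complexify x) powr kexp TYPE('n) * inner_part (complexify x) = f x"
proof -
  define z where "z = complexify x"
  define a b where "a = r0 + (norm x - r0) / 3" and "b = r0 + 2 * (norm x - r0) / 3"
  define a' b' where "a' = norm x + (r1 - norm x) / 3" and "b' = norm x + 2 * (r1 - norm x) / 3"
  have ab: "r0 < a" "a < b" "b < norm x" using third_points[OF x(1)] by (simp_all add: a_def b_def)
  have ab': "norm x < a'" "a' < b'" "b' < r1" using third_points[OF x(2)] by (simp_all add: a'_def b'_def)
  have i: "inner_part z = cut_series (qform z) z a b / repr_const"
    using x by (simp add: inner_part_def z_def Lie_complexify a_def b_def Let_def)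
  have o: "outer_part z = - cut_series 1 z a' b' / repr_const"
    using x by (simp add: outer_part_def z_def Lie_complexify a'_def b'_def Let_def max_def)
  have "(norm x + b) * \<tau> \<le> (2 * r1) * \<tau>" using ab x \<tau> by (intro mult_right_mono) auto
  then have "qform z powr kexp TYPE('n) * cut_series (qform z) z a b = cut_series 1 z a b"
    unfolding z_def using ab x type_bound by (intro powr_mult_cut_series) auto
  moreover have "cut_series 1 z a b - cut_series 1 z a' b' = repr_const * f x"
    unfolding z_def by (rule representation[OF ab ab'])
  ultimately have "outer_part z + qform z powr kexp TYPE('n) * inner_part z = (repr_const * f x) / repr_const"
    unfolding i o times_divide_eq_right by (simp add: diff_divide_distrib[symmetric] add_divide_distrib[symmetric])
  then show ?thesis using repr_const_nonzero by (simp add: z_def)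
qed

end

section \<open>Assembly of the extension theorem\<close>

theorem mainTheorem16:
  fixes f :: "real^'n::finite \<Rightarrow> complex"
    and r0 :: real and r1 :: ereal and \<tau> :: real
  assumes "odd CARD('n)" and "CARD('n) > 1"
    and "0 \<le> r0" and "ereal r0 < r1"
    and "0 \<le> \<tau>" and "r1 < inv_two \<tau>"
    and "polyharmonic_inf_type (annulus r0 r1) \<tau> f"
  shows "\<exists>f1 f2 :: complex^'n \<Rightarrow> complex.
     analytic_on_Cn {z. ereal (Lie_plus z) < r1} f1 \<and>
     analytic_on_Cn {z. r0 < Lie_minus z \<and> Lie_minus z \<le> Lie_plus z
                        \<and> ereal (Lie_plus z) < inv_two \<tau>} f2 \<and>
     (let F = (\<lambda>z. f1 z + qform z powr (complex_of_real ((2 - real CARD('n)) / 2)) * f2 z)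
      in analytic_on_Cn (Lie_annulus r0 r1 - qform -` {w. w \<in> \<real> \<and> Re w \<le> 0}) F \<and>
         (\<forall>x\<in>annulus r0 r1. F (complexify x) = f x))"
proof -
  \<comment> \<open>The strict inequality makes r1 finite even when \<tau> = 0 and the right-hand
    side is infinite.\<close>
  have "r1 \<noteq> \<infinity>" using assms(6) by auto
  then obtain R1 where R1: "r1 = ereal R1" using assms(4) by (cases r1) auto
  have ann: "annulus r0 r1 = {x :: real^'n. r0 < norm x \<and> norm x < R1}"
    by (auto simp: annulus_def R1)
  have inv_two: "ereal c < inv_two \<tau> \<longleftrightarrow> 2 * \<tau> * c < 1" for c
    using assms(5) by (cases "\<tau> = 0") (auto simp: inv_two_def field_simps)
  interpret polyharmonic_annulus f r0 R1 \<tau>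
  proof
    show "2 * R1 * \<tau> < 1" using assms(6) inv_two[of R1] by (simp add: R1 mult_ac)
    show "smooth_on {x. r0 < norm x \<and> norm x < R1} f"
      using assms(7) by (simp add: polyharmonic_inf_type_def ann)
    show "\<exists>C>0. \<forall>p. \<forall>x\<in>K. norm ((laplacian ^^ p) f x) \<le> C * fact (2 * p) * (\<tau> + \<epsilon>) ^ (2 * p)"
      if "compact K" "K \<subseteq> {x. r0 < norm x \<and> norm x < R1}" "0 < \<epsilon>" for K \<epsilon>
      using assms(7) that unfolding polyharmonic_inf_type_def ann by blast
  qed (use assms R1 in auto)
  have e: "complex_of_real ((2 - real CARD('n)) / 2) = kexp TYPE('n)"
    by (simp add: kexp_def field_simps)
  define S1 where "S1 = {z :: complex^'n. ereal (Lie_plus z) < r1}"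
  define S2 where "S2 = {z :: complex^'n. r0 < Lie_minus z \<and> Lie_minus z \<le> Lie_plus z \<and> ereal (Lie_plus z) < inv_two \<tau>}"
  define D where "D = Lie_annulus r0 r1 - qform -` {w. w \<in> \<real> \<and> Re w \<le> 0} \<inter> (UNIV :: (complex^'n) set)"
  have S1: "z \<in> S1 \<longleftrightarrow> Lie_plus z < R1" for z by (simp add: S1_def R1)
  have S2: "z \<in> S2 \<longleftrightarrow> r0 < Lie_minus z \<and> 2 * \<tau> * Lie_plus z < 1" for z
    using Lie_minus_le_plus[of z] by (auto simp: S2_def inv_two)
  have neg: "{w. w \<in> \<real> \<and> Re w \<le> 0} = \<real>\<^sub>\<le>\<^sub>0"
    by (auto simp: complex_nonpos_Reals_iff complex_is_Real_iff)
  have D: "z \<in> D \<longleftrightarrow> r0 < Lie_minus z \<and> Lie_plus z < R1 \<and> qform z \<notin> \<real>\<^sub>\<le>\<^sub>0" for z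
    unfolding D_def neg by (simp add: Lie_annulus_def R1)
  have "S1 = {z. Lie_plus z < R1}" "S2 = {z. r0 < Lie_minus z} \<inter> {z. 2 * \<tau> * Lie_plus z < 1}"
    using S1 S2 by auto
  then have opens: "open S1" "open S2"
    by (auto intro!: open_Lie_less open_Lie_greater open_Int open_Collect_less continuous_on_Lie continuous_intros)
  have "open (qform -` (- \<real>\<^sub>\<le>\<^sub>0) :: (complex^'n) set)"
    by (intro open_vimage continuous_on_qform open_Compl closed_nonpos_Reals_complex)
  moreover have "D = {z. r0 < Lie_minus z} \<inter> {z. Lie_plus z < R1} \<inter> qform -` (- \<real>\<^sub>\<le>\<^sub>0)" using D by auto
  ultimately have openD: "open D"
    by (auto intro!: open_Int open_Lie_less open_Lie_greater)
  have DS: "D \<subseteq> S1" "D \<subseteq> S2"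
  proof -
    show "D \<subseteq> S1" using D S1 by auto
    show "D \<subseteq> S2"
    proof
      fix z assume "z \<in> D"
      then have z: "r0 < Lie_minus z" "Lie_plus z < R1" using D by auto
      have "2 * \<tau> * Lie_plus z \<le> 2 * \<tau> * R1" using z(2) assms(5) by (intro mult_left_mono) auto
      then have "2 * \<tau> * Lie_plus z < 1" using type_bound by (simp add: mult_ac)
      then show "z \<in> S2" using z S2 by simp
    qed
  qed
  have f1: "sep_holomorphic S1 outer_part" "locally_bounded S1 outer_part"
  proof -
    have ex: "\<exists>V s. open V \<and> a \<in> V \<and> sep_holomorphic V s \<and> locally_bounded V s \<and> (\<forall>z\<in>V. outer_part z = s z)"
      if "a \<in> S1" for a using outer_part_local[of a] that S1 by simp
    show "sep_holomorphic S1 outer_part" by (rule sep_holomorphic_locallyI) (use ex in meson)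
    show "locally_bounded S1 outer_part" by (rule locally_bounded_locallyI) (use ex in meson)
  qed
  have f2: "sep_holomorphic S2 inner_part" "locally_bounded S2 inner_part"
  proof -
    have ex: "\<exists>V s. open V \<and> a \<in> V \<and> sep_holomorphic V s \<and> locally_bounded V s \<and> (\<forall>z\<in>V. inner_part z = s z)"
      if "a \<in> S2" for a using inner_part_local[of a] that S2 by simp
    show "sep_holomorphic S2 inner_part" by (rule sep_holomorphic_locallyI) (use ex in meson)
    show "locally_bounded S2 inner_part" by (rule locally_bounded_locallyI) (use ex in meson)
  qed
  have q: "sep_holomorphic D (\<lambda>z. qform z powr kexp TYPE('n))"
    unfolding sep_holomorphic_def
  proof (intro ballI allI)
    fix z j assume "z \<in> D"
    then have nz: "qform (vec_upd z j (z $ j)) \<notin> \<real>\<^sub>\<le>\<^sub>0" using D by simp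
    have "(\<lambda>t. qform (vec_upd z j t)) field_differentiable at (z $ j)"
      by (rule holomorphic_on_imp_differentiable_at[OF holomorphic_qform_slice open_UNIV]) simp
    then obtain d where "((\<lambda>t. qform (vec_upd z j t)) has_field_derivative d) (at (z $ j))"
      by (auto simp: field_differentiable_def)
    from DERIV_chain2[OF has_field_derivative_powr[OF nz, of "kexp TYPE('n)"] this]
    show "(\<lambda>t. qform (vec_upd z j t) powr kexp TYPE('n)) field_differentiable at (z $ j)"
      by (auto simp: field_differentiable_def)
  qed
  have qb: "locally_bounded D (\<lambda>z. qform z powr kexp TYPE('n))"
  proof (rule continuous_imp_locally_bounded)
    have "continuous_on (- \<real>\<^sub>\<le>\<^sub>0) (\<lambda>v::complex. v powr kexp TYPE('n))"
      by (intro continuous_at_imp_continuous_on ballI DERIV_isCont[OF has_field_derivative_powr]) auto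
    then show "continuous_on D (\<lambda>z. qform z powr kexp TYPE('n))"
      by (rule continuous_on_compose2[OF _ continuous_on_qform]) (use D in auto)
  qed
  note sub = sep_holomorphic_subset[OF f1(1) DS(1)] sep_holomorphic_subset[OF f2(1) DS(2)]
    locally_bounded_subset[OF f1(2) DS(1)] locally_bounded_subset[OF f2(2) DS(2)]
  have F: "analytic_on_Cn D (\<lambda>z. outer_part z + qform z powr kexp TYPE('n) * inner_part z)"
    by (intro analytic_on_Cn_Osgood openD locally_bounded_add_mult sep_holomorphic_add_mult q qb sub)
  have "analytic_on_Cn S1 outer_part" "analytic_on_Cn S2 inner_part"
    by (intro analytic_on_Cn_Osgood opens f1 f2)+
  moreover have "outer_part (complexify x) + qform (complexify x) powr kexp TYPE('n) * inner_part (complexify x) = f x"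
    if "x \<in> annulus r0 r1" for x
    using that unfolding ann by (intro outer_inner_representation) auto
  ultimately show ?thesis
    using F unfolding e Let_def S1_def S2_def D_def Int_UNIV_right by blast
qed

end
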